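(* Let $d>0$ be a real number and let $f$ be a graph parameter. There exists a $[-d,d]$-graphon $W$ such that $f(F)=t(F,W)$ for all multigraphs $F$ if and only if $f$ is normalized, multiplicative, weakly reflection positive, and satisfies $|f(K_2^k)|\le d^k$ for all integers $k\ge 0$.
   Context: A multigraph is a finite undirected graph in which multiple edges are allowed and loops are excluded; for distinct nodes $i,j$ of a multigraph $F$, $F_{i,j}$ denotes the number of edges joining $i$ and $j$. A graph parameter is a real-valued function on multigraphs that is invariant under isomorphism. It is normalized if $f(K_1)=1$, where $K_1$ is the one-node graph, and multiplicative if $f(F_1\cup F_2)=f(F_1)f(F_2)$ for all multigraphs $F_1,F_2$, where $F_1\cup F_2$ is the disjoint union. $K_2^k$ is the multigraph with two nodes joined by $k$ parallel edges. For $n\ge 1$, let $\mathcal{F}_n$ be the set of multigraphs with node set exactly $\{1,\dots,n\}$. The product $F_1F_2$ of $F_1,F_2\in\mathcal{F}_n$ is the multigraph on $\{1,\dots,n\}$ obtained by adding edge multiplicities, $(F_1F_2)_{i,j}=(F_1)_{i,j}+(F_2)_{i,j}$. Let $\mathcal{P}_n$ be the real vector space of formal finite linear combinations of elements of $\mathcal{F}_n$, with the product extended bilinearly, and extend $f$ linearly to $\mathcal{P}_n$. The parameter $f$ is weakly reflection positive if $f(p^2)\ge 0$ for every $n$ and every $p\in\mathcal{P}_n$. Let $\mathcal{P}[-d,d]$ be the set of Borel probability measures on $[-d,d]$ with the weak topology. A $[-d,d]$-graphon is a symmetric function $W:[0,1]^2\to\mathcal{P}[-d,d]$ that is measurable with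 respect to the Borel sets of $\mathcal{P}[-d,d]$. Put $W_k(x,y)=\int_{[-d,d]} s^k\,dW(x,y)(s)$ for $k\ge 0$ (so $W_0\equiv 1$). For a multigraph $F$ with $V(F)=\{1,\dots,m\}$, $$t(F,W)=\int_{[0,1]^m}\prod_{1\le i<j\le m}W_{F_{i,j}}(x_i,x_j)\,dx_1\cdots dx_m .$$ *)

theory Defs
  imports "HOL-Probability.Probability" "HOL-Library.Poly_Mapping" "HOL-Library.Nat_Bijection"
begin

text \<open>
  Nodes are natural numbers; since graph parameters are isomorphism invariant, this loses no
  generality. The function component gives the number of edges joining two nodes.
\<close>

typedef multigraph =
  "{(V :: nat set, m :: nat \<Rightarrow> nat \<Rightarrow> nat).
     finite V \<and> (\<forall>i j. m i j = m j i) \<and> (\<forall>i. m i i = 0) \<and>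
     (\<forall>i j. m i j \<noteq> 0 \<longrightarrow> i \<in> V \<and> j \<in> V)}"
  by (rule exI[of _ "({}, \<lambda>_ _. 0)"]) auto

setup_lifting type_definition_multigraph

lift_definition nodes :: "multigraph \<Rightarrow> nat set" is fst .

lift_definition edge_mult :: "multigraph \<Rightarrow> nat \<Rightarrow> nat \<Rightarrow> nat" is snd .

lift_definition K1 :: multigraph is "({1}, \<lambda>_ _. 0)"
  by auto

lift_definition K2 :: "nat \<Rightarrow> multigraph" is
  "\<lambda>k. ({1, 2}, \<lambda>i j. if {i, j} = {1, 2} then k else 0)"
  by (auto simp: doubleton_eq_iff)

text \<open>
  The node \<open>i\<close> of the first graph becomes \<open>sum_encode (Inl i)\<close>, the node \<open>j\<close> of the second
  graph becomes \<open>sum_encode (Inr j)\<close>.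
\<close>

lift_definition disjoint_union :: "multigraph \<Rightarrow> multigraph \<Rightarrow> multigraph" is
  "\<lambda>(V\<^sub>1, m\<^sub>1) (V\<^sub>2, m\<^sub>2). (sum_encode ` (V\<^sub>1 <+> V\<^sub>2),
     \<lambda>a b. case (sum_decode a, sum_decode b) of
       (Inl i, Inl j) \<Rightarrow> m\<^sub>1 i j
     | (Inr i, Inr j) \<Rightarrow> m\<^sub>2 i j
     | _ \<Rightarrow> 0)"
  by (auto simp: image_iff Bex_def split: sum.splits prod.splits)
     (metis InlI InrI sum_decode_inverse)+

text \<open>
  On a common node set this is the product of the graphs: multiplicities are added.
\<close>

lift_definition gluing :: "multigraph \<Rightarrow> multigraph \<Rightarrow> multigraph" is
  "\<lambda>(V\<^sub>1, m\<^sub>1) (V\<^sub>2, m\<^sub>2). (V\<^sub>1 \<union> V\<^sub>2, \<lambda>i j. m\<^sub>1 i j + m\<^sub>2 i j)"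
  by fastforce

definition isomorphic :: "multigraph \<Rightarrow> multigraph \<Rightarrow> bool" where
  "isomorphic F G \<longleftrightarrow> (\<exists>\<phi>. bij_betw \<phi> (nodes F) (nodes G) \<and>
     (\<forall>i\<in>nodes F. \<forall>j\<in>nodes F. edge_mult G (\<phi> i) (\<phi> j) = edge_mult F i j))"

definition graph_parameter :: "(multigraph \<Rightarrow> real) \<Rightarrow> bool" where
  "graph_parameter f \<longleftrightarrow> (\<forall>F G. isomorphic F G \<longrightarrow> f F = f G)"

definition normalized :: "(multigraph \<Rightarrow> real) \<Rightarrow> bool" where
  "normalized f \<longleftrightarrow> f K1 = 1"

definition multiplicative :: "(multigraph \<Rightarrow> real) \<Rightarrow> bool" where
  "multiplicative f \<longleftrightarrow> (\<forall>F\<^sub>1 F\<^sub>2. f (disjoint_union F\<^sub>1 F\<^sub>2) = f F\<^sub>1 * f F\<^sub>2)"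

definition graphs_on :: "nat \<Rightarrow> multigraph set" where
  "graphs_on n = {F. nodes F = {1..n}}"

definition quantum_graphs :: "nat \<Rightarrow> (multigraph \<Rightarrow>\<^sub>0 real) set" where
  "quantum_graphs n = {p. Poly_Mapping.keys p \<subseteq> graphs_on n}"

definition quantum_mult ::
    "(multigraph \<Rightarrow>\<^sub>0 real) \<Rightarrow> (multigraph \<Rightarrow>\<^sub>0 real) \<Rightarrow> (multigraph \<Rightarrow>\<^sub>0 real)" where
  "quantum_mult p q = (\<Sum>F\<in>Poly_Mapping.keys p. \<Sum>G\<in>Poly_Mapping.keys q.
     Poly_Mapping.single (gluing F G) (Poly_Mapping.lookup p F * Poly_Mapping.lookup q G))"

definition linear_extension :: "(multigraph \<Rightarrow> real) \<Rightarrow> (multigraph \<Rightarrow>\<^sub>0 real) \<Rightarrow> real" where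
  "linear_extension f p = (\<Sum>F\<in>Poly_Mapping.keys p. Poly_Mapping.lookup p F * f F)"

definition weakly_reflection_positive :: "(multigraph \<Rightarrow> real) \<Rightarrow> bool" where
  "weakly_reflection_positive f \<longleftrightarrow>
     (\<forall>n\<ge>1. \<forall>p\<in>quantum_graphs n. linear_extension f (quantum_mult p p) \<ge> 0)"

definition borel_prob_measures :: "real \<Rightarrow> real measure set" where
  "borel_prob_measures d = {\<mu>. prob_space \<mu> \<and> sets \<mu> = sets (restrict_space borel {-d..d})}"

text \<open>
  The coarsest topology for which \<open>\<mu> \<mapsto> \<integral>g d\<mu>\<close> is continuous for every continuous (hence bounded)
  \<open>g\<close> on \<open>[-d, d]\<close>.
\<close>

definition weak_topology :: "real \<Rightarrow> real measure topology" where
  "weak_topology d = topology_generated_by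
     {{\<mu> \<in> borel_prob_measures d. (\<integral>s. g s \<partial>\<mu>) \<in> U} | (g :: real \<Rightarrow> real) U.
        continuous_on {-d..d} g \<and> open U}"

definition weak_borel :: "real \<Rightarrow> real measure measure" where
  "weak_borel d = sigma (borel_prob_measures d) {U. openin (weak_topology d) U}"

text \<open>
  As usual for functions on \<open>[0, 1]\<^sup>2\<close>, measurability on the domain is Lebesgue measurability.
  Membership in the measurable functions includes that the values lie in
  \<^term>\<open>borel_prob_measures d\<close>.
\<close>

definition graphon :: "real \<Rightarrow> (real \<Rightarrow> real \<Rightarrow> real measure) \<Rightarrow> bool" where
  "graphon d W \<longleftrightarrow>
     (\<forall>x\<in>{0..1}. \<forall>y\<in>{0..1}. W x y = W y x) \<and>
     (\<lambda>(x, y). W x y) \<in> lebesgue_on ({0..1} \<times> {0..1}) \<rightarrow>\<^sub>M weak_borel d"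

definition moment :: "(real \<Rightarrow> real \<Rightarrow> real measure) \<Rightarrow> nat \<Rightarrow> real \<Rightarrow> real \<Rightarrow> real" where
  "moment W k x y = (\<integral>s. s ^ k \<partial>W x y)"

text \<open>
  Lebesgue measure on \<open>[0, 1]\<^sup>V\<close>. The completion is needed because the integrands built from a
  Lebesgue measurable \<open>W\<close> need not be measurable for the product \<open>\<sigma>\<close>-algebra.
\<close>

definition unit_cube :: "nat set \<Rightarrow> (nat \<Rightarrow> real) measure" where
  "unit_cube V = completion (\<Pi>\<^sub>M i\<in>V. restrict_space lborel {0..1})"

definition hom_density :: "multigraph \<Rightarrow> (real \<Rightarrow> real \<Rightarrow> real measure) \<Rightarrow> real" where
  "hom_density F W =
     (\<integral>x. (\<Prod>(i, j)\<in>{(i, j). i \<in> nodes F \<and> j \<in> nodes F \<and> i < j}.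
              moment W (edge_mult F i j) (x i) (x j)) \<partial>unit_cube (nodes F))"

end

theory Submission imports Defs begin

text \<open>
  Conversely to the elementary direction, a weakly reflection positive \<open>f\<close> defines a functional on
  polynomials in edge variables that is nonnegative on squares; together with the growth bound on
  the moments of a single variable the Cauchy--Schwarz inequality makes it nonnegative on products of
  factors \<open>d \<plusminus> x\<^sub>e\<close>. These values are the cylinder probabilities of an array of random signs, with
  infinitely many copies for every edge, whose distribution is invariant under relabelling the
  nodes. Following Aldous and Hoover, infinitely many nodes are kept as a background. Given the
  background and the rows of edges that join the sampled nodes to it, the edges between sampled nodes
  are independent, and given the background the rows are independent and identically distributed:
  enlarging the background does not change the distribution of a conditional expectation, so it
  does not change the conditional expectation either. Hence \<open>f\<close> is the mean of \<open>t(\<cdot>, W)\<close> for a random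
  kernel \<open>W\<close> that depends on the background. By multiplicativity \<open>t(F, W)\<close> has variance 0, so almost every
  realization of \<open>W\<close> will do.
\<close>

section \<open>Random bits with prescribed correlations\<close>

text \<open>Signs serve in place of edge weights for two reasons. A multiplicity k becomes a product
  over k distinct copies of an edge, so only square-free products occur, and the law of the array is
  given by its Walsh correlations, with cylinder probabilities that are finite sums. Cutting [0,1]
  into nested intervals of these lengths realizes the array as a function \<open>bits_of\<close> of
  one uniform number, without an extension theorem. The same device, applied to correlations
  conditioned on the background, replaces regular conditional distributions: it turns a uniform node
  type x into a random row. The weight distribution W(x,y) is recovered only at the end, by de
  Finetti's theorem for the copies of one edge: d^k times the correlation of k copies is its k-th
  moment. Moments also carry the measurability, since by Weierstrass approximation they determine
  the weak topology. The recurring obstacle: conditional expectations are fixed only up to null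
  sets, while a graphon needs a true measure at every point; hence the truncations, the default
  values and the reduction to countably many conditions.\<close>

definition unit01 :: "real measure" where
  "unit01 = restrict_space lborel {0..1}"

definition Bits :: "(nat \<Rightarrow> bool) measure" where
  "Bits = (\<Pi>\<^sub>M n\<in>UNIV. count_space UNIV)"

definition sgnb :: "bool \<Rightarrow> real" where
  "sgnb b = (if b then 1 else -1)"

definition walsh :: "nat set \<Rightarrow> (nat \<Rightarrow> bool) \<Rightarrow> real" where
  "walsh K \<omega> = (\<Prod>n\<in>K. sgnb (\<omega> n))"

lemma sgnb_simps [simp]: "sgnb True = 1" "sgnb False = -1" "\<bar>sgnb b\<bar> = 1" "sgnb b * sgnb b = 1"
  by (auto simp: sgnb_def)

lemma abs_walsh [simp]: "\<bar>walsh K \<omega>\<bar> = 1"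
  by (simp add: walsh_def abs_prod)

lemma walsh_empty [simp]: "walsh {} \<omega> = 1"
  by (simp add: walsh_def)

lemma walsh_insert: "finite K \<Longrightarrow> n \<notin> K \<Longrightarrow> walsh (insert n K) \<omega> = sgnb (\<omega> n) * walsh K \<omega>"
  by (simp add: walsh_def)

lemma walsh_Un: "finite K \<Longrightarrow> finite L \<Longrightarrow> K \<inter> L = {} \<Longrightarrow> walsh (K \<union> L) \<omega> = walsh K \<omega> * walsh L \<omega>"
  by (simp add: walsh_def prod.union_disjoint)

lemma space_Bits [simp]: "space Bits = UNIV"
  by (simp add: Bits_def space_PiM PiE_def)

lemma measurable_Bits_component [measurable]: "(\<lambda>\<omega>. \<omega> n) \<in> Bits \<rightarrow>\<^sub>M count_space UNIV"
  unfolding Bits_def by (rule measurable_component_singleton) simp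

lemma measurable_sgnb [measurable]: "sgnb \<in> count_space UNIV \<rightarrow>\<^sub>M borel"
  by simp

lemma measurable_walsh [measurable]: "walsh K \<in> borel_measurable Bits"
  unfolding walsh_def by measurable

lemma measurable_BitsI:
  assumes "\<And>n. (\<lambda>x. f x n) \<in> M \<rightarrow>\<^sub>M count_space UNIV"
  shows "f \<in> M \<rightarrow>\<^sub>M Bits"
  unfolding Bits_def by (rule measurable_PiM_single') (auto simp: assms)

lemma prob_space_unit01 [intro, simp]: "prob_space unit01"
  unfolding unit01_def by (intro prob_spaceI) (simp add: emeasure_restrict_space space_restrict_space)

lemma space_unit01 [simp]: "space unit01 = {0..1}"
  by (simp add: unit01_def space_restrict_space)

lemma measurable_ident_unit01 [measurable]: "(\<lambda>u. u) \<in> unit01 \<rightarrow>\<^sub>M borel"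
  unfolding unit01_def by (rule measurable_restrict_space1) simp

text \<open>
  The number \<open>u\<close> is mapped to the bits of the nested intervals it lies in: the cylinder of the bit
  list \<open>s\<close> is an interval of length \<open>p s\<close> with left end point \<open>lft p s\<close>.
\<close>

definition lft :: "(bool list \<Rightarrow> real) \<Rightarrow> bool list \<Rightarrow> real" where
  "lft p s = (\<Sum>i<length s. if s ! i then p (take i s @ [False]) else 0)"

primrec pref :: "(bool list \<Rightarrow> real) \<Rightarrow> real \<Rightarrow> nat \<Rightarrow> bool list" where
  "pref p u 0 = []"
| "pref p u (Suc n) = pref p u n @ [lft p (pref p u n) + p (pref p u n @ [False]) \<le> u]"

definition bitseq :: "(bool list \<Rightarrow> real) \<Rightarrow> real \<Rightarrow> nat \<Rightarrow> bool" where
  "bitseq p u n \<longleftrightarrow> lft p (pref p u n) + p (pref p u n @ [False]) \<le> u"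

lemma length_pref [simp]: "length (pref p u n) = n"
  by (induction n) auto

lemma pref_Suc_eq: "pref p u (Suc n) = s @ [b] \<longleftrightarrow> pref p u n = s \<and> bitseq p u n = b"
  by (auto simp: bitseq_def)

lemma lft_Nil [simp]: "lft p [] = 0"
  by (simp add: lft_def)

lemma lft_snoc: "lft p (s @ [b]) = lft p s + (if b then p (s @ [False]) else 0)"
  unfolding lft_def by (auto simp: nth_append intro!: sum.cong)

locale cylinder_prob =
  fixes p :: "bool list \<Rightarrow> real"
  assumes p_Nil: "p [] = 1"
    and p_nonneg: "0 \<le> p s"
    and p_split: "p s = p (s @ [False]) + p (s @ [True])"
begin

lemma lft_bounds: "0 \<le> lft p s \<and> lft p s + p s \<le> 1"
proof (induction s rule: rev_induct)
  case (snoc b s)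
  then show ?case
    using p_nonneg[of "s @ [b]"] p_nonneg[of "s @ [False]"] p_nonneg[of "s @ [True]"] p_split[of s]
    by (cases b) (auto simp: lft_snoc)
qed (simp add: p_Nil)

text \<open>The half-open interval of a list is cut at exactly the threshold that
  \<open>pref\<close> tests, so the two children partition it even if one of them has length 0. The
  price of half-open intervals is the point 1, a null set.\<close>

lemma pref_eq_iff:
  assumes "0 \<le> u" "u < 1"
  shows "pref p u n = s \<longleftrightarrow> length s = n \<and> lft p s \<le> u \<and> u < lft p s + p s"
proof (induction n arbitrary: s)
  case 0
  then show ?case using assms by (auto simp: p_Nil)
next
  case (Suc n)
  show ?case
  proof (cases s rule: rev_cases)
    case Nil
    then show ?thesis by auto
  next
    case (snoc t b)
    have "pref p u (Suc n) = s \<longleftrightarrow> pref p u n = t \<and> bitseq p u n = b"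
      unfolding snoc by (rule pref_Suc_eq)
    also have "\<dots> \<longleftrightarrow> pref p u n = t \<and> (lft p t + p (t @ [False]) \<le> u) = b"
      by (auto simp: bitseq_def)
    also have "\<dots> \<longleftrightarrow> length s = Suc n \<and> lft p s \<le> u \<and> u < lft p s + p s"
      using p_nonneg[of "t @ [False]"] p_nonneg[of "t @ [True]"] p_split[of t]
      unfolding Suc snoc by (cases b) (auto simp: lft_snoc)
    finally show ?thesis .
  qed
qed

lemma measure_pref:
  assumes [measurable]: "(\<lambda>u. pref p u n) \<in> unit01 \<rightarrow>\<^sub>M count_space UNIV"
  assumes "length s = n"
  shows "(\<integral>u. of_bool (pref p u n = s) \<partial>unit01) = p s"
proof -
  have ne: "AE u in unit01. u \<noteq> 1"
    unfolding unit01_def using AE_lborel_singleton[of 1]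
    by (subst AE_restrict_space_iff) (auto elim!: eventually_mono)
  have "(\<integral>u. of_bool (pref p u n = s) \<partial>unit01) = (\<integral>u. (indicator {lft p s..<lft p s + p s} u :: real) \<partial>unit01)"
  proof (rule integral_cong_AE)
    show "AE u in unit01. of_bool (pref p u n = s) = (indicator {lft p s..<lft p s + p s} u :: real)"
      using ne AE_space
    proof eventually_elim
      case (elim u)
      then have "pref p u n = s \<longleftrightarrow> u \<in> {lft p s..<lft p s + p s}"
        by (subst pref_eq_iff) (auto simp: assms(2))
      then show ?case by (simp add: indicator_def)
    qed
  qed measurable
  also have "\<dots> = (\<integral>u. indicator {0..1} u * indicator {lft p s..<lft p s + p s} u \<partial>lborel)"
    unfolding unit01_def by (subst integral_restrict_space) simp_all
  also have "\<dots> = (\<integral>u. indicator {lft p s..<lft p s + p s} u \<partial>lborel)"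
    using lft_bounds[of s] by (intro Bochner_Integration.integral_cong) (auto simp: indicator_def)
  also have "\<dots> = p s"
    using p_nonneg[of s] by simp
  finally show ?thesis .
qed

end

text \<open>If \<open>g A\<close> is the mean of the product of signs X_i over i in A, this is the
  mean of the product over i < \<open>length s\<close> of (1 + \<open>sgnb (s ! i)\<close> X_i) / 2,
  that is, the probability that the first bits are \<open>s\<close>.\<close>

definition genp :: "(nat set \<Rightarrow> real) \<Rightarrow> bool list \<Rightarrow> real" where
  "genp g s = (\<Sum>A\<in>Pow {..<length s}. (\<Prod>i\<in>A. sgnb (s ! i)) * g A) / 2 ^ length s"

definition bits_of :: "(nat set \<Rightarrow> real) \<Rightarrow> real \<Rightarrow> nat \<Rightarrow> bool" where
  "bits_of g = bitseq (genp g)"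

lemma sum_Pow_lessThan_Suc:
  fixes h :: "nat set \<Rightarrow> real"
  shows "(\<Sum>A\<in>Pow {..<Suc n}. h A) = (\<Sum>A\<in>Pow {..<n}. h A) + (\<Sum>A\<in>Pow {..<n}. h (insert n A))"
proof -
  have "Pow {..<Suc n} = Pow {..<n} \<union> insert n ` Pow {..<n}"
    by (simp add: lessThan_Suc Pow_insert)
  moreover have "Pow {..<n} \<inter> insert n ` Pow {..<n} = {}" by auto
  moreover have "inj_on (insert n) (Pow {..<n})"
  proof (rule inj_onI)
    fix A B assume "A \<in> Pow {..<n}" "B \<in> Pow {..<n}" "insert n A = insert n B"
    moreover from this have "n \<notin> A" "n \<notin> B" by auto
    ultimately show "A = B" by (simp add: insert_ident)
  qed
  ultimately show ?thesis by (simp add: sum.union_disjoint sum.reindex)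
qed

lemma genp_snoc:
  assumes "length s = n"
  shows "genp g (s @ [b]) = (genp g s + sgnb b * genp (\<lambda>A. g (insert n A)) s) / 2"
proof -
  have 1: "(\<Prod>i\<in>A. sgnb ((s @ [b]) ! i)) = (\<Prod>i\<in>A. sgnb (s ! i))" if "A \<subseteq> {..<n}" for A
    using that assms by (intro prod.cong) (auto simp: nth_append)
  have 2: "(\<Prod>i\<in>insert n A. sgnb ((s @ [b]) ! i)) = sgnb b * (\<Prod>i\<in>A. sgnb (s ! i))" if "A \<subseteq> {..<n}" for A
  proof -
    have "finite A" "n \<notin> A" using that by (auto intro: finite_subset)
    then show ?thesis using 1[OF that] assms by (simp add: nth_append)
  qed
  have "(\<Sum>A\<in>Pow {..<n}. (\<Prod>i\<in>A. sgnb ((s @ [b]) ! i)) * g A) = (\<Sum>A\<in>Pow {..<n}. (\<Prod>i\<in>A. sgnb (s ! i)) * g A)"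
    by (intro sum.cong refl) (simp add: 1)
  moreover have "(\<Sum>A\<in>Pow {..<n}. (\<Prod>i\<in>insert n A. sgnb ((s @ [b]) ! i)) * g (insert n A))
      = sgnb b * (\<Sum>A\<in>Pow {..<n}. (\<Prod>i\<in>A. sgnb (s ! i)) * g (insert n A))"
    unfolding sum_distrib_left mult.assoc[symmetric] by (intro sum.cong refl) (simp add: 2)
  ultimately show ?thesis
    unfolding genp_def using assms by (simp add: sum_Pow_lessThan_Suc add_divide_distrib)
qed

text \<open>
  The nonnegativity condition says that the would-be probabilities of the cylinder sets,
  computed from the correlations by Fourier inversion, are nonnegative.
\<close>

definition correlation :: "(nat set \<Rightarrow> real) \<Rightarrow> bool" where
  "correlation g \<longleftrightarrow> g {} = 1 \<and> (\<forall>s. 0 \<le> genp g s)"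

lemma cylinder_prob_genp:
  assumes "correlation g"
  shows "cylinder_prob (genp g)"
proof
  show "genp g s = genp g (s @ [False]) + genp g (s @ [True])" for s
    by (simp add: genp_snoc[OF refl] field_simps)
qed (use assms in \<open>auto simp: correlation_def genp_def\<close>)

lemma measurable_pref:
  assumes [measurable]: "\<And>s. (\<lambda>x. p x s) \<in> borel_measurable M" "u \<in> borel_measurable M"
  shows "(\<lambda>x. pref (p x) (u x) n) \<in> M \<rightarrow>\<^sub>M count_space UNIV"
proof (induction n)
  case (Suc n)
  note Suc[measurable]
  have "(\<lambda>x. (\<lambda>s x. s @ [lft (p x) s + p x (s @ [False]) \<le> u x]) (pref (p x) (u x) n) x)
    \<in> M \<rightarrow>\<^sub>M count_space UNIV"
    by (rule measurable_compose_countable[OF _ Suc]) (unfold lft_def, measurable)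
  then show ?case by simp
qed simp

lemma measurable_bits_of:
  assumes [measurable]: "\<And>K. finite K \<Longrightarrow> (\<lambda>x. g x K) \<in> borel_measurable M" "u \<in> borel_measurable M"
  shows "(\<lambda>x. bits_of (g x) (u x)) \<in> M \<rightarrow>\<^sub>M Bits"
proof (rule measurable_BitsI)
  fix n
  have [measurable]: "(\<lambda>x. genp (g x) s) \<in> borel_measurable M" for s
    unfolding genp_def
    by (intro borel_measurable_divide borel_measurable_sum borel_measurable_times assms)
       (auto intro: finite_subset)
  have [measurable]: "(\<lambda>x. pref (genp (g x)) (u x) (Suc n)) \<in> M \<rightarrow>\<^sub>M count_space UNIV"
    by (rule measurable_pref) measurable
  have "bits_of (g x) (u x) n = last (pref (genp (g x)) (u x) (Suc n))" for x
    by (simp add: bits_of_def bitseq_def)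
  then show "(\<lambda>x. bits_of (g x) (u x) n) \<in> M \<rightarrow>\<^sub>M count_space UNIV"
    by (simp del: pref.simps)
qed

lemma measurable_bits_of' [measurable]: "bits_of g \<in> unit01 \<rightarrow>\<^sub>M Bits"
  by (rule measurable_bits_of) auto

theorem integral_walsh_bits_of:
  assumes g: "correlation g" and "finite K"
  shows "(\<integral>u. walsh K (bits_of g u) \<partial>unit01) = g K"
proof -
  interpret cylinder_prob "genp g" by (rule cylinder_prob_genp[OF g])
  interpret U: prob_space unit01 by simp
  have [measurable]: "(\<lambda>u. pref (genp g) u n) \<in> unit01 \<rightarrow>\<^sub>M count_space UNIV" for n
    by (rule measurable_pref) measurable
  have int: "integrable unit01 (\<lambda>u. of_bool (pref (genp g) u n = s) * walsh K (bits_of g u))" for n s K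
    by (rule U.integrable_const_bound[where B=1]) (auto simp: abs_mult)
  \<comment> \<open>Generalized so that the bits can be read off one by one: at bit n the list
    \<open>s\<close> grows by one entry and n leaves \<open>K\<close>; by \<open>genp_snoc\<close>
    the sum over both values of the bit puts n back into the argument of \<open>g\<close>.\<close>
  have main: "(\<integral>u. of_bool (pref (genp g) u n = s) * walsh K (bits_of g u) \<partial>unit01)
      = genp (\<lambda>A. g (A \<union> K)) s"
    if "length s = n" "K \<subseteq> {n..<n+m}" for m n s K
    using that
  proof (induction m arbitrary: n s K)
    case 0
    then show ?case by (simp add: measure_pref)
  next
    case (Suc m)
    let ?K = "K - {n}" and ?c = "\<lambda>b. if n \<in> K then sgnb b else 1"
    have finK: "finite K" using Suc.prems(2) finite_subset by blast
    have split: "of_bool (pref (genp g) u n = s) * walsh K (bits_of g u) =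
        ?c False * (of_bool (pref (genp g) u (Suc n) = s @ [False]) * walsh ?K (bits_of g u)) +
        ?c True * (of_bool (pref (genp g) u (Suc n) = s @ [True]) * walsh ?K (bits_of g u))" for u
    proof -
      have *: "walsh K (bits_of g u) = ?c (bits_of g u n) * walsh ?K (bits_of g u)"
        using finK walsh_insert[of ?K n "bits_of g u"] by (cases "n \<in> K") (simp_all add: insert_absorb)
      have **: "pref (genp g) u (Suc n) = s @ [b] \<longleftrightarrow> pref (genp g) u n = s \<and> bits_of g u n = b" for b
        unfolding pref_Suc_eq bits_of_def ..
      show ?thesis
        unfolding * ** by (cases "bits_of g u n"; cases "n \<in> K") (simp_all del: Diff_insert0)
    qed
    have IH: "(\<integral>u. of_bool (pref (genp g) u (Suc n) = s @ [b]) * walsh ?K (bits_of g u) \<partial>unit01)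
        = (genp (\<lambda>A. g (A \<union> ?K)) s + sgnb b * genp (\<lambda>A. g (insert n A \<union> ?K)) s) / 2" for b
    proof -
      have "?K \<subseteq> {Suc n..<Suc n + m}" using Suc.prems(2) by fastforce
      from Suc.IH[OF _ this, of "s @ [b]"] show ?thesis
        using Suc.prems(1) by (simp add: genp_snoc del: pref.simps)
    qed
    have "(\<integral>u. of_bool (pref (genp g) u n = s) * walsh K (bits_of g u) \<partial>unit01) =
        ?c False * ((genp (\<lambda>A. g (A \<union> ?K)) s + sgnb False * genp (\<lambda>A. g (insert n A \<union> ?K)) s) / 2) +
        ?c True * ((genp (\<lambda>A. g (A \<union> ?K)) s + sgnb True * genp (\<lambda>A. g (insert n A \<union> ?K)) s) / 2)"
      unfolding split
      by (subst Bochner_Integration.integral_add)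
         (intro integrable_mult_right int, intro integrable_mult_right int,
          simp only: integral_mult_right_zero IH)
    also have "\<dots> = genp (\<lambda>A. g (A \<union> K)) s"
    proof (cases "n \<in> K")
      case True
      then have "insert n A \<union> ?K = A \<union> K" for A by auto
      then show ?thesis using True by (simp add: field_simps)
    next
      case False
      then show ?thesis by (simp add: field_simps)
    qed
    finally show ?case .
  qed
  obtain m where "K \<subseteq> {0..<0+m}"
    using \<open>finite K\<close> finite_nat_set_iff_bounded by (metis atLeastLessThan_iff add_0 le0 subsetI)
  from main[OF _ this, of "[]"] show ?thesis by (simp add: genp_def)
qed

text \<open>Every cylinder set is a combination of Walsh characters.\<close>

lemma distr_Bits_eqI:
  assumes "prob_space M" "prob_space M'"
    and [measurable]: "X \<in> M \<rightarrow>\<^sub>M Bits" "X' \<in> M' \<rightarrow>\<^sub>M Bits"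
    and eq: "\<And>K. finite K \<Longrightarrow> (\<integral>x. walsh K (X x) \<partial>M) = (\<integral>x. walsh K (X' x) \<partial>M')"
  shows "distr M Bits X = distr M' Bits X'"
proof -
  have key: "measure (distr M Bits X) (prod_emb UNIV (\<lambda>_. count_space UNIV) J (Pi\<^sub>E J A)) =
    (\<Sum>K\<in>Pow J. (\<Prod>i\<in>K. (of_bool (True \<in> A i) - of_bool (False \<in> A i)) / 2) *
       (\<Prod>i\<in>J-K. (of_bool (True \<in> A i) + of_bool (False \<in> A i)) / 2) * (\<integral>x. walsh K (X x) \<partial>M))"
    if M: "prob_space M" and [measurable]: "X \<in> M \<rightarrow>\<^sub>M Bits" and J: "finite J"
    for M :: "'x measure" and X and J :: "nat set" and A :: "nat \<Rightarrow> bool set"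
  proof -
    interpret prob_space M by (rule M)
    let ?E = "prod_emb UNIV (\<lambda>_. count_space UNIV) J (Pi\<^sub>E J A) :: (nat \<Rightarrow> bool) set"
    have int: "integrable M (\<lambda>x. walsh K (X x))" for K
      by (rule integrable_const_bound[where B=1]) auto
    have E: "?E \<in> sets Bits"
      unfolding Bits_def using J by (intro sets_PiM_I) auto
    have mem: "\<omega> \<in> ?E \<longleftrightarrow> (\<forall>i\<in>J. \<omega> i \<in> A i)" for \<omega>
      by (auto simp: prod_emb_def space_PiM PiE_iff)
    have "indicator ?E \<omega> = (\<Sum>K\<in>Pow J. (\<Prod>i\<in>K. (of_bool (True \<in> A i) - of_bool (False \<in> A i)) / 2) *
       (\<Prod>i\<in>J-K. (of_bool (True \<in> A i) + of_bool (False \<in> A i)) / 2) * walsh K \<omega>)" (is "_ = ?S \<omega>") for \<omega>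
    proof -
      have "indicator ?E \<omega> = (\<Prod>i\<in>J. of_bool (\<omega> i \<in> A i) :: real)"
        using J by (auto simp: indicator_def mem prod_zero_iff)
      \<comment> \<open>A function of one bit is affine in its sign, so the product expands into
        characters over the subsets of \<open>J\<close>.\<close>
      also have "\<dots> = (\<Prod>i\<in>J. sgnb (\<omega> i) * ((of_bool (True \<in> A i) - of_bool (False \<in> A i)) / 2) +
          (of_bool (True \<in> A i) + of_bool (False \<in> A i)) / 2)"
      proof (rule prod.cong[OF refl])
        fix i
        show "of_bool (\<omega> i \<in> A i) = sgnb (\<omega> i) * ((of_bool (True \<in> A i) - of_bool (False \<in> A i)) / 2) +
          (of_bool (True \<in> A i) + of_bool (False \<in> A i)) / (2::real)"
          by (cases "\<omega> i") (simp_all add: of_bool_def)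
      qed
      also have "\<dots> = ?S \<omega>"
        by (subst prod_add[OF J], intro sum.cong refl) (simp only: walsh_def prod.distrib mult_ac)
      finally show ?thesis .
    qed
    note ind = this
    have "measure (distr M Bits X) ?E = (\<integral>x. indicator ?E (X x) \<partial>M)"
      using E by (subst integral_distr[symmetric, of X M Bits]) auto
    then show ?thesis
      unfolding ind by (simp add: int Bochner_Integration.integral_sum)
  qed
  interpret D: prob_space "distr M Bits X" by (rule prob_space.prob_space_distr) (use assms in auto)
  interpret D': prob_space "distr M' Bits X'" by (rule prob_space.prob_space_distr) (use assms in auto)
  show ?thesis
  proof (rule measure_eqI_PiM_infinite)
    show "sets (distr M Bits X) = sets (\<Pi>\<^sub>M n\<in>UNIV. count_space UNIV)"
      "sets (distr M' Bits X') = sets (\<Pi>\<^sub>M n\<in>UNIV. count_space UNIV)"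
      by (simp_all add: Bits_def)
    show "finite_measure (distr M Bits X)" by unfold_locales
    fix A and J :: "nat set" assume J: "finite J"
    then have "measure (distr M Bits X) (prod_emb UNIV (\<lambda>_. count_space UNIV) J (Pi\<^sub>E J A)) =
      measure (distr M' Bits X') (prod_emb UNIV (\<lambda>_. count_space UNIV) J (Pi\<^sub>E J A))"
      by (simp add: key assms) (auto intro!: sum.cong simp: eq finite_subset[OF _ J])
    then show "emeasure (distr M Bits X) (prod_emb UNIV (\<lambda>_. count_space UNIV) J (Pi\<^sub>E J A)) =
      emeasure (distr M' Bits X') (prod_emb UNIV (\<lambda>_. count_space UNIV) J (Pi\<^sub>E J A))"
      by (simp add: D.emeasure_eq_measure D'.emeasure_eq_measure)
  qed
qed

section \<open>Positive functionals on commutative rings\<close>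

text \<open>The reals act through the ring homomorphism \<open>C\<close>, later the constant
  polynomials, so the arguments stay purely ring-theoretic.\<close>

locale scalar_embedding =
  fixes C :: "real \<Rightarrow> 'a::comm_ring_1"
  assumes C_add: "C (a + b) = C a + C b" and C_mult: "C (a * b) = C a * C b" and C_1: "C 1 = 1"
begin

definition positive_functional :: "('a \<Rightarrow> real) \<Rightarrow> bool" where
  "positive_functional L \<longleftrightarrow> (\<forall>p q. L (p + q) = L p + L q) \<and> (\<forall>c p. L (C c * p) = c * L p) \<and>
     (\<forall>p. 0 \<le> L (p * p))"

text \<open>The algebraic substitute for |x| <= 1: a random variable with bounded even moments lies
  in [-1,1] almost surely.\<close>

definition tame :: "('a \<Rightarrow> real) \<Rightarrow> 'a \<Rightarrow> bool" where
  "tame L x \<longleftrightarrow> (\<exists>B. \<forall>k. L (x ^ (2 * k)) \<le> B)"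

lemma
  assumes "positive_functional L"
  shows pf_add: "L (p + q) = L p + L q"
    and pf_scale: "L (C c * p) = c * L p"
    and pf_square: "0 \<le> L (p * p)"
  using assms by (auto simp: positive_functional_def)

lemma pf_diff:
  assumes "positive_functional L"
  shows "L (p - q) = L p - L q"
  using pf_add[OF assms, of "p - q" q] by simp

lemma Cauchy_Schwarz_functional:
  assumes L: "positive_functional L"
  shows "(L (p * q))\<^sup>2 \<le> L (p * p) * L (q * q)"
proof -
  have quad: "0 \<le> L (p * p) + 2 * t * L (p * q) + t\<^sup>2 * L (q * q)" for t
  proof -
    have "(p + C t * q) * (p + C t * q) = p * p + (C t * (p * q) + C t * (p * q)) + C (t * t) * (q * q)"
      by (simp add: C_mult algebra_simps)
    then have "L ((p + C t * q) * (p + C t * q)) = L (p * p) + (t * L (p * q) + t * L (p * q)) + t * t * L (q * q)"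
      by (simp only: pf_add[OF L] pf_scale[OF L])
    with pf_square[OF L, of "p + C t * q"] show ?thesis by (simp add: power2_eq_square)
  qed
  show ?thesis
  proof (cases "L (q * q) = 0")
    case True
    have "L (p * q) = 0"
    proof (rule ccontr)
      assume "L (p * q) \<noteq> 0"
      \<comment> \<open>For \<open>L (q * q) = 0\<close> the quadratic is affine in t, and at this t
        its value is -1.\<close>
      with quad[of "- (L (p * p) + 1) / (2 * L (p * q))"] True show False by (simp add: field_simps)
    qed
    then show ?thesis using True by simp
  next
    case False
    with pf_square[OF L, of q] have pos: "L (q * q) > 0" by simp
    have "0 \<le> L (p * p) - (L (p * q))\<^sup>2 / L (q * q)"
      using quad[of "- L (p * q) / L (q * q)"] pos by (simp add: field_simps power2_eq_square)
    with pos show ?thesis by (simp add: field_simps)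
  qed
qed

text \<open>
  If \<open>L (x\<^sup>2 p\<^sup>2) > L (p\<^sup>2)\<close>, then by the Cauchy--Schwarz inequality \<open>L (x\<^sup>2\<^sup>k p\<^sup>2)\<close> would grow
  at least geometrically.
\<close>

lemma pf_one_minus_square:
  assumes L: "positive_functional L" and "tame L x"
  shows "0 \<le> L ((1 - x * x) * (p * p))"
proof -
  define a where "a k = L (x ^ (2 * k) * (p * p))" for k
  obtain B where B: "\<And>k. L (x ^ (2 * k)) \<le> B" using assms(2) by (auto simp: tame_def)
  have nonneg: "0 \<le> a k" for k
  proof -
    have "x ^ (2 * k) * (p * p) = (x ^ k * p) * (x ^ k * p)"
      unfolding mult_2 power_add by (simp only: mult_ac)
    then show ?thesis unfolding a_def by (simp only: pf_square[OF L])
  qed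
  have convex: "(a (Suc k))\<^sup>2 \<le> a k * a (Suc (Suc k))" for k
  proof -
    have "(x ^ k * p) * (x ^ Suc (Suc k) * p) = x ^ (2 * Suc k) * (p * p)"
      "(x ^ k * p) * (x ^ k * p) = x ^ (2 * k) * (p * p)"
      "(x ^ Suc (Suc k) * p) * (x ^ Suc (Suc k) * p) = x ^ (2 * Suc (Suc k)) * (p * p)"
      unfolding mult_2 power_add power_Suc by (simp_all only: mult_ac)
    with Cauchy_Schwarz_functional[OF L, of "x ^ k * p" "x ^ Suc (Suc k) * p"] show ?thesis
      by (simp only: a_def)
  qed
  \<comment> \<open>Cauchy--Schwarz separates x from p, so the tameness of x alone bounds the whole
    sequence.\<close>
  have bounded: "(a k)\<^sup>2 \<le> B * L ((p * p) * (p * p))" for k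
  proof -
    have "x ^ (2 * k) * x ^ (2 * k) = x ^ (2 * (2 * k))"
      by (simp add: mult_2 power_add)
    then have "(a k)\<^sup>2 \<le> L (x ^ (2 * (2 * k))) * L ((p * p) * (p * p))"
      using Cauchy_Schwarz_functional[OF L, of "x ^ (2 * k)" "p * p"] by (simp add: a_def)
    also have "\<dots> \<le> B * L ((p * p) * (p * p))"
      by (intro mult_right_mono B pf_square[OF L])
    finally show ?thesis .
  qed
  have "a 1 \<le> a 0"
  proof (rule ccontr)
    assume "\<not> a 1 \<le> a 0"
    then have less: "a 0 < a 1" by simp
    have a0: "0 < a 0"
    proof (rule ccontr)
      assume "\<not> 0 < a 0"
      with nonneg[of 0] have "a 0 = 0" by simp
      with convex[of 0] less show False by simp
    qed
    define r where "r = a 1 / a 0"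
    have r: "1 < r" using less a0 by (simp add: r_def)
    have step: "0 < a k \<and> r * a k \<le> a (Suc k)" for k
    proof (induction k)
      case 0
      then show ?case using a0 by (simp add: r_def)
    next
      case (Suc k)
      then have pos: "0 < a k" "0 < r * a k" using r by auto
      then have pos': "0 < a (Suc k)" using Suc by linarith
      have "(r * a k) * a (Suc k) \<le> a (Suc k) * a (Suc k)"
        using Suc pos' by (intro mult_right_mono) auto
      also have "\<dots> \<le> a k * a (Suc (Suc k))"
        using convex[of k] by (simp add: power2_eq_square)
      finally have "a k * (r * a (Suc k)) \<le> a k * a (Suc (Suc k))" by (simp add: mult_ac)
      with pos have "r * a (Suc k) \<le> a (Suc (Suc k))" by simp
      with pos' show ?case by simp
    qed
    have grow: "r ^ k * a 0 \<le> a k" for k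
    proof (induction k)
      case (Suc k)
      have "r ^ Suc k * a 0 = r * (r ^ k * a 0)" by simp
      also have "\<dots> \<le> r * a k" using Suc r by (intro mult_left_mono) auto
      also have "\<dots> \<le> a (Suc k)" using step by simp
      finally show ?case .
    qed simp
    define D where "D = B * L ((p * p) * (p * p))"
    obtain k where k: "(\<bar>D\<bar> + 1) / a 0 < r ^ k" using real_arch_pow[OF r] by blast
    then have big: "\<bar>D\<bar> + 1 < a k" using grow[of k] a0 by (simp add: field_simps)
    then have "(\<bar>D\<bar> + 1) * 1 \<le> a k * a k" by (intro mult_mono) auto
    also have "\<dots> \<le> D" using bounded[of k] by (simp add: D_def power2_eq_square)
    finally show False by simp
  qed
  then show ?thesis
    by (simp add: a_def left_diff_distrib pf_diff[OF L] numeral_2_eq_2)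
qed

text \<open>Rests on 2 (1 + x) = (1 + x)^2 + (1 - x^2), where the first summand is a square and the
  second is \<open>pf_one_minus_square\<close>.\<close>

lemma pf_one_plus:
  assumes L: "positive_functional L" and "tame L x"
  shows "0 \<le> L ((1 + x) * (p * p))"
proof -
  have "C 2 * ((1 + x) * (p * p)) = ((1 + x) * p) * ((1 + x) * p) + (1 - x * x) * (p * p)"
    using C_add[of 1 1] by (simp add: C_1 algebra_simps)
  then have "2 * L ((1 + x) * (p * p)) = L (((1 + x) * p) * ((1 + x) * p)) + L ((1 - x * x) * (p * p))"
    by (metis pf_add[OF L] pf_scale[OF L])
  with pf_square[OF L, of "(1 + x) * p"] pf_one_minus_square[OF assms, of p] show ?thesis by simp
qed

text \<open>Together with \<open>tame_weight\<close> this makes the weighted functional fit for the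
  same lemmas again, so that factors 1 + y can be inserted one at a time.\<close>

lemma pf_weight:
  assumes L: "positive_functional L" and w: "\<And>p. 0 \<le> L (w * (p * p))"
  shows "positive_functional (\<lambda>q. L (w * q))"
  unfolding positive_functional_def
proof (intro conjI allI)
  show "L (w * (p + q)) = L (w * p) + L (w * q)" for p q
    by (simp add: distrib_left pf_add[OF L])
  show "L (w * (C c * p)) = c * L (w * p)" for c p
    by (metis mult.left_commute pf_scale[OF L])
qed (rule w)

lemma tame_weight:
  assumes L: "positive_functional L" and "tame L x"
  shows "tame (\<lambda>q. L (w * q)) x"
proof -
  obtain B where B: "\<And>k. L (x ^ (2 * k)) \<le> B" using assms(2) by (auto simp: tame_def)
  \<comment> \<open>The bound is a crude substitute for a square root: with a =
    \<open>L (w * w) * B\<close> it uses a <= (|a| + 1)^2.\<close>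
  have "L (w * x ^ (2 * k)) \<le> \<bar>L (w * w) * B\<bar> + 1" for k
  proof -
    have "x ^ (2 * k) * x ^ (2 * k) = x ^ (2 * (2 * k))"
      by (simp add: mult_2 power_add)
    then have "(L (w * x ^ (2 * k)))\<^sup>2 \<le> L (w * w) * L (x ^ (2 * (2 * k)))"
      using Cauchy_Schwarz_functional[OF L, of w "x ^ (2 * k)"] by simp
    also have "\<dots> \<le> L (w * w) * B" by (intro mult_left_mono B pf_square[OF L])
    also have "\<dots> \<le> (\<bar>L (w * w) * B\<bar> + 1)\<^sup>2"
    proof -
      have "\<bar>L (w * w) * B\<bar> \<le> (\<bar>L (w * w) * B\<bar> + 1) * (\<bar>L (w * w) * B\<bar> + 1)"
        by (simp add: distrib_left distrib_right add_increasing)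
      then show ?thesis by (simp add: power2_eq_square)
    qed
    finally show ?thesis by (rule power2_le_imp_le) simp
  qed
  then show ?thesis unfolding tame_def by blast
qed

lemma pf_prod_one_plus:
  assumes "finite J" "positive_functional L" "\<And>n. n \<in> J \<Longrightarrow> tame L (y n)"
  shows "0 \<le> L (\<Prod>n\<in>J. 1 + y n)"
proof -
  have "positive_functional (\<lambda>q. L ((\<Prod>n\<in>J. 1 + y n) * q))"
    using assms(1,3)
  proof (induction J)
    case empty
    then show ?case using assms(2) by (simp add: eta_contract_eq)
  next
    case (insert n J)
    let ?w = "\<Prod>n\<in>J. 1 + y n"
    have "positive_functional (\<lambda>q. L (?w * q))" "tame (\<lambda>q. L (?w * q)) (y n)"
      using insert by (auto intro!: tame_weight assms(2))
    from pf_weight[OF this(1) pf_one_plus[OF this]]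
    show ?case using insert by (simp add: mult_ac)
  qed
  from pf_square[OF this, of 1] show ?thesis by simp
qed

end

section \<open>The polynomial algebra of a graph parameter\<close>

text \<open>
  Every natural number codes exactly one edge: the code of \<open>(i, k)\<close> stands for the edge joining
  \<open>i\<close> and \<open>i + k + 1\<close>.
\<close>

definition ends :: "nat \<Rightarrow> nat \<times> nat" where
  "ends c = (case prod_decode c of (i, k) \<Rightarrow> (i, Suc (i + k)))"

definition ecode :: "nat \<Rightarrow> nat \<Rightarrow> nat" where
  "ecode i j = prod_encode (min i j, max i j - Suc (min i j))"

lemma ecode_commute: "ecode i j = ecode j i"
  by (simp add: ecode_def min.commute max.commute)

lemma ends_ecode: "i \<noteq> j \<Longrightarrow> ends (ecode i j) = (min i j, max i j)"
  by (auto simp: ends_def ecode_def min_def max_def)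

lemma ecode_ends: "ends c = (i, j) \<Longrightarrow> ecode i j = c"
  by (auto simp: ends_def ecode_def split: prod.splits) (metis prod_decode_inverse)

lemma ends_less: "fst (ends c) < snd (ends c)"
  by (auto simp: ends_def split: prod.splits)

lemma ecode_eq_iff: "i \<noteq> j \<Longrightarrow> k \<noteq> l \<Longrightarrow> ecode i j = ecode k l \<longleftrightarrow> {i, j} = {k, l}"
proof
  assume "i \<noteq> j" "k \<noteq> l" "ecode i j = ecode k l"
  then have "(min i j, max i j) = (min k l, max k l)" by (metis ends_ecode)
  then show "{i, j} = {k, l}" by (auto simp: min_def max_def split: if_splits)
qed (auto simp: doubleton_eq_iff ecode_commute)

definition endset :: "nat \<Rightarrow> nat set" where
  "endset c = {fst (ends c), snd (ends c)}"

lemma endset_ecode: "i \<noteq> j \<Longrightarrow> endset (ecode i j) = {i, j}"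
  by (auto simp: endset_def ends_ecode min_def max_def)

lemma finite_endset [simp]: "finite (endset c)"
  by (simp add: endset_def)

lemma obtain_ecode:
  obtains i j where "i < j" "c = ecode i j" "endset c = {i, j}"
  by (metis ecode_ends endset_def ends_less prod.collapse)

text \<open>Reading multiplicities from edge codes builds in symmetry; infinite \<open>V\<close> is
  sent to the empty graph to keep the function total.\<close>

lift_definition mk_graph :: "nat set \<Rightarrow> (nat \<Rightarrow> nat) \<Rightarrow> multigraph" is
  "\<lambda>V m. (if finite V then V else {}, \<lambda>i j. if finite V \<and> i \<in> V \<and> j \<in> V \<and> i \<noteq> j then m (ecode i j) else 0)"
  by (auto simp: ecode_commute)

lemma nodes_mk_graph [simp]: "finite V \<Longrightarrow> nodes (mk_graph V m) = V"
  by transfer simp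

lemma edge_mult_mk_graph:
  "finite V \<Longrightarrow> edge_mult (mk_graph V m) i j = (if i \<in> V \<and> j \<in> V \<and> i \<noteq> j then m (ecode i j) else 0)"
  by transfer simp

lemma edge_mult_self [simp]: "edge_mult F i i = 0"
  by transfer auto

lemma edge_mult_commute: "edge_mult F i j = edge_mult F j i"
  by transfer (auto simp: prod_eq_iff)

lemma edge_mult_outside: "i \<notin> nodes F \<or> j \<notin> nodes F \<Longrightarrow> edge_mult F i j = 0"
  by transfer force

lemma finite_nodes [simp]: "finite (nodes F)"
  by transfer auto

lemma multigraph_eqI:
  assumes "nodes F = nodes G" "\<And>i j. edge_mult F i j = edge_mult G i j"
  shows "F = G"
  using assms by transfer (auto simp: prod_eq_iff fun_eq_iff)

lemma nodes_gluing [simp]: "nodes (gluing F G) = nodes F \<union> nodes G"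
  by transfer auto

lemma edge_mult_gluing [simp]: "edge_mult (gluing F G) i j = edge_mult F i j + edge_mult G i j"
  by transfer auto

lemma nodes_K1 [simp]: "nodes K1 = {1}"
  by transfer simp

lemma edge_mult_K1 [simp]: "edge_mult K1 i j = 0"
  by transfer simp

lemma nodes_K2 [simp]: "nodes (K2 k) = {1, 2}"
  by transfer simp

lemma edge_mult_K2 [simp]: "edge_mult (K2 k) i j = (if {i, j} = {1, 2} then k else 0)"
  by transfer simp

lemma nodes_disjoint_union [simp]:
  "nodes (disjoint_union F G) = (\<lambda>i. 2 * i) ` nodes F \<union> (\<lambda>i. Suc (2 * i)) ` nodes G"
  by transfer (auto simp: sum_encode_def Plus_def image_Un image_image)

lemma edge_mult_disjoint_union [simp]:
  "edge_mult (disjoint_union F G) (2 * i) (2 * j) = edge_mult F i j"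
  "edge_mult (disjoint_union F G) (Suc (2 * i)) (Suc (2 * j)) = edge_mult G i j"
  "edge_mult (disjoint_union F G) (2 * i) (Suc (2 * j)) = 0"
  "edge_mult (disjoint_union F G) (Suc (2 * i)) (2 * j) = 0"
  by (transfer; auto simp: sum_decode_def)+

definition support_nodes :: "(nat \<Rightarrow> nat) \<Rightarrow> nat set" where
  "support_nodes m = (\<Union>c\<in>{c. m c \<noteq> 0}. endset c)"

text \<open>Isolated nodes do not change f (\<open>f_mk_graph\<close>), so f becomes a function of
  the multiplicities alone, that is, of monomials in edge variables.\<close>

definition gval :: "(multigraph \<Rightarrow> real) \<Rightarrow> (nat \<Rightarrow> nat) \<Rightarrow> real" where
  "gval f m = f (mk_graph (support_nodes m) m)"

lemma finite_support_nodes: "finite {c. m c \<noteq> 0} \<Longrightarrow> finite (support_nodes m)"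
  by (simp add: support_nodes_def)

lemma mult_zero_outside_support:
  "i \<noteq> j \<Longrightarrow> \<not> {i, j} \<subseteq> support_nodes m \<Longrightarrow> m (ecode i j) = 0"
  by (auto simp: support_nodes_def endset_ecode intro: ccontr)

lemma graph_parameter_cong:
  assumes "graph_parameter f" "bij_betw \<phi> (nodes F) (nodes G)"
    "\<And>i j. i \<in> nodes F \<Longrightarrow> j \<in> nodes F \<Longrightarrow> i \<noteq> j \<Longrightarrow> edge_mult G (\<phi> i) (\<phi> j) = edge_mult F i j"
  shows "f F = f G"
proof -
  have "edge_mult G (\<phi> i) (\<phi> j) = edge_mult F i j" if "i \<in> nodes F" "j \<in> nodes F" for i j
    using assms(3)[OF that] by (cases "i = j") auto
  with assms(1,2) show ?thesis
    unfolding graph_parameter_def isomorphic_def by blast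
qed

section \<open>Independence of isolated nodes and of node names\<close>

locale limit_parameter =
  fixes f :: "multigraph \<Rightarrow> real"
  assumes gp: "graph_parameter f" and norm: "normalized f" and mult: "multiplicative f"
begin

lemma f_add_isolated_node:
  assumes "finite V" "v \<notin> V" "support_nodes m \<subseteq> V"
  shows "f (mk_graph (insert v V) m) = f (mk_graph V m)"
proof -
  have "f (mk_graph (insert v V) m) = f (disjoint_union (mk_graph V m) K1)"
  \<comment> \<open>In the disjoint union the only node 1 of \<open>K1\<close> becomes 2 * 1 + 1 =
    3.\<close>
  proof (rule graph_parameter_cong[OF gp, where \<phi>="\<lambda>x. if x = v then 3 else 2 * x"])
    show "bij_betw (\<lambda>x. if x = v then 3 else 2 * x) (nodes (mk_graph (insert v V) m))
        (nodes (disjoint_union (mk_graph V m) K1))"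
      using assms by (auto simp: bij_betw_def inj_on_def image_iff) presburger+
    fix i j assume ij: "i \<in> nodes (mk_graph (insert v V) m)" "j \<in> nodes (mk_graph (insert v V) m)" "i \<noteq> j"
    have "edge_mult (disjoint_union (mk_graph V m) K1) (2 * a) 3 = 0"
      "edge_mult (disjoint_union (mk_graph V m) K1) 3 (2 * a) = 0" for a
      using edge_mult_disjoint_union(3,4)[where i=a and j=1] edge_mult_disjoint_union(3,4)[where i=1 and j=a]
      by (simp_all add: numeral_3_eq_3)
    then show "edge_mult (disjoint_union (mk_graph V m) K1) (if i = v then 3 else 2 * i) (if j = v then 3 else 2 * j)
        = edge_mult (mk_graph (insert v V) m) i j"
      using ij assms mult_zero_outside_support[of i j m] by (auto simp: edge_mult_mk_graph)
  qed
  also have "\<dots> = f (mk_graph V m)"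
    using mult norm by (simp add: multiplicative_def normalized_def)
  finally show ?thesis .
qed

lemma f_mk_graph:
  assumes "finite V" "support_nodes m \<subseteq> V"
  shows "f (mk_graph V m) = gval f m"
proof -
  have fin: "finite (support_nodes m)" using assms finite_subset by blast
  have "f (mk_graph (support_nodes m \<union> D) m) = gval f m"
    if "finite D" "D \<inter> support_nodes m = {}" for D
    using that
  proof (induction D)
    case (insert v D)
    then show ?case using f_add_isolated_node[of "support_nodes m \<union> D" v m] fin by auto
  qed (simp add: gval_def)
  from this[of "V - support_nodes m"] assms show ?thesis by (simp add: Un_absorb1 Diff_Int_distrib2)
qed

lemma f_eq_gval:
  assumes "inj_on \<phi> (nodes F)" "support_nodes m \<subseteq> \<phi> ` nodes F"
    "\<And>i j. i \<in> nodes F \<Longrightarrow> j \<in> nodes F \<Longrightarrow> i \<noteq> j \<Longrightarrow> m (ecode (\<phi> i) (\<phi> j)) = edge_mult F i j"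
  shows "f F = gval f m"
proof -
  have "f F = f (mk_graph (\<phi> ` nodes F) m)"
    using assms by (intro graph_parameter_cong[OF gp, where \<phi>=\<phi>])
      (auto simp: bij_betw_def edge_mult_mk_graph inj_on_eq_iff)
  then show ?thesis using assms(2) by (simp add: f_mk_graph)
qed

lemma gval_0: "gval f (\<lambda>_. 0) = 1"
  using f_add_isolated_node[of "{}" 1 "\<lambda>_. 0"] f_mk_graph[of "{1}" "\<lambda>_. 0"] norm
    f_eq_gval[of id K1 "\<lambda>_. 0"] by (simp add: support_nodes_def normalized_def)

lemma gval_relabel:
  assumes "finite {c. m c \<noteq> 0}" "inj \<sigma>"
    "\<And>i j. i \<noteq> j \<Longrightarrow> m' (ecode (\<sigma> i) (\<sigma> j)) = m (ecode i j)"
    "\<And>c. m' c \<noteq> 0 \<Longrightarrow> endset c \<subseteq> range \<sigma>"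
  shows "gval f m' = gval f m"
proof -
  let ?F = "mk_graph (support_nodes m) m"
  have fin: "finite (support_nodes m)" using assms(1) by (rule finite_support_nodes)
  have "f ?F = gval f m'"
  proof (rule f_eq_gval[where \<phi>=\<sigma>])
    show "support_nodes m' \<subseteq> \<sigma> ` nodes ?F"
    proof
      fix x assume "x \<in> support_nodes m'"
      then obtain c where c: "m' c \<noteq> 0" "x \<in> endset c" by (auto simp: support_nodes_def)
      obtain i j where ij: "i < j" "c = ecode i j" "endset c = {i, j}" by (rule obtain_ecode)
      then obtain k l where kl: "i = \<sigma> k" "j = \<sigma> l" using assms(4)[OF c(1)] by auto
      then have "k \<noteq> l" using ij by auto
      then have "m (ecode k l) \<noteq> 0" using assms(3) c ij kl by metis
      then have "{k, l} \<subseteq> support_nodes m" using mult_zero_outside_support[OF \<open>k \<noteq> l\<close>, of m] by argo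
      then show "x \<in> \<sigma> ` nodes ?F" using c ij kl fin by auto
    qed
    show "inj_on \<sigma> (nodes ?F)" using assms(2) by (rule inj_on_subset) simp
    show "m' (ecode (\<sigma> i) (\<sigma> j)) = edge_mult ?F i j" if "i \<in> nodes ?F" "j \<in> nodes ?F" "i \<noteq> j" for i j
      using that fin assms(3)[OF that(3)] by (simp add: edge_mult_mk_graph)
  qed
  then show ?thesis by (simp add: gval_def)
qed

end

section \<open>The linear functional on polynomials in the edge variables\<close>

type_synonym edge_poly = "(nat \<Rightarrow>\<^sub>0 nat) \<Rightarrow>\<^sub>0 real"

abbreviation const_poly :: "real \<Rightarrow> edge_poly" where
  "const_poly c \<equiv> Poly_Mapping.single 0 c"

interpretation poly: scalar_embedding const_poly
  by unfold_locales (simp_all add: single_add mult_single)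

text \<open>Reflection positivity is stated for node sets {1..n}, while edge codes use the nodes 0,
  1, ...; hence the shift by one.\<close>

definition shift_graph :: "nat \<Rightarrow> (nat \<Rightarrow> nat) \<Rightarrow> multigraph" where
  "shift_graph n m = mk_graph {1..n} (\<lambda>c. m (ecode (fst (ends c) - 1) (snd (ends c) - 1)))"

lemma shift_graph_in [simp]: "shift_graph n m \<in> graphs_on n"
  by (simp add: shift_graph_def graphs_on_def)

lemma nodes_shift_graph [simp]: "nodes (shift_graph n m) = {1..n}"
  by (simp add: shift_graph_def)

lemma edge_mult_shift_graph:
  "edge_mult (shift_graph n m) i j =
    (if i \<in> {1..n} \<and> j \<in> {1..n} \<and> i \<noteq> j then m (ecode (i - 1) (j - 1)) else 0)"
proof (cases "i = j")
  case False
  then have "ecode (fst (ends (ecode i j)) - 1) (snd (ends (ecode i j)) - 1) = ecode (i - 1) (j - 1)"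
    by (simp add: ends_ecode min_def max_def ecode_commute)
  with False show ?thesis by (simp add: shift_graph_def edge_mult_mk_graph)
qed simp

lemma gluing_shift_graph:
  "gluing (shift_graph n m) (shift_graph n m') = shift_graph n (\<lambda>c. m c + m' c)"
  by (rule multigraph_eqI) (simp_all add: edge_mult_shift_graph)

text \<open>Distinct monomials must give distinct basis elements of the quantum graphs, or
  coefficients would be merged.\<close>

lemma shift_graph_inject:
  assumes "shift_graph n m = shift_graph n m'"
    "support_nodes m \<subseteq> {..<n}" "support_nodes m' \<subseteq> {..<n}"
  shows "m = m'"
proof
  fix c
  obtain i j where ij: "i < j" "c = ecode i j" "endset c = {i, j}" by (rule obtain_ecode)
  show "m c = m' c"
  proof (cases "j < n")
    case True
    have "edge_mult (shift_graph n m) (Suc i) (Suc j) = edge_mult (shift_graph n m') (Suc i) (Suc j)"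
      by (simp add: assms(1))
    with True ij show ?thesis by (simp add: edge_mult_shift_graph)
  next
    case False
    then have "\<not> {i, j} \<subseteq> support_nodes m" "\<not> {i, j} \<subseteq> support_nodes m'" using assms by auto
    with mult_zero_outside_support[of i j m] mult_zero_outside_support[of i j m'] ij show ?thesis by simp
  qed
qed

lemma linear_extension_superset:
  assumes "finite S" "Poly_Mapping.keys p \<subseteq> S"
  shows "linear_extension f p = (\<Sum>F\<in>S. Poly_Mapping.lookup p F * f F)"
  unfolding linear_extension_def using assms
  by (intro sum.mono_neutral_left) (auto simp: in_keys_iff)

lemma linear_extension_add: "linear_extension f (p + q) = linear_extension f p + linear_extension f q"
proof -
  let ?S = "Poly_Mapping.keys p \<union> Poly_Mapping.keys q"
  have "linear_extension f (p + q) = (\<Sum>F\<in>?S. Poly_Mapping.lookup (p + q) F * f F)"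
    by (rule linear_extension_superset) (use Poly_Mapping.keys_add[of p q] in auto)
  then show ?thesis
    by (simp add: linear_extension_superset[of ?S] lookup_add distrib_right sum.distrib)
qed

lemma linear_extension_0 [simp]: "linear_extension f 0 = 0"
  by (simp add: linear_extension_def)

lemma linear_extension_sum: "linear_extension f (sum P A) = (\<Sum>a\<in>A. linear_extension f (P a))"
  by (induction A rule: infinite_finite_induct) (simp_all add: linear_extension_add)

lemma linear_extension_single [simp]: "linear_extension f (Poly_Mapping.single F c) = c * f F"
  by (cases "c = 0") (simp_all add: linear_extension_def)

context limit_parameter
begin

text \<open>A monomial is read as the multigraph whose multiplicities are its exponents; multiplying
  monomials is then gluing graphs.\<close>

definition Lf :: "edge_poly \<Rightarrow> real" where
  "Lf p = (\<Sum>a\<in>Poly_Mapping.keys p. Poly_Mapping.lookup p a * gval f (Poly_Mapping.lookup a))"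

lemma Lf_superset:
  assumes "finite S" "Poly_Mapping.keys p \<subseteq> S"
  shows "Lf p = (\<Sum>a\<in>S. Poly_Mapping.lookup p a * gval f (Poly_Mapping.lookup a))"
  unfolding Lf_def using assms by (intro sum.mono_neutral_left) (auto simp: in_keys_iff)

lemma Lf_add: "Lf (p + q) = Lf p + Lf q"
proof -
  let ?S = "Poly_Mapping.keys p \<union> Poly_Mapping.keys q"
  have "Lf (p + q) = (\<Sum>a\<in>?S. Poly_Mapping.lookup (p + q) a * gval f (Poly_Mapping.lookup a))"
    by (rule Lf_superset) (use Poly_Mapping.keys_add[of p q] in auto)
  then show ?thesis
    by (simp add: Lf_superset[of ?S] lookup_add distrib_right sum.distrib)
qed

lemma Lf_0 [simp]: "Lf 0 = 0"
  by (simp add: Lf_def)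

lemma Lf_sum: "Lf (sum P A) = (\<Sum>a\<in>A. Lf (P a))"
  by (induction A rule: infinite_finite_induct) (simp_all add: Lf_add)

lemma Lf_single: "Lf (Poly_Mapping.single a c) = c * gval f (Poly_Mapping.lookup a)"
  by (cases "c = 0") (simp_all add: Lf_def)

lemma edge_poly_eq_sum:
  "(p :: edge_poly) = (\<Sum>a\<in>Poly_Mapping.keys p. Poly_Mapping.single a (Poly_Mapping.lookup p a))"
proof (rule poly_mapping_eqI)
  fix b
  have "(\<Sum>a\<in>Poly_Mapping.keys p. Poly_Mapping.lookup (Poly_Mapping.single a (Poly_Mapping.lookup p a)) b)
      = (\<Sum>a\<in>Poly_Mapping.keys p. if a = b then Poly_Mapping.lookup p b else 0)"
    by (intro sum.cong refl) (auto simp: lookup_single when_def)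
  then show "Poly_Mapping.lookup p b = Poly_Mapping.lookup
      (\<Sum>a\<in>Poly_Mapping.keys p. Poly_Mapping.single a (Poly_Mapping.lookup p a)) b"
    by (simp add: lookup_sum in_keys_iff)
qed

lemma Lf_scale: "Lf (const_poly c * p) = c * Lf p"
proof -
  have "const_poly c * p = (\<Sum>a\<in>Poly_Mapping.keys p. Poly_Mapping.single a (c * Poly_Mapping.lookup p a))"
    by (subst edge_poly_eq_sum[of p]) (simp add: sum_distrib_left mult_single)
  then show ?thesis
    by (simp add: Lf_sum Lf_single) (simp add: Lf_def sum_distrib_left mult_ac)
qed

lemma f_shift_graph:
  assumes "support_nodes m \<subseteq> {..<n}"
  shows "f (shift_graph n m) = gval f m"
proof (rule f_eq_gval[where \<phi>="\<lambda>i. i - 1"])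
  show "inj_on (\<lambda>i. i - 1) (nodes (shift_graph n m))" by (auto simp: inj_on_def)
  have "{..<n} \<subseteq> (\<lambda>i. i - 1) ` {1..n}"
  proof
    fix x assume "x \<in> {..<n}"
    then show "x \<in> (\<lambda>i. i - 1) ` {1..n}" by (intro image_eqI[of _ _ "Suc x"]) auto
  qed
  with assms show "support_nodes m \<subseteq> (\<lambda>i. i - 1) ` nodes (shift_graph n m)" by simp
qed (auto simp: edge_mult_shift_graph)

text \<open>A polynomial involves finitely many nodes, so it can be copied, coefficient by
  coefficient, to a quantum graph \<open>P\<close> on {1..n} with the same value on the
  square.\<close>

lemma Lf_square_nonneg:
  assumes "weakly_reflection_positive f"
  shows "0 \<le> Lf (p * p)"
proof -
  let ?K = "Poly_Mapping.keys p" and ?l = "Poly_Mapping.lookup :: (nat \<Rightarrow>\<^sub>0 nat) \<Rightarrow> nat \<Rightarrow> nat"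
  let ?c = "Poly_Mapping.lookup p"
  have "finite {c. ?l a c \<noteq> 0}" for a by simp
  then have "finite (\<Union>a\<in>?K. support_nodes (?l a))"
    by (intro finite_UN_I finite_keys finite_support_nodes)
  then obtain n0 where n0: "(\<Union>a\<in>?K. support_nodes (?l a)) \<subseteq> {..<n0}"
    by (auto simp: finite_nat_set_iff_bounded)
  \<comment> \<open>The successor ensures n >= 1, also for a constant polynomial.\<close>
  define n where "n = Suc n0"
  have n: "support_nodes (?l a) \<subseteq> {..<n}" if "a \<in> ?K" for a
    using n0 that by (force simp: n_def)
  let ?G = "\<lambda>a. shift_graph n (?l a)"
  define P where "P = (\<Sum>a\<in>?K. Poly_Mapping.single (?G a) (?c a))"
  have inj: "inj_on ?G ?K"
    by (rule inj_onI) (metis n shift_graph_inject poly_mapping_eqI)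
  have lookP: "Poly_Mapping.lookup P (?G a) = ?c a" if "a \<in> ?K" for a
  proof -
    have "(\<Sum>b\<in>?K. Poly_Mapping.lookup (Poly_Mapping.single (?G b) (?c b)) (?G a)) = (\<Sum>b\<in>?K. if b = a then ?c a else 0)"
      using that by (intro sum.cong refl) (auto simp: lookup_single when_def dest: inj_onD[OF inj])
    with that show ?thesis by (simp add: P_def lookup_sum)
  qed
  have "Poly_Mapping.lookup P F = 0" if "F \<notin> ?G ` ?K" for F
    unfolding P_def lookup_sum using that by (intro sum.neutral) (auto simp: lookup_single when_def)
  then have keysP: "Poly_Mapping.keys P = ?G ` ?K"
    using lookP by (auto simp: in_keys_iff)
  have "linear_extension f (quantum_mult P P) =
      (\<Sum>F\<in>?G ` ?K. \<Sum>G\<in>?G ` ?K. Poly_Mapping.lookup P F * Poly_Mapping.lookup P G * f (gluing F G))"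
    unfolding quantum_mult_def keysP by (simp add: linear_extension_sum)
  also have "\<dots> = (\<Sum>a\<in>?K. \<Sum>b\<in>?K. ?c a * ?c b * gval f (?l (a + b)))"
  proof -
    have "f (gluing (?G a) (?G b)) = gval f (?l (a + b))" if "a \<in> ?K" "b \<in> ?K" for a b
    proof -
      have "support_nodes (?l (a + b)) \<subseteq> {..<n}"
        using n[OF that(1)] n[OF that(2)] by (auto simp: support_nodes_def lookup_add)
      from f_shift_graph[OF this] show ?thesis
        by (simp add: gluing_shift_graph lookup_add[abs_def])
    qed
    then show ?thesis by (simp add: sum.reindex[OF inj] lookP)
  qed
  also have "\<dots> = Lf (p * p)"
  proof -
    have "p * p = (\<Sum>a\<in>?K. \<Sum>b\<in>?K. Poly_Mapping.single (a + b) (?c a * ?c b))"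
      by (subst (1 2) edge_poly_eq_sum) (simp add: sum_product mult_single)
    then show ?thesis by (simp add: Lf_sum Lf_single)
  qed
  finally have "Lf (p * p) = linear_extension f (quantum_mult P P)" ..
  moreover have "P \<in> quantum_graphs n"
    unfolding quantum_graphs_def using keysP by auto
  moreover have "1 \<le> n" by (simp add: n_def)
  ultimately show ?thesis
    using assms unfolding weakly_reflection_positive_def by metis
qed

end

section \<open>Correlations of the array of signs\<close>

definition edge_count :: "nat set \<Rightarrow> nat \<Rightarrow> nat" where
  "edge_count K c = card {n\<in>K. fst (prod_decode n) = c}"

lemma edge_count_insert:
  "finite K \<Longrightarrow> n \<notin> K \<Longrightarrow> edge_count (insert n K) c = (if fst (prod_decode n) = c then 1 else 0) + edge_count K c"
proof -
  assume "finite K" "n \<notin> K"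
  moreover have "{k \<in> insert n K. fst (prod_decode k) = c} =
      (if fst (prod_decode n) = c then insert n {k \<in> K. fst (prod_decode k) = c} else {k \<in> K. fst (prod_decode k) = c})"
    by auto
  ultimately show ?thesis by (simp add: edge_count_def)
qed

locale rp_parameter = limit_parameter +
  fixes d :: real
  assumes d_pos: "d > 0" and wrp: "weakly_reflection_positive f"
    and bound: "\<And>k. \<bar>f (K2 k)\<bar> \<le> d ^ k"
begin

text \<open>The scaling by 1/d turns the bound d^k on the k-th moment into the bound 1 that
  \<open>tame\<close> expects.\<close>

definition edge_var :: "nat \<Rightarrow> edge_poly" where
  "edge_var c = Poly_Mapping.single (Poly_Mapping.single c 1) (1 / d)"

text \<open>Models signs that, given the edge weights x_e, are independent with mean x_e / d:
  distinct copies of one edge contribute equal factors, so a set \<open>K\<close> of bits is read as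
  the multigraph with one parallel edge for each selected copy.\<close>

definition gcor :: "nat set \<Rightarrow> real" where
  "gcor K = gval f (edge_count K) / d ^ card K"

lemma pf_Lf: "poly.positive_functional Lf"
  unfolding poly.positive_functional_def by (simp add: Lf_add Lf_scale Lf_square_nonneg wrp)

text \<open>The even moments of a single variable are \<open>f (K2 (2 * k)) / d ^ (2 * k)\<close>.
  The sign \<open>e\<close> covers both factors 1 + x and 1 - x.\<close>

lemma tame_edge_var:
  assumes "\<bar>e\<bar> = 1"
  shows "poly.tame Lf (const_poly e * edge_var c)"
proof -
  have "Lf ((const_poly e * edge_var c) ^ (2 * k)) \<le> 1" for k
  proof -
    have "e * e = 1" using assms by (simp add: abs_if split: if_splits)
    then have *: "(const_poly e * edge_var c) ^ (2 * k) =
        Poly_Mapping.single (Poly_Mapping.single c (2 * k)) ((1 / d) ^ (2 * k))"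
    proof (induction k)
      case (Suc k)
      have "(const_poly e * edge_var c) ^ (2 * Suc k) =
          (const_poly e * edge_var c) * (const_poly e * edge_var c) * (const_poly e * edge_var c) ^ (2 * k)"
        by (simp add: mult.assoc)
      also have "\<dots> = Poly_Mapping.single (Poly_Mapping.single c (2 * Suc k)) ((1 / d) ^ (2 * Suc k))"
        using Suc by (simp add: edge_var_def mult_single single_add[symmetric] algebra_simps)
      finally show ?case .
    qed (simp add: single_one)
    obtain i j where ij: "i < j" "c = ecode i j" "endset c = {i, j}" by (rule obtain_ecode)
    have "f (K2 (2 * k)) = gval f (Poly_Mapping.lookup (Poly_Mapping.single c (2 * k)))"
    proof (rule f_eq_gval[where \<phi>="\<lambda>x. if x = 1 then i else j"])
      show "support_nodes (Poly_Mapping.lookup (Poly_Mapping.single c (2 * k)))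
          \<subseteq> (\<lambda>x. if x = 1 then i else j) ` nodes (K2 (2 * k))"
        using ij(3) by (auto simp: support_nodes_def lookup_single when_def split: if_splits)
    qed (use ij in \<open>auto simp: inj_on_def lookup_single when_def ecode_commute insert_commute\<close>)
    then have "Lf ((const_poly e * edge_var c) ^ (2 * k)) = f (K2 (2 * k)) / d ^ (2 * k)"
      unfolding * Lf_single by (simp add: power_one_over)
    also have "\<dots> \<le> 1" using bound[of "2 * k"] d_pos by (simp add: divide_le_eq)
    finally show ?thesis .
  qed
  then show ?thesis unfolding poly.tame_def by blast
qed

lemma Lf_prod_edge_var:
  assumes "finite K"
  shows "Lf (\<Prod>n\<in>K. edge_var (fst (prod_decode n))) = gcor K"
proof -
  have "(\<Prod>n\<in>K. edge_var (fst (prod_decode n))) =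
      Poly_Mapping.single (\<Sum>n\<in>K. Poly_Mapping.single (fst (prod_decode n)) 1) ((1 / d) ^ card K)"
    using assms
  proof (induction K)
    case (insert n K)
    then show ?case by (simp add: edge_var_def mult_single)
  qed (simp add: single_one)
  moreover have "Poly_Mapping.lookup (\<Sum>n\<in>K. Poly_Mapping.single (fst (prod_decode n)) 1) = edge_count K"
    using assms
  proof (induction K)
    case (insert n K)
    show ?case
    proof
      fix c
      show "Poly_Mapping.lookup (\<Sum>n\<in>insert n K. Poly_Mapping.single (fst (prod_decode n)) 1) c = edge_count (insert n K) c"
        using insert by (simp add: edge_count_insert lookup_add lookup_single when_def)
    qed
  qed (simp add: edge_count_def fun_eq_iff)
  ultimately show ?thesis by (simp add: Lf_single gcor_def power_one_over)
qed

lemma correlation_gcor: "correlation gcor"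
  unfolding correlation_def
proof (intro conjI allI)
  have "edge_count {} = (\<lambda>_. 0)" by (simp add: edge_count_def fun_eq_iff)
  then show "gcor {} = 1" by (simp add: gcor_def gval_0)
  fix s :: "bool list"
  let ?J = "{..<length s}" and ?x = "\<lambda>n. edge_var (fst (prod_decode n))"
  have *: "(\<Prod>i\<in>A. const_poly (sgnb (s ! i)) * ?x i) = const_poly (\<Prod>i\<in>A. sgnb (s ! i)) * (\<Prod>i\<in>A. ?x i)"
    if "finite A" for A
    using that
  proof (induction A)
    case (insert i A)
    then show ?case by (simp add: poly.C_mult mult_ac)
  qed (simp add: single_one)
  have "0 \<le> Lf (\<Prod>i\<in>?J. 1 + const_poly (sgnb (s ! i)) * ?x i)"
    by (rule poly.pf_prod_one_plus) (auto intro: pf_Lf tame_edge_var)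
  also have "(\<Prod>i\<in>?J. 1 + const_poly (sgnb (s ! i)) * ?x i) =
      (\<Sum>A\<in>Pow ?J. const_poly (\<Prod>i\<in>A. sgnb (s ! i)) * (\<Prod>i\<in>A. ?x i))"
  proof -
    have "(\<Prod>i\<in>?J. const_poly (sgnb (s ! i)) * ?x i + 1) =
      (\<Sum>A\<in>Pow ?J. (\<Prod>i\<in>A. const_poly (sgnb (s ! i)) * ?x i) * (\<Prod>i\<in>?J-A. 1))"
      by (rule prod_add) simp
    also have "\<dots> = (\<Sum>A\<in>Pow ?J. const_poly (\<Prod>i\<in>A. sgnb (s ! i)) * (\<Prod>i\<in>A. ?x i))"
      by (intro sum.cong refl) (simp only: * Pow_iff finite_subset[OF _ finite_lessThan] prod.neutral_const mult_1_right)
    finally show ?thesis by (simp only: add.commute)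
  qed
  also have "Lf \<dots> = (\<Sum>A\<in>Pow ?J. (\<Prod>i\<in>A. sgnb (s ! i)) * gcor A)"
    unfolding Lf_sum Lf_scale by (intro sum.cong refl) (simp add: Lf_prod_edge_var finite_subset)
  finally show "0 \<le> genp gcor s" by (simp add: genp_def)
qed

end

section \<open>Conditioning on a set of bits\<close>

text \<open>Forgetting bits as a map of the sequence space into itself: the sigma-algebra generated
  by the bits in \<open>S\<close> is the pullback of \<open>Bits\<close> along it.\<close>

definition keep :: "nat set \<Rightarrow> (nat \<Rightarrow> bool) \<Rightarrow> nat \<Rightarrow> bool" where
  "keep S \<omega> n \<longleftrightarrow> n \<in> S \<and> \<omega> n"

text \<open>Required at every point, not up to null sets, so that such functions can later be
  evaluated at resampled configurations.\<close>

definition depends_on :: "nat set \<Rightarrow> ((nat \<Rightarrow> bool) \<Rightarrow> 'a) \<Rightarrow> bool" where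
  "depends_on S G \<longleftrightarrow> (\<forall>\<omega> \<omega>'. (\<forall>n\<in>S. \<omega> n = \<omega>' n) \<longrightarrow> G \<omega> = G \<omega>')"

definition bdd1 :: "((nat \<Rightarrow> bool) \<Rightarrow> real) \<Rightarrow> bool" where
  "bdd1 G \<longleftrightarrow> G \<in> borel_measurable Bits \<and> (\<forall>\<omega>. \<bar>G \<omega>\<bar> \<le> 1)"

definition relab :: "(nat \<Rightarrow> nat) \<Rightarrow> (nat \<Rightarrow> bool) \<Rightarrow> nat \<Rightarrow> bool" where
  "relab \<pi> \<omega> n = \<omega> (\<pi> n)"

lemma depends_onD: "depends_on S G \<Longrightarrow> (\<And>n. n \<in> S \<Longrightarrow> \<omega> n = \<omega>' n) \<Longrightarrow> G \<omega> = G \<omega>'"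
  by (auto simp: depends_on_def)

lemma depends_on_mono: "depends_on S G \<Longrightarrow> S \<subseteq> T \<Longrightarrow> depends_on T G"
  by (auto simp: depends_on_def)

lemma depends_on_keep: "depends_on S G \<Longrightarrow> G (keep S \<omega>) = G \<omega>"
  by (erule depends_onD) (simp add: keep_def)

lemma depends_on_walsh: "K \<subseteq> S \<Longrightarrow> depends_on S (walsh K)"
  by (auto simp: depends_on_def walsh_def intro!: prod.cong)

lemma depends_on_mult:
  fixes G H :: "(nat \<Rightarrow> bool) \<Rightarrow> real"
  shows "depends_on S G \<Longrightarrow> depends_on S H \<Longrightarrow> depends_on S (\<lambda>\<omega>. G \<omega> * H \<omega>)"
  unfolding depends_on_def by (metis (no_types, lifting))

lemma depends_on_prod:
  fixes G :: "'i \<Rightarrow> (nat \<Rightarrow> bool) \<Rightarrow> real"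
  assumes "\<And>i. i \<in> I \<Longrightarrow> depends_on S (G i)"
  shows "depends_on S (\<lambda>\<omega>. \<Prod>i\<in>I. G i \<omega>)"
  unfolding depends_on_def
proof (intro allI impI)
  fix \<omega> \<omega>' :: "nat \<Rightarrow> bool" assume "\<forall>n\<in>S. \<omega> n = \<omega>' n"
  then show "(\<Prod>i\<in>I. G i \<omega>) = (\<Prod>i\<in>I. G i \<omega>')"
    using assms by (intro prod.cong refl) (auto intro: depends_onD)
qed

lemma depends_on_relab: "depends_on S G \<Longrightarrow> depends_on (\<pi> ` S) (\<lambda>\<omega>. G (relab \<pi> \<omega>))"
  by (auto simp: depends_on_def relab_def)

lemma measurable_keep [measurable]: "keep S \<in> Bits \<rightarrow>\<^sub>M Bits"
  by (rule measurable_BitsI) (simp add: keep_def[abs_def])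

lemma measurable_relab [measurable]: "relab \<pi> \<in> Bits \<rightarrow>\<^sub>M Bits"
  by (rule measurable_BitsI) (simp add: relab_def[abs_def])

lemma bdd1_measurable [measurable_dest]: "bdd1 G \<Longrightarrow> G \<in> borel_measurable Bits"
  by (simp add: bdd1_def)

lemma bdd1_le: "bdd1 G \<Longrightarrow> \<bar>G \<omega>\<bar> \<le> 1"
  by (simp add: bdd1_def)

lemma bdd1_mult: "bdd1 G \<Longrightarrow> bdd1 H \<Longrightarrow> bdd1 (\<lambda>\<omega>. G \<omega> * H \<omega>)"
  by (auto simp: bdd1_def abs_mult intro!: mult_le_one)

lemma bdd1_prod:
  assumes "\<And>i. i \<in> I \<Longrightarrow> bdd1 (G i)"
  shows "bdd1 (\<lambda>\<omega>. \<Prod>i\<in>I. G i \<omega>)"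
  using assms by (auto simp: bdd1_def abs_prod intro!: prod_le_1 borel_measurable_prod)

lemma bdd1_walsh: "bdd1 (walsh K)"
  by (simp add: bdd1_def)

lemma bdd1_compose: "bdd1 G \<Longrightarrow> T \<in> Bits \<rightarrow>\<^sub>M Bits \<Longrightarrow> bdd1 (\<lambda>\<omega>. G (T \<omega>))"
  unfolding bdd1_def by (auto intro: measurable_compose)

lemma bdd1_relab: "bdd1 G \<Longrightarrow> bdd1 (\<lambda>\<omega>. G (relab \<pi> \<omega>))"
  by (rule bdd1_compose) measurable

lemma walsh_relab:
  assumes "inj \<pi>"
  shows "walsh K (relab \<pi> \<omega>) = walsh (\<pi> ` K) \<omega>"
  using assms by (simp add: walsh_def relab_def prod.reindex inj_on_subset[OF assms])

lemma ex_depends_relab: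
  assumes "inj \<pi>" "bdd1 G" "depends_on (\<pi> ` S) G"
  obtains G' where "bdd1 G'" "depends_on S G'" "\<And>\<omega>. G' (relab \<pi> \<omega>) = G \<omega>"
proof
  define T where "T \<omega> n = (n \<in> \<pi> ` S \<and> \<omega> (inv \<pi> n))" for \<omega> :: "nat \<Rightarrow> bool" and n
  have [measurable]: "T \<in> Bits \<rightarrow>\<^sub>M Bits"
    by (rule measurable_BitsI) (simp add: T_def[abs_def])
  show "bdd1 (\<lambda>\<omega>. G (T \<omega>))" by (rule bdd1_compose[OF assms(2)]) measurable
  show "depends_on S (\<lambda>\<omega>. G (T \<omega>))"
    using assms(1) by (auto simp: depends_on_def T_def intro!: arg_cong[of _ _ G] ext)
  show "G (T (relab \<pi> \<omega>)) = G \<omega>" for \<omega>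
    using assms(1) by (intro depends_onD[OF assms(3)]) (auto simp: T_def relab_def)
qed

section \<open>Conditional expectations given a set of bits\<close>

locale bit_space = prob_space M for M :: "(nat \<Rightarrow> bool) measure" +
  assumes sets_M [measurable_cong]: "sets M = sets Bits"
begin

lemma space_M [simp]: "space M = UNIV"
  using sets_eq_imp_space_eq[OF sets_M] by simp

lemma measurable_M: "measurable M N = measurable Bits N"
  by (rule measurable_cong_sets[OF sets_M refl])

lemma bdd1_measurable_M [measurable_dest]: "bdd1 G \<Longrightarrow> G \<in> borel_measurable M"
  by (simp add: bdd1_def measurable_M)

lemma integrable_bdd1: "bdd1 G \<Longrightarrow> integrable M G"
  by (rule integrable_const_bound[where B=1]) (auto dest: bdd1_le bdd1_measurable_M)

lemma AE_eq_if_L2: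
  assumes "bdd1 Z" "bdd1 Z'"
    and "(\<integral>\<omega>. Z \<omega> * Z \<omega> \<partial>M) = (\<integral>\<omega>. Z \<omega> * Z' \<omega> \<partial>M)" "(\<integral>\<omega>. Z' \<omega> * Z' \<omega> \<partial>M) = (\<integral>\<omega>. Z \<omega> * Z' \<omega> \<partial>M)"
  shows "AE \<omega> in M. Z \<omega> = Z' \<omega>"
proof -
  note int = integrable_bdd1[OF bdd1_mult]
  have eq: "(Z \<omega> - Z' \<omega>)\<^sup>2 = Z \<omega> * Z \<omega> - 2 * (Z \<omega> * Z' \<omega>) + Z' \<omega> * Z' \<omega>" for \<omega>
    by (simp add: power2_eq_square algebra_simps)
  have "(\<integral>\<omega>. (Z \<omega> - Z' \<omega>)\<^sup>2 \<partial>M) = 0"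
    unfolding eq using assms by (simp add: int)
  moreover have "integrable M (\<lambda>\<omega>. (Z \<omega> - Z' \<omega>)\<^sup>2)"
    unfolding eq using assms by (simp add: int)
  ultimately have "AE \<omega> in M. (Z \<omega> - Z' \<omega>)\<^sup>2 = 0"
    by (subst (asm) integral_nonneg_eq_0_iff_AE) auto
  then show ?thesis by simp
qed

text \<open>
  The truncation changes the conditional expectation of a function bounded by 1 on a null set
  only.
\<close>

definition CE :: "nat set \<Rightarrow> ((nat \<Rightarrow> bool) \<Rightarrow> real) \<Rightarrow> (nat \<Rightarrow> bool) \<Rightarrow> real" where
  "CE S Y \<omega> = max (-1) (min 1 (real_cond_exp M (vimage_algebra UNIV (keep S) Bits) Y \<omega>))"

lemma subalg: "subalgebra M (vimage_algebra UNIV (keep S) Bits)"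
proof -
  have "keep S \<in> M \<rightarrow>\<^sub>M Bits" by measurable
  then have "sets (vimage_algebra UNIV (keep S) Bits) \<subseteq> sets M"
    using sets_image_in_sets[of M UNIV "keep S" Bits] by simp
  then show ?thesis by (simp add: subalgebra_def)
qed

lemma measurable_CE': "CE S Y \<in> borel_measurable (vimage_algebra UNIV (keep S) Bits)"
  unfolding CE_def[abs_def] by measurable

lemma bdd1_CE: "bdd1 (CE S Y)"
proof -
  have "CE S Y \<in> borel_measurable M"
    by (rule measurable_from_subalg[OF subalg measurable_CE'])
  then have "CE S Y \<in> borel_measurable Bits" by (simp only: measurable_M)
  then show ?thesis by (auto simp: bdd1_def CE_def)
qed

text \<open>A level set of a function measurable for the pulled-back sigma-algebra is a preimage
  under \<open>keep S\<close>, so it cannot separate configurations that agree on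
  \<open>S\<close>.\<close>

lemma depends_on_CE: "depends_on S (CE S Y)"
  unfolding depends_on_def
proof (intro allI impI)
  fix \<omega> \<omega>' :: "nat \<Rightarrow> bool" assume "\<forall>n\<in>S. \<omega> n = \<omega>' n"
  then have eq: "keep S \<omega> = keep S \<omega>'" by (auto simp: keep_def fun_eq_iff)
  have "CE S Y -` {CE S Y \<omega>} \<inter> space (vimage_algebra UNIV (keep S) Bits) \<in> sets (vimage_algebra UNIV (keep S) Bits)"
    by (rule measurable_sets[OF measurable_CE']) simp
  then have "CE S Y -` {CE S Y \<omega>} \<in> {keep S -` A \<inter> UNIV |A. A \<in> sets Bits}"
    by (subst (asm) sets_vimage_algebra2) auto
  then obtain A where A: "CE S Y -` {CE S Y \<omega>} = keep S -` A" by auto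
  have "\<omega> \<in> CE S Y -` {CE S Y \<omega>}" by simp
  then have "\<omega>' \<in> CE S Y -` {CE S Y \<omega>}" unfolding A using eq by simp
  then show "CE S Y \<omega> = CE S Y \<omega>'" by simp
qed

lemma measurable_depends_on:
  assumes "bdd1 G" "depends_on S G"
  shows "G \<in> borel_measurable (vimage_algebra UNIV (keep S) Bits)"
proof -
  have "keep S \<in> vimage_algebra UNIV (keep S) Bits \<rightarrow>\<^sub>M Bits"
    by (rule measurable_vimage_algebra1) simp
  from measurable_compose[OF this bdd1_measurable[OF assms(1)]]
  show ?thesis by (simp add: depends_on_keep[OF assms(2)])
qed

lemma CE_integral:
  assumes Y: "bdd1 Y" and G: "bdd1 G" "depends_on S G"
  shows "(\<integral>\<omega>. G \<omega> * Y \<omega> \<partial>M) = (\<integral>\<omega>. G \<omega> * CE S Y \<omega> \<partial>M)"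
proof -
  interpret finite_measure_subalgebra M "vimage_algebra UNIV (keep S) Bits"
    by unfold_locales (rule subalg)
  let ?R = "real_cond_exp M (vimage_algebra UNIV (keep S) Bits) Y"
  note [measurable] = bdd1_measurable_M[OF Y] bdd1_measurable_M[OF G(1)] bdd1_measurable_M[OF bdd1_CE[of S Y]]
  have "AE \<omega> in M. ?R \<omega> \<le> 1"
    by (rule real_cond_exp_le_c[OF integrable_bdd1[OF Y]]) (use bdd1_le[OF Y] in \<open>auto simp: abs_le_iff\<close>)
  moreover have "AE \<omega> in M. ?R \<omega> \<ge> -1"
    by (rule real_cond_exp_ge_c[OF integrable_bdd1[OF Y]]) (use bdd1_le[OF Y] in \<open>auto simp: abs_le_iff minus_le_iff\<close>)
  ultimately have AE: "AE \<omega> in M. G \<omega> * ?R \<omega> = G \<omega> * CE S Y \<omega>"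
    by eventually_elim (simp add: CE_def)
  have [measurable]: "?R \<in> borel_measurable M" by (rule borel_measurable_cond_exp2)
  have "(\<integral>\<omega>. G \<omega> * Y \<omega> \<partial>M) = (\<integral>\<omega>. G \<omega> * ?R \<omega> \<partial>M)"
    by (rule real_cond_exp_intg(2)[symmetric])
       (use measurable_depends_on[OF G] integrable_bdd1[OF bdd1_mult[OF G(1) Y]] in auto)
  also have "\<dots> = (\<integral>\<omega>. G \<omega> * CE S Y \<omega> \<partial>M)"
    by (intro integral_cong_AE AE) measurable
  finally show ?thesis .
qed

text \<open>Testing with \<open>G = CE S Y\<close> and \<open>G = Z\<close> shows that both squared
  norms equal the inner product of the two functions.\<close>

lemma CE_unique:
  assumes Y: "bdd1 Y" and Z: "bdd1 Z" "depends_on S Z"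
    and eq: "\<And>G. bdd1 G \<Longrightarrow> depends_on S G \<Longrightarrow> (\<integral>\<omega>. G \<omega> * Y \<omega> \<partial>M) = (\<integral>\<omega>. G \<omega> * Z \<omega> \<partial>M)"
  shows "AE \<omega> in M. CE S Y \<omega> = Z \<omega>"
proof (rule AE_eq_if_L2[OF bdd1_CE Z(1)])
  have C: "bdd1 (CE S Y)" "depends_on S (CE S Y)" by (rule bdd1_CE depends_on_CE)+
  show "(\<integral>\<omega>. CE S Y \<omega> * CE S Y \<omega> \<partial>M) = (\<integral>\<omega>. CE S Y \<omega> * Z \<omega> \<partial>M)"
    using CE_integral[OF Y C] eq[OF C] by simp
  show "(\<integral>\<omega>. Z \<omega> * Z \<omega> \<partial>M) = (\<integral>\<omega>. CE S Y \<omega> * Z \<omega> \<partial>M)"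
    using CE_integral[OF Y Z] eq[OF Z] by (simp add: mult.commute)
qed

end

section \<open>Relabellings that preserve the law\<close>

locale relabelled_bit_space = bit_space +
  fixes \<pi> :: "nat \<Rightarrow> nat"
  assumes inj_\<pi>: "inj \<pi>" and preserving: "distr M Bits (relab \<pi>) = M"
begin

lemma integral_relab:
  assumes "bdd1 G"
  shows "(\<integral>\<omega>. G (relab \<pi> \<omega>) \<partial>M) = (\<integral>\<omega>. G \<omega> \<partial>M)"
proof -
  note [measurable] = bdd1_measurable[OF assms]
  have "(\<integral>\<omega>. G \<omega> \<partial>M) = (\<integral>\<omega>. G \<omega> \<partial>distr M Bits (relab \<pi>))" by (simp only: preserving)
  also have "\<dots> = (\<integral>\<omega>. G (relab \<pi> \<omega>) \<partial>M)" by (rule integral_distr) measurable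
  finally show ?thesis ..
qed

lemma CE_relab:
  assumes Y: "bdd1 Y"
  shows "AE \<omega> in M. CE (\<pi> ` S) (\<lambda>\<omega>. Y (relab \<pi> \<omega>)) \<omega> = CE S Y (relab \<pi> \<omega>)"
proof (rule CE_unique)
  fix G assume "bdd1 G" "depends_on (\<pi> ` S) G"
  then obtain G' where G': "bdd1 G'" "depends_on S G'" "\<And>\<omega>. G' (relab \<pi> \<omega>) = G \<omega>"
    using ex_depends_relab[OF inj_\<pi>] by blast
  have "(\<integral>\<omega>. G \<omega> * Y (relab \<pi> \<omega>) \<partial>M) = (\<integral>\<omega>. G' \<omega> * Y \<omega> \<partial>M)"
    using integral_relab[OF bdd1_mult[OF G'(1) Y]] by (simp add: G'(3))
  also have "\<dots> = (\<integral>\<omega>. G' \<omega> * CE S Y \<omega> \<partial>M)" by (rule CE_integral[OF Y G'(1,2)])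
  also have "\<dots> = (\<integral>\<omega>. G \<omega> * CE S Y (relab \<pi> \<omega>) \<partial>M)"
    using integral_relab[OF bdd1_mult[OF G'(1) bdd1_CE]] by (simp add: G'(3))
  finally show "(\<integral>\<omega>. G \<omega> * Y (relab \<pi> \<omega>) \<partial>M) = (\<integral>\<omega>. G \<omega> * CE S Y (relab \<pi> \<omega>) \<partial>M)" .
qed (intro bdd1_relab depends_on_relab Y bdd1_CE depends_on_CE)+

text \<open>
  The conditional expectations of \<open>Y\<close> given \<open>S\<close> and given the larger set \<open>\<pi> ` S\<close> have the same
  distribution, hence the same \<open>L\<^sup>2\<close> norm, and the first is a projection of the second: they agree.
\<close>

lemma integral_CE_larger:
  assumes Y: "bdd1 Y" "\<And>\<omega>. Y (relab \<pi> \<omega>) = Y \<omega>"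
    and S: "S \<subseteq> \<pi> ` S" and G: "bdd1 G" "depends_on (\<pi> ` S) G"
  shows "(\<integral>\<omega>. G \<omega> * Y \<omega> \<partial>M) = (\<integral>\<omega>. G \<omega> * CE S Y \<omega> \<partial>M)"
proof -
  let ?h = "CE S Y"
  have h: "bdd1 ?h" "depends_on S ?h" by (rule bdd1_CE depends_on_CE)+
  \<comment> \<open>As \<open>Y\<close> is invariant, \<open>?h (relab \<pi> \<omega>)\<close> is
    its conditional expectation given the larger set.\<close>
  have transfer: "(\<integral>\<omega>. H \<omega> * Y \<omega> \<partial>M) = (\<integral>\<omega>. H \<omega> * ?h (relab \<pi> \<omega>) \<partial>M)"
    if H: "bdd1 H" "depends_on (\<pi> ` S) H" for H
  proof -
    obtain H' where H': "bdd1 H'" "depends_on S H'" "\<And>\<omega>. H' (relab \<pi> \<omega>) = H \<omega>"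
      using ex_depends_relab[OF inj_\<pi> H] by blast
    have "(\<integral>\<omega>. H \<omega> * Y \<omega> \<partial>M) = (\<integral>\<omega>. H' \<omega> * Y \<omega> \<partial>M)"
      using integral_relab[OF bdd1_mult[OF H'(1) Y(1)]] by (simp add: H'(3) Y(2))
    also have "\<dots> = (\<integral>\<omega>. H' \<omega> * ?h \<omega> \<partial>M)" by (rule CE_integral[OF Y(1) H'(1,2)])
    also have "\<dots> = (\<integral>\<omega>. H \<omega> * ?h (relab \<pi> \<omega>) \<partial>M)"
      using integral_relab[OF bdd1_mult[OF H'(1) h(1)]] by (simp add: H'(3))
    finally show ?thesis .
  qed
  have "AE \<omega> in M. ?h (relab \<pi> \<omega>) = ?h \<omega>"
  proof (rule AE_eq_if_L2[OF bdd1_relab[OF h(1)] h(1)])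
    have "(\<integral>\<omega>. ?h \<omega> * ?h \<omega> \<partial>M) = (\<integral>\<omega>. ?h \<omega> * Y \<omega> \<partial>M)"
      by (rule CE_integral[OF Y(1) h, symmetric])
    also have "\<dots> = (\<integral>\<omega>. ?h (relab \<pi> \<omega>) * ?h \<omega> \<partial>M)"
      using transfer[OF h(1) depends_on_mono[OF h(2) S]] by (simp add: mult.commute)
    finally show *: "(\<integral>\<omega>. ?h \<omega> * ?h \<omega> \<partial>M) = (\<integral>\<omega>. ?h (relab \<pi> \<omega>) * ?h \<omega> \<partial>M)" .
    show "(\<integral>\<omega>. ?h (relab \<pi> \<omega>) * ?h (relab \<pi> \<omega>) \<partial>M) = (\<integral>\<omega>. ?h (relab \<pi> \<omega>) * ?h \<omega> \<partial>M)"
      unfolding *[symmetric] by (rule integral_relab[OF bdd1_mult[OF h(1) h(1)]])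
  qed
  then have "(\<integral>\<omega>. G \<omega> * ?h (relab \<pi> \<omega>) \<partial>M) = (\<integral>\<omega>. G \<omega> * ?h \<omega> \<partial>M)"
    by (intro integral_cong_AE bdd1_measurable_M bdd1_mult G h bdd1_relab) auto
  with transfer[OF G] show ?thesis by simp
qed

end

section \<open>The exchangeable array\<close>

text \<open>The bit with index \<open>n\<close> is the copy number \<open>etag n\<close> of the edge with end points \<open>enodes n\<close>.\<close>

definition enodes :: "nat \<Rightarrow> nat set" where
  "enodes n = endset (fst (prod_decode n))"

definition etag :: "nat \<Rightarrow> nat" where
  "etag n = snd (prod_decode n)"

definition bidx :: "nat \<Rightarrow> nat \<Rightarrow> nat \<Rightarrow> nat" where
  "bidx i j t = prod_encode (ecode i j, t)"

definition nperm :: "(nat \<Rightarrow> nat) \<Rightarrow> nat \<Rightarrow> nat" where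
  "nperm \<sigma> n = (case ends (fst (prod_decode n)) of (i, j) \<Rightarrow> bidx (\<sigma> i) (\<sigma> j) (etag n))"

lemma enodes_bidx [simp]: "i \<noteq> j \<Longrightarrow> enodes (bidx i j t) = {i, j}"
  by (simp add: enodes_def bidx_def endset_ecode)

lemma etag_bidx [simp]: "etag (bidx i j t) = t"
  by (simp add: etag_def bidx_def)

lemma bidx_commute: "bidx i j t = bidx j i t"
  by (simp add: bidx_def ecode_commute)

lemma obtain_bidx:
  obtains i j where "i < j" "n = bidx i j (etag n)" "enodes n = {i, j}"
proof -
  obtain i j where ij: "i < j" "fst (prod_decode n) = ecode i j" "endset (fst (prod_decode n)) = {i, j}"
    by (rule obtain_ecode)
  then have "n = bidx i j (etag n)"
    by (metis bidx_def etag_def prod.collapse prod_decode_inverse)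
  with ij that show thesis by (simp add: enodes_def)
qed

lemma bidx_eq_iff:
  "i \<noteq> j \<Longrightarrow> k \<noteq> l \<Longrightarrow> bidx i j t = bidx k l t' \<longleftrightarrow> {i, j} = {k, l} \<and> t = t'"
  by (simp add: bidx_def ecode_eq_iff)

lemma bidx_if_enodes:
  assumes "enodes n = {i, j}"
  shows "n = bidx i j (etag n)"
proof -
  obtain k l where kl: "k < l" "n = bidx k l (etag n)" "enodes n = {k, l}" by (rule obtain_bidx)
  from kl(3) assms have "i = k \<and> j = l \<or> i = l \<and> j = k" by (auto simp: doubleton_eq_iff)
  with kl(2) show ?thesis by (metis bidx_commute)
qed

lemma decode_eq_ecode_iff:
  assumes "i \<noteq> j"
  shows "fst (prod_decode n) = ecode i j \<longleftrightarrow> enodes n = {i, j}"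
proof
  assume "enodes n = {i, j}"
  from bidx_if_enodes[OF this] have "prod_decode n = (ecode i j, etag n)"
    unfolding bidx_def by (metis prod_encode_inverse)
  then show "fst (prod_decode n) = ecode i j" by simp
qed (simp add: enodes_def endset_ecode assms)

lemma nperm_bidx: "i \<noteq> j \<Longrightarrow> nperm \<sigma> (bidx i j t) = bidx (\<sigma> i) (\<sigma> j) t"
  by (auto simp: nperm_def bidx_def ends_ecode etag_def min_def max_def ecode_commute)

lemma nperm_eq:
  assumes "i \<noteq> j" "n = bidx i j (etag n)"
  shows "nperm \<sigma> n = bidx (\<sigma> i) (\<sigma> j) (etag n)"
  using arg_cong[OF assms(2), of "nperm \<sigma>"] nperm_bidx[OF assms(1)] by (rule trans)

lemma inj_nperm:
  assumes "inj \<sigma>"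
  shows "inj (nperm \<sigma>)"
proof (rule injI)
  fix m n assume eq: "nperm \<sigma> m = nperm \<sigma> n"
  obtain i j where ij: "i < j" "m = bidx i j (etag m)" "enodes m = {i, j}" by (rule obtain_bidx)
  obtain k l where kl: "k < l" "n = bidx k l (etag n)" "enodes n = {k, l}" by (rule obtain_bidx)
  have "bidx (\<sigma> i) (\<sigma> j) (etag m) = bidx (\<sigma> k) (\<sigma> l) (etag n)"
    using eq nperm_eq[OF less_imp_neq[OF ij(1)] ij(2), of \<sigma>] nperm_eq[OF less_imp_neq[OF kl(1)] kl(2), of \<sigma>]
    by argo
  moreover have "\<sigma> i \<noteq> \<sigma> j" "\<sigma> k \<noteq> \<sigma> l" using assms ij(1) kl(1) by (auto simp: inj_eq)
  ultimately have "\<sigma> ` {i, j} = \<sigma> ` {k, l}" "etag m = etag n" by (simp_all add: bidx_eq_iff)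
  then have "{i, j} = {k, l}" by (simp only: inj_image_eq_iff[OF assms])
  then have "m = bidx k l (etag m)" using ij(3) by (intro bidx_if_enodes) simp
  also have "\<dots> = n" using \<open>etag m = etag n\<close> kl(2) by argo
  finally show "m = n" .
qed

lemma nperm_image_memI:
  assumes "enodes n = {\<sigma> i, \<sigma> j}" "i \<noteq> j" "bidx i j (etag n) \<in> S"
  shows "n \<in> nperm \<sigma> ` S"
  using assms bidx_if_enodes[OF assms(1)] by (intro image_eqI[OF _ assms(3)]) (simp add: nperm_bidx)

lemma nperm_fixed:
  assumes "\<And>x. x \<in> enodes n \<Longrightarrow> \<sigma> x = x"
  shows "nperm \<sigma> n = n"
proof -
  obtain i j where ij: "i < j" "n = bidx i j (etag n)" "enodes n = {i, j}" by (rule obtain_bidx)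
  have "nperm \<sigma> n = bidx (\<sigma> i) (\<sigma> j) (etag n)" by (rule nperm_eq[OF less_imp_neq[OF ij(1)] ij(2)])
  also have "\<dots> = bidx i j (etag n)" using assms[of i] assms[of j] ij(3) by simp
  also have "\<dots> = n" by (rule ij(2)[symmetric])
  finally show ?thesis .
qed

text \<open>
  The even nodes form an infinite background; the odd nodes are the ones sampled. A relabelling
  that maps the background onto a larger set turns the background into one that already contains
  given odd nodes.
\<close>

definition BG :: "nat set" where
  "BG = {x. even x}"

text \<open>For \<open>A\<close> outside the background: the edges within the background and those
  from \<open>A\<close> to it, but no edge within \<open>A\<close>. These are the bits given which
  the edges within \<open>A\<close> become independent.\<close>

definition rowset :: "nat set \<Rightarrow> nat set" where
  "rowset A = {n. enodes n \<subseteq> BG \<union> A \<and> enodes n \<inter> BG \<noteq> {}}"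

lemma infinite_BG: "infinite BG" "infinite (- BG)"
proof -
  have "infinite (range (\<lambda>i::nat. 2 * i))" "infinite (range (\<lambda>i::nat. Suc (2 * i)))"
    by (auto intro!: range_inj_infinite simp: inj_def)
  moreover have "range (\<lambda>i. 2 * i) \<subseteq> BG" "range (\<lambda>i. Suc (2 * i)) \<subseteq> - BG"
    by (auto simp: BG_def)
  ultimately show "infinite BG" "infinite (- BG)"
    by (blast dest: infinite_super)+
qed

lemma ex_bij_infinite_nat:
  assumes "infinite (A :: nat set)" "infinite (B :: nat set)"
  shows "\<exists>\<beta>. bij_betw \<beta> A B"
  using bij_betw_trans[OF bij_betw_inv_into[OF bij_enumerate[OF assms(1)]] bij_enumerate[OF assms(2)]] by blast

text \<open>Possible because the background and its complement are both infinite: off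
  \<open>D\<close>, the background is mapped bijectively onto itself together with \<open>A\<close>,
  and the other nodes still find room in the rest of the complement. \<open>D\<close> holds the
  nodes of the bits that must not move.\<close>

lemma ex_absorbing_relabelling:
  assumes "finite D" "finite A" "D \<inter> A = {}"
  obtains \<sigma> :: "nat \<Rightarrow> nat" where "inj \<sigma>" "\<And>x. x \<in> D \<Longrightarrow> \<sigma> x = x" "BG \<union> A \<subseteq> \<sigma> ` BG"
proof -
  have inf: "infinite (BG - D)" "infinite (BG \<union> A - D)" "infinite (- BG - D)" "infinite (- BG - (D \<union> A))"
    using infinite_BG assms by (auto simp: Un_Diff Diff_infinite_finite)
  obtain \<beta> where \<beta>: "bij_betw \<beta> (BG - D) (BG \<union> A - D)" using ex_bij_infinite_nat[OF inf(1,2)] by blast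
  obtain \<gamma> where \<gamma>: "bij_betw \<gamma> (- BG - D) (- BG - (D \<union> A))" using ex_bij_infinite_nat[OF inf(3,4)] by blast
  define \<sigma> where "\<sigma> x = (if x \<in> D then x else if x \<in> BG then \<beta> x else \<gamma> x)" for x
  have \<beta>': "\<sigma> x \<in> BG \<union> A - D" if "x \<in> BG - D" for x
    using that bij_betwE[OF \<beta>] by (auto simp: \<sigma>_def)
  have \<gamma>': "\<sigma> x \<in> - BG - (D \<union> A)" if "x \<in> - BG - D" for x
    using that bij_betwE[OF \<gamma>] by (auto simp: \<sigma>_def)
  have "inj_on \<sigma> (BG - D)" "inj_on \<sigma> (- BG - D)"
    using \<beta> \<gamma> by (auto simp: bij_betw_def inj_on_def \<sigma>_def)
  moreover have "inj_on \<sigma> D" by (simp add: inj_on_def \<sigma>_def)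
  moreover have "x \<in> D \<or> x \<in> BG - D \<or> x \<in> - BG - D" for x by auto
  ultimately have "inj \<sigma>"
    unfolding inj_on_def using \<beta>' \<gamma>'
    by (smt (verit) Compl_iff DiffD1 DiffD2 UnE UnI1 UnI2 \<sigma>_def)
  moreover have "BG \<union> A \<subseteq> \<sigma> ` BG"
  proof
    fix x assume x: "x \<in> BG \<union> A"
    show "x \<in> \<sigma> ` BG"
    proof (cases "x \<in> D")
      case True
      with x assms(3) show ?thesis by (intro image_eqI[of _ _ x]) (auto simp: \<sigma>_def)
    next
      case False
      with x have "x \<in> \<beta> ` (BG - D)" using \<beta> by (simp add: bij_betw_def)
      then show ?thesis by (auto simp: \<sigma>_def)
    qed
  qed
  moreover have "\<sigma> x = x" if "x \<in> D" for x using that by (simp add: \<sigma>_def)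
  ultimately show thesis using that by blast
qed

text \<open>End points in \<open>D\<close> are fixed and all others come from the background. Since
  some end point lies outside \<open>D\<close>, the preimage edge touches the background, hence lies
  in \<open>rowset D\<close>.\<close>

lemma rowset_absorbing:
  assumes "inj \<sigma>" "BG \<union> A \<subseteq> \<sigma> ` BG" "\<And>x. x \<in> D \<Longrightarrow> \<sigma> x = x" "D \<inter> BG = {}"
  shows "{n. enodes n \<subseteq> BG \<union> A \<union> D \<and> \<not> enodes n \<subseteq> D} \<subseteq> nperm \<sigma> ` rowset D"
proof
  fix n assume "n \<in> {n. enodes n \<subseteq> BG \<union> A \<union> D \<and> \<not> enodes n \<subseteq> D}"
  then have n: "enodes n \<subseteq> BG \<union> A \<union> D" "\<not> enodes n \<subseteq> D" by auto
  obtain i j where ij: "i < j" "enodes n = {i, j}" by (rule obtain_bidx[of n])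
  have pre: "\<exists>i'\<in>BG \<union> D. x = \<sigma> i' \<and> (x \<notin> D \<longrightarrow> i' \<in> BG)" if "x \<in> enodes n" for x
  proof (cases "x \<in> D")
    case True
    then show ?thesis using assms(3)[OF True] by (intro bexI[of _ x]) auto
  next
    case False
    then have "x \<in> \<sigma> ` BG" using that n(1) assms(2) by blast
    then show ?thesis by auto
  qed
  obtain i' where i': "i' \<in> BG \<union> D" "i = \<sigma> i'" "i \<notin> D \<longrightarrow> i' \<in> BG" using pre[of i] ij by auto
  obtain j' where j': "j' \<in> BG \<union> D" "j = \<sigma> j'" "j \<notin> D \<longrightarrow> j' \<in> BG" using pre[of j] ij by auto
  have "i' \<noteq> j'" using ij i' j' by auto
  then have "bidx i' j' (etag n) \<in> rowset D"
    using i' j' n(2) ij(2) by (auto simp: rowset_def)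
  then show "n \<in> nperm \<sigma> ` rowset D"
    using \<open>i' \<noteq> j'\<close> ij(2) i'(2) j'(2) by (intro nperm_image_memI[of _ _ i' j']) auto
qed

section \<open>Conditional independence of edges and of rows\<close>

context bit_space
begin

text \<open>A hybrid argument: the factors are exchanged one at a time, and in each step the
  remaining factors, old or new, together with \<open>G\<close> form an admissible test function
  \<open>H\<close>.\<close>

lemma integral_replace_all:
  assumes "finite I" "\<And>i. i \<in> I \<Longrightarrow> bdd1 (Y i)" "\<And>i. i \<in> I \<Longrightarrow> bdd1 (h i)" "bdd1 G"
    and "\<And>i. i \<in> I \<Longrightarrow> depends_on (R i) G"
    and "\<And>i j. i \<in> I \<Longrightarrow> j \<in> I \<Longrightarrow> i \<noteq> j \<Longrightarrow> depends_on (R i) (Y j)"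
    and "\<And>i j. i \<in> I \<Longrightarrow> j \<in> I \<Longrightarrow> i \<noteq> j \<Longrightarrow> depends_on (R i) (h j)"
    and rep: "\<And>i H. i \<in> I \<Longrightarrow> bdd1 H \<Longrightarrow> depends_on (R i) H \<Longrightarrow>
      (\<integral>\<omega>. H \<omega> * Y i \<omega> \<partial>M) = (\<integral>\<omega>. H \<omega> * h i \<omega> \<partial>M)"
  shows "(\<integral>\<omega>. G \<omega> * (\<Prod>i\<in>I. Y i \<omega>) \<partial>M) = (\<integral>\<omega>. G \<omega> * (\<Prod>i\<in>I. h i \<omega>) \<partial>M)"
  using assms
proof (induction I arbitrary: G)
  case (insert i I)
  have dep: "depends_on (R i) (Y j)" "depends_on (R j) (h i)" if "j \<in> I" for j
    using insert.hyps insert.prems(5)[of i j] insert.prems(6)[of j i] that by auto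
  have "(\<integral>\<omega>. G \<omega> * (\<Prod>j\<in>insert i I. Y j \<omega>) \<partial>M) = (\<integral>\<omega>. (G \<omega> * (\<Prod>j\<in>I. Y j \<omega>)) * Y i \<omega> \<partial>M)"
    using insert.hyps by (simp add: mult_ac)
  also have "\<dots> = (\<integral>\<omega>. (G \<omega> * (\<Prod>j\<in>I. Y j \<omega>)) * h i \<omega> \<partial>M)"
    using insert.hyps insert.prems(1-4) dep
    by (intro insert.prems(7) bdd1_mult bdd1_prod depends_on_mult depends_on_prod) auto
  also have "\<dots> = (\<integral>\<omega>. (G \<omega> * h i \<omega>) * (\<Prod>j\<in>I. Y j \<omega>) \<partial>M)"
    by (simp add: mult_ac)
  also have "\<dots> = (\<integral>\<omega>. (G \<omega> * h i \<omega>) * (\<Prod>j\<in>I. h j \<omega>) \<partial>M)"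
    by (rule insert.IH) (use insert.prems dep in \<open>auto intro!: bdd1_mult depends_on_mult\<close>)
  also have "\<dots> = (\<integral>\<omega>. G \<omega> * (\<Prod>j\<in>insert i I. h j \<omega>) \<partial>M)"
    using insert.hyps by (simp add: mult_ac)
  finally show ?case .
qed simp

end

context rp_parameter
begin

definition \<Omega> :: "(nat \<Rightarrow> bool) measure" where
  "\<Omega> = distr unit01 Bits (bits_of gcor)"

sublocale \<Omega>: bit_space \<Omega>
proof (intro bit_space.intro bit_space_axioms.intro)
  show "prob_space \<Omega>"
    unfolding \<Omega>_def by (rule prob_space.prob_space_distr[OF prob_space_unit01 measurable_bits_of'])
qed (simp add: \<Omega>_def)

lemma integral_walsh:
  assumes "finite K"
  shows "(\<integral>\<omega>. walsh K \<omega> \<partial>\<Omega>) = gcor K"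
  unfolding \<Omega>_def integral_distr[OF measurable_bits_of' measurable_walsh]
  by (rule integral_walsh_bits_of[OF correlation_gcor assms])

text \<open>This is the isomorphism invariance of f: \<open>nperm \<sigma>\<close> carries the
  multigraph of \<open>K\<close> along \<open>\<sigma>\<close> and keeps the number of copies on
  every edge.\<close>

lemma gcor_nperm:
  assumes "inj \<sigma>" "finite K"
  shows "gcor (nperm \<sigma> ` K) = gcor K"
proof -
  note inj = inj_nperm[OF assms(1)]
  have enodes_nperm: "enodes (nperm \<sigma> n) = \<sigma> ` enodes n" for n
  proof -
    obtain i j where ij: "i < j" "n = bidx i j (etag n)" "enodes n = {i, j}" by (rule obtain_bidx)
    have "nperm \<sigma> n = bidx (\<sigma> i) (\<sigma> j) (etag n)" by (rule nperm_eq[OF less_imp_neq[OF ij(1)] ij(2)])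
    moreover have "\<sigma> i \<noteq> \<sigma> j" using assms(1) ij(1) by (auto simp: inj_eq)
    ultimately show ?thesis using ij(3) by simp
  qed
  have "gval f (edge_count (nperm \<sigma> ` K)) = gval f (edge_count K)"
  proof (rule gval_relabel[OF _ assms(1)])
    have "{c. edge_count K c \<noteq> 0} \<subseteq> (\<lambda>n. fst (prod_decode n)) ` K"
      using assms(2) by (auto simp: edge_count_def card_gt_0_iff)
    then show "finite {c. edge_count K c \<noteq> 0}" using assms(2) finite_subset by blast
    show "edge_count (nperm \<sigma> ` K) (ecode (\<sigma> i) (\<sigma> j)) = edge_count K (ecode i j)" if "i \<noteq> j" for i j
    proof -
      have ne: "\<sigma> i \<noteq> \<sigma> j" using assms(1) that by (simp add: inj_eq)
      have "\<sigma> ` enodes n = {\<sigma> i, \<sigma> j} \<longleftrightarrow> enodes n = {i, j}" for n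
        using inj_image_eq_iff[OF assms(1), of "enodes n" "{i, j}"] by simp
      then have "{n \<in> nperm \<sigma> ` K. fst (prod_decode n) = ecode (\<sigma> i) (\<sigma> j)} =
          nperm \<sigma> ` {n \<in> K. fst (prod_decode n) = ecode i j}"
        by (auto simp: decode_eq_ecode_iff[OF ne] decode_eq_ecode_iff[OF that] enodes_nperm)
      then show ?thesis
        by (simp add: edge_count_def card_image inj_on_subset[OF inj])
    qed
    show "endset c \<subseteq> range \<sigma>" if "edge_count (nperm \<sigma> ` K) c \<noteq> 0" for c
    proof -
      from that obtain n where "n \<in> K" "fst (prod_decode (nperm \<sigma> n)) = c"
        unfolding edge_count_def by (metis (mono_tags, lifting) card.empty empty_Collect_eq imageE)
      then show ?thesis using enodes_nperm[of n] by (auto simp: enodes_def)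
    qed
  qed
  then show ?thesis by (simp add: gcor_def card_image inj_on_subset[OF inj])
qed

lemma relabelledI:
  assumes "inj \<pi>" "\<And>K. finite K \<Longrightarrow> gcor (\<pi> ` K) = gcor K"
  shows "relabelled_bit_space \<Omega> \<pi>"
proof (intro relabelled_bit_space.intro relabelled_bit_space_axioms.intro \<Omega>.bit_space_axioms assms(1))
  have "distr \<Omega> Bits (relab \<pi>) = distr \<Omega> Bits (\<lambda>\<omega>. \<omega>)"
  proof (rule distr_Bits_eqI[OF \<Omega>.prob_space_axioms \<Omega>.prob_space_axioms])
    show "(\<integral>\<omega>. walsh K (relab \<pi> \<omega>) \<partial>\<Omega>) = (\<integral>\<omega>. walsh K \<omega> \<partial>\<Omega>)" if "finite K" for K
      using that assms by (simp add: walsh_relab integral_walsh)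
  qed (simp_all add: \<Omega>.measurable_M measurable_relab)
  also have "\<dots> = \<Omega>"
    by (rule distr_id2) (simp add: \<Omega>.sets_M)
  finally show "distr \<Omega> Bits (relab \<pi>) = \<Omega>" .
qed

lemma relabelled_nperm: "inj \<sigma> \<Longrightarrow> relabelled_bit_space \<Omega> (nperm \<sigma>)"
  by (rule relabelledI[OF inj_nperm gcor_nperm])

text \<open>Multiplicity k is realized by the first k copies of the edge.\<close>

definition pairset :: "nat \<Rightarrow> nat \<Rightarrow> nat \<Rightarrow> nat set" where
  "pairset a b k = bidx a b ` {..<k}"

lemma enodes_pairset: "a \<noteq> b \<Longrightarrow> n \<in> pairset a b k \<Longrightarrow> enodes n = {a, b}"
  by (auto simp: pairset_def)

text \<open>A relabelling that fixes \<open>a\<close> and \<open>b\<close> and absorbs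
  \<open>A\<close> leaves the copies of the edge ab unchanged, while all other bits seen by
  \<open>G\<close> fall into the image of \<open>rowset {a, b}\<close>. So given the rows of
  \<open>a\<close> and \<open>b\<close>, those bits tell nothing more about the edge.\<close>

lemma replace_edge:
  assumes "a \<noteq> b" "a \<notin> BG" "b \<notin> BG" "finite A" "a \<notin> A" "b \<notin> A"
    and "bdd1 G" "depends_on {n. enodes n \<subseteq> BG \<union> A \<union> {a, b} \<and> \<not> enodes n \<subseteq> {a, b}} G"
  shows "(\<integral>\<omega>. G \<omega> * walsh (pairset a b k) \<omega> \<partial>\<Omega>)
    = (\<integral>\<omega>. G \<omega> * \<Omega>.CE (rowset {a, b}) (walsh (pairset a b k)) \<omega> \<partial>\<Omega>)"
proof -
  obtain \<sigma> where \<sigma>: "inj \<sigma>" "\<And>x. x \<in> {a, b} \<Longrightarrow> \<sigma> x = x" "BG \<union> A \<subseteq> \<sigma> ` BG"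
    by (rule ex_absorbing_relabelling[of "{a, b}" A]) (use assms in auto)
  interpret relabelled_bit_space \<Omega> "nperm \<sigma>" by (rule relabelled_nperm[OF \<sigma>(1)])
  have sub: "{n. enodes n \<subseteq> BG \<union> A \<union> {a, b} \<and> \<not> enodes n \<subseteq> {a, b}} \<subseteq> nperm \<sigma> ` rowset {a, b}"
    by (rule rowset_absorbing[OF \<sigma>(1,3,2)]) (use assms in auto)
  have "walsh (pairset a b k) (relab (nperm \<sigma>) \<omega>) = walsh (pairset a b k) \<omega>" for \<omega>
  proof -
    have "nperm \<sigma> n = n" if "n \<in> pairset a b k" for n
      using enodes_pairset[OF assms(1) that] \<sigma>(2) by (intro nperm_fixed) auto
    then have "nperm \<sigma> ` pairset a b k = pairset a b k" by auto
    then show ?thesis by (simp add: walsh_relab inj_\<pi>)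
  qed
  moreover have "rowset {a, b} \<subseteq> nperm \<sigma> ` rowset {a, b}"
    using sub assms(2,3) by (auto simp: rowset_def)
  ultimately show ?thesis
    using depends_on_mono[OF assms(8) sub] by (intro integral_CE_larger bdd1_walsh assms(7)) auto
qed

lemma replace_row:
  assumes "a \<notin> BG" "finite A" "a \<notin> A" "A \<inter> BG = {}" "finite K" "\<And>n. n \<in> K \<Longrightarrow> enodes n \<subseteq> insert a BG"
    and "bdd1 G" "depends_on (rowset A) G"
  shows "(\<integral>\<omega>. G \<omega> * walsh K \<omega> \<partial>\<Omega>) = (\<integral>\<omega>. G \<omega> * \<Omega>.CE (rowset {}) (walsh K) \<omega> \<partial>\<Omega>)"
proof -
  \<comment> \<open>The background nodes met by \<open>K\<close> have to be fixed as well; this set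
    is finite because rows are tested by finite characters only.\<close>
  let ?D = "insert a (\<Union>n\<in>K. enodes n)"
  have "finite ?D" using assms(5) by (simp add: enodes_def)
  moreover have "?D \<inter> A = {}" using assms(3,4,6) by blast
  ultimately obtain \<sigma> where \<sigma>: "inj \<sigma>" "\<And>x. x \<in> ?D \<Longrightarrow> \<sigma> x = x" "BG \<union> A \<subseteq> \<sigma> ` BG"
    using assms(2) by (metis ex_absorbing_relabelling)
  interpret relabelled_bit_space \<Omega> "nperm \<sigma>" by (rule relabelled_nperm[OF \<sigma>(1)])
  have sub: "{n. enodes n \<subseteq> BG \<union> A \<union> {} \<and> \<not> enodes n \<subseteq> {}} \<subseteq> nperm \<sigma> ` rowset {}"
    by (rule rowset_absorbing[OF \<sigma>(1,3)]) auto
  have "walsh K (relab (nperm \<sigma>) \<omega>) = walsh K \<omega>" for \<omega>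
  proof -
    have "nperm \<sigma> n = n" if "n \<in> K" for n
      using that \<sigma>(2) by (intro nperm_fixed) auto
    then have "nperm \<sigma> ` K = K" by auto
    then show ?thesis by (simp add: walsh_relab inj_\<pi>)
  qed
  moreover have "rowset {} \<subseteq> nperm \<sigma> ` rowset {}" "rowset A \<subseteq> nperm \<sigma> ` rowset {}"
    by (rule order_trans[OF _ sub]; auto simp: rowset_def)+
  ultimately show ?thesis
    using depends_on_mono[OF assms(8)] by (intro integral_CE_larger bdd1_walsh assms(7)) auto
qed

end

section \<open>Sampled nodes, their rows, and relabellings fixing the background\<close>

definition lab :: "nat \<Rightarrow> nat" where
  "lab i = Suc (2 * i)"

text \<open>\<open>ridx a\<close> enumerates the bits of the edges joining the odd node \<open>a\<close> to the background.\<close>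

definition ridx :: "nat \<Rightarrow> nat \<Rightarrow> nat" where
  "ridx a m = bidx a (2 * fst (prod_decode m)) (snd (prod_decode m))"

text \<open>All other bits are set to \<open>False\<close>, as \<open>keep\<close> does, so that the
  laws of the two configurations can be compared.\<close>

definition cfg :: "nat set \<Rightarrow> (nat \<Rightarrow> bool) \<Rightarrow> (nat \<Rightarrow> nat \<Rightarrow> bool) \<Rightarrow> nat \<Rightarrow> bool" where
  "cfg V \<omega> \<rho> n \<longleftrightarrow> n \<in> rowset {} \<and> \<omega> n \<or> (\<exists>i\<in>V. \<exists>m. n = ridx (lab i) m \<and> \<rho> i m)"

lemma lab_eq_iff [simp]: "lab i = lab j \<longleftrightarrow> i = j"
  by (simp add: lab_def)

lemma lab_not_BG [simp]: "lab i \<notin> BG"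
  by (simp add: lab_def BG_def)

lemma double_BG [simp]: "2 * i \<in> BG"
  by (simp add: BG_def)

lemma lab_neq_double: "lab i \<noteq> 2 * k" "2 * k \<noteq> lab i"
  by (simp_all add: lab_def) presburger+

lemma enodes_ridx [simp]: "enodes (ridx (lab i) m) = {lab i, 2 * fst (prod_decode m)}"
  by (simp add: ridx_def lab_neq_double)

lemma ridx_eq_iff [simp]: "ridx (lab i) m = ridx (lab j) m' \<longleftrightarrow> i = j \<and> m = m'"
proof
  assume "ridx (lab i) m = ridx (lab j) m'"
  then have "{lab i, 2 * fst (prod_decode m)} = {lab j, 2 * fst (prod_decode m')}"
    "snd (prod_decode m) = snd (prod_decode m')"
    by (simp_all add: ridx_def bidx_eq_iff lab_neq_double)
  then have "i = j" "prod_decode m = prod_decode m'"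
    by (auto simp: doubleton_eq_iff lab_neq_double prod_eq_iff)
  then show "i = j \<and> m = m'" by (metis prod_decode_inverse)
qed simp

lemma inj_ridx: "inj (ridx (lab i))"
  by (simp add: inj_def)

lemma ridx_notin_rowset_empty [simp]: "ridx (lab i) m \<notin> rowset {}"
  by (simp add: rowset_def)

lemma rowset_cases:
  assumes "n \<in> rowset (lab ` V)"
  obtains "n \<in> rowset {}" | i m where "i \<in> V" "n = ridx (lab i) m"
proof -
  obtain a b where ab: "a < b" "n = bidx a b (etag n)" "enodes n = {a, b}" by (rule obtain_bidx)
  have row: "\<exists>m. n = ridx (lab i) m" if "enodes n = {lab i, c}" "c \<in> BG" for i c
  proof -
    from that(2) obtain k where "c = 2 * k" by (auto simp: BG_def elim: evenE)
    then have "n = ridx (lab i) (prod_encode (k, etag n))"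
      using bidx_if_enodes[OF that(1)] by (simp add: ridx_def)
    then show ?thesis ..
  qed
  consider "a \<in> BG" "b \<in> BG" | i where "i \<in> V" "a = lab i" "b \<in> BG" | i where "i \<in> V" "b = lab i" "a \<in> BG"
    using assms ab(3) by (auto simp: rowset_def)
  then show thesis
  proof cases
    case 1
    then show thesis using that(1) ab(3) by (simp add: rowset_def)
  next
    case 2
    then show thesis using that(2) row[of i b] ab(3) by auto
  next
    case 3
    then show thesis using that(2) row[of i a] ab(3) by (auto simp: insert_commute)
  qed
qed

lemma ridx_in_rowset [simp]: "i \<in> V \<Longrightarrow> ridx (lab i) m \<in> rowset (lab ` V)"
  by (simp add: rowset_def)

lemma rowset_mono: "A \<subseteq> B \<Longrightarrow> rowset A \<subseteq> rowset B"
  by (auto simp: rowset_def)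

lemma cfg_background [simp]: "n \<in> rowset {} \<Longrightarrow> cfg V \<omega> \<rho> n = \<omega> n"
  by (auto simp: cfg_def)

lemma cfg_row [simp]: "i \<in> V \<Longrightarrow> cfg V \<omega> \<rho> (ridx (lab i) m) = \<rho> i m"
  by (auto simp: cfg_def)

lemma cfg_outside: "n \<notin> rowset (lab ` V) \<Longrightarrow> \<not> cfg V \<omega> \<rho> n"
  using rowset_mono[of "{}" "lab ` V"] by (auto simp: cfg_def)

text \<open>Unlike the absorbing relabellings, these fix the background pointwise: they carry one
  sampled node to another without disturbing what is conditioned on.\<close>

lemma ex_relabelling:
  assumes "finite D" "D \<inter> BG = {}" "inj_on \<tau> D" "\<tau> ` D \<inter> BG = {}"
  obtains \<sigma> :: "nat \<Rightarrow> nat" where "inj \<sigma>" "\<And>x. x \<in> D \<Longrightarrow> \<sigma> x = \<tau> x" "\<And>x. x \<in> BG \<Longrightarrow> \<sigma> x = x"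
proof -
  have inf: "infinite (- BG - D)" "infinite (- BG - \<tau> ` D)"
    using infinite_BG assms by (auto simp: Diff_infinite_finite)
  obtain \<gamma> where \<gamma>: "bij_betw \<gamma> (- BG - D) (- BG - \<tau> ` D)" using ex_bij_infinite_nat[OF inf] by blast
  define \<sigma> where "\<sigma> x = (if x \<in> D then \<tau> x else if x \<in> BG then x else \<gamma> x)" for x
  have \<gamma>': "\<gamma> x \<in> - BG - \<tau> ` D" if "x \<in> - BG - D" for x
    using that bij_betwE[OF \<gamma>] by auto
  have \<gamma>_inj: "x = y" if "\<gamma> x = \<gamma> y" "x \<in> - BG - D" "y \<in> - BG - D" for x y
    using that \<gamma> by (auto simp: bij_betw_def inj_on_def)
  have "inj \<sigma>"
  proof (rule injI)
    fix x y assume eq: "\<sigma> x = \<sigma> y"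
    consider "x \<in> D" | "x \<in> BG" "x \<notin> D" | "x \<in> - BG - D" by auto
    then show "x = y"
    proof cases
      case 1
      with eq \<gamma>'[of y] assms(4) imageI[OF 1, of \<tau>] have "y \<in> D" by (auto simp: \<sigma>_def split: if_splits)
      with 1 eq assms(3) show ?thesis by (simp add: \<sigma>_def inj_on_eq_iff)
    next
      case 2
      with eq \<gamma>'[of y] assms(4) have "y \<in> BG" "y \<notin> D" by (auto simp: \<sigma>_def split: if_splits)
      with 2 eq show ?thesis by (simp add: \<sigma>_def)
    next
      case 3
      with eq \<gamma>'[of x] assms(4) have "y \<in> - BG - D" by (auto simp: \<sigma>_def split: if_splits)
      with 3 eq show ?thesis by - (rule \<gamma>_inj, simp_all add: \<sigma>_def)
    qed
  qed
  moreover have "\<sigma> x = x" if "x \<in> BG" for x using that assms(2) by (auto simp: \<sigma>_def)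
  ultimately show thesis using that[of \<sigma>] by (simp add: \<sigma>_def)
qed

lemma
  assumes "\<And>x. x \<in> BG \<Longrightarrow> \<sigma> x = x"
  shows nperm_background: "n \<in> rowset {} \<Longrightarrow> nperm \<sigma> n = n"
    and nperm_ridx: "\<sigma> (lab i) = a \<Longrightarrow> nperm \<sigma> (ridx (lab i) m) = ridx a m"
  using assms by (auto intro!: nperm_fixed simp: rowset_def ridx_def nperm_bidx lab_neq_double)

lemma nperm_rowset:
  assumes "\<And>x. x \<in> BG \<Longrightarrow> \<sigma> x = x" "\<And>i. i \<in> V \<Longrightarrow> \<sigma> (lab i) = lab (\<tau> i)"
  shows "nperm \<sigma> ` rowset (lab ` V) = rowset (lab ` \<tau> ` V)"
proof (intro equalityI subsetI)
  fix n assume "n \<in> nperm \<sigma> ` rowset (lab ` V)"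
  then obtain k where k: "k \<in> rowset (lab ` V)" "n = nperm \<sigma> k" by auto
  from k(1) show "n \<in> rowset (lab ` \<tau> ` V)"
  proof (cases rule: rowset_cases)
    case 1
    then show ?thesis
      using k(2) assms(1) rowset_mono[of "{}" "lab ` \<tau> ` V"] by (auto simp: nperm_background)
  next
    case (2 i m)
    then have "n = ridx (lab (\<tau> i)) m" using k(2) assms by (auto simp: nperm_ridx)
    with 2 show ?thesis by simp
  qed
next
  fix n assume "n \<in> rowset (lab ` \<tau> ` V)"
  then show "n \<in> nperm \<sigma> ` rowset (lab ` V)"
  proof (cases rule: rowset_cases)
    case 1
    then show ?thesis
      using assms(1) rowset_mono[of "{}" "lab ` V"] by (intro image_eqI[of _ _ n]) (auto simp: nperm_background)
  next
    case (2 i m)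
    then obtain j where "j \<in> V" "i = \<tau> j" by auto
    with 2 show ?thesis
      using assms by (intro image_eqI[of _ _ "ridx (lab j) m"]) (auto simp: nperm_ridx)
  qed
qed

section \<open>The conditional law of a row given the background\<close>

context bit_space
begin

lemma CE_const_1: "AE \<omega> in M. CE S (\<lambda>_. 1) \<omega> = 1"
  by (rule CE_unique) (auto simp: bdd1_def depends_on_def)

lemma CE_combination_nonneg:
  assumes "finite I" "\<And>i. i \<in> I \<Longrightarrow> bdd1 (Y i)" "\<And>\<omega>. 0 \<le> (\<Sum>i\<in>I. c i * Y i \<omega>)"
  shows "AE \<omega> in M. 0 \<le> (\<Sum>i\<in>I. c i * CE S (Y i) \<omega>)"
proof -
  define Z where "Z \<omega> = (\<Sum>i\<in>I. c i * CE S (Y i) \<omega>)" for \<omega>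
  \<comment> \<open>The test function is the event on which the combination is negative; it depends
    on \<open>S\<close> alone, so it is admissible for \<open>CE_integral\<close>.\<close>
  define G where "G \<omega> = (indicator {..<0} (Z \<omega>) :: real)" for \<omega>
  have CE_meas [measurable]: "CE S (Y i) \<in> borel_measurable Bits" for i
    by (rule bdd1_measurable[OF bdd1_CE])
  have [measurable]: "Z \<in> borel_measurable Bits" unfolding Z_def[abs_def] by measurable
  have G: "bdd1 G"
    by (auto simp: bdd1_def G_def[abs_def] indicator_def) measurable
  have "Z \<omega> = Z \<omega>'" if "\<forall>n\<in>S. \<omega> n = \<omega>' n" for \<omega> \<omega>'
    using that depends_onD[OF depends_on_CE, of S \<omega> \<omega>'] by (auto simp: Z_def intro!: sum.cong)
  then have G': "depends_on S G"
    unfolding depends_on_def G_def by metis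
  have int: "integrable M (\<lambda>\<omega>. G \<omega> * Y i \<omega>)" "integrable M (\<lambda>\<omega>. G \<omega> * CE S (Y i) \<omega>)" if "i \<in> I" for i
    using that assms(2) by (auto intro!: integrable_bdd1 bdd1_mult G bdd1_CE)
  have GZ: "G \<omega> * Z \<omega> = (\<Sum>i\<in>I. c i * (G \<omega> * CE S (Y i) \<omega>))" for \<omega>
    by (simp add: Z_def sum_distrib_left mult_ac)
  have intGZ: "integrable M (\<lambda>\<omega>. G \<omega> * Z \<omega>)"
    unfolding GZ using int by (intro Bochner_Integration.integrable_sum integrable_mult_right) auto
  have "0 \<le> (\<integral>\<omega>. G \<omega> * (\<Sum>i\<in>I. c i * Y i \<omega>) \<partial>M)"
    using assms(3) by (intro Bochner_Integration.integral_nonneg) (auto simp: G_def indicator_def)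
  also have "\<dots> = (\<Sum>i\<in>I. c i * (\<integral>\<omega>. G \<omega> * Y i \<omega> \<partial>M))"
  proof -
    have "G \<omega> * (\<Sum>i\<in>I. c i * Y i \<omega>) = (\<Sum>i\<in>I. c i * (G \<omega> * Y i \<omega>))" for \<omega>
      by (simp add: sum_distrib_left mult_ac)
    then show ?thesis using int by (simp add: Bochner_Integration.integral_sum)
  qed
  also have "\<dots> = (\<Sum>i\<in>I. c i * (\<integral>\<omega>. G \<omega> * CE S (Y i) \<omega> \<partial>M))"
    using assms(2) by (intro sum.cong refl arg_cong2[of _ _ _ _ "(*)"] CE_integral G G') auto
  also have "\<dots> = (\<integral>\<omega>. G \<omega> * Z \<omega> \<partial>M)"
    unfolding GZ using int by (simp add: Bochner_Integration.integral_sum)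
  finally have "(\<integral>\<omega>. - (G \<omega> * Z \<omega>) \<partial>M) \<le> 0" by simp
  moreover have nn: "0 \<le> - (G \<omega> * Z \<omega>)" for \<omega> by (auto simp: G_def indicator_def)
  ultimately have "(\<integral>\<omega>. - (G \<omega> * Z \<omega>) \<partial>M) = 0"
    by (intro antisym Bochner_Integration.integral_nonneg) auto
  then have "AE \<omega> in M. - (G \<omega> * Z \<omega>) = 0"
    by (subst (asm) integral_nonneg_eq_0_iff_AE) (use intGZ nn in auto)
  then show ?thesis
    by eventually_elim (auto simp: G_def indicator_def Z_def split: if_splits)
qed

text \<open>Replaces the existence of regular conditional distributions: each would-be cylinder
  probability is a conditional mean of a nonnegative function, hence nonnegative almost everywhere,
  and there are only countably many bit lists.\<close>

lemma CE_correlation: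
  assumes "\<And>A. finite A \<Longrightarrow> AE \<omega> in M. CE S (walsh (\<iota> ` A)) \<omega> = R \<omega> A" "inj \<iota>"
  shows "AE \<omega> in M. correlation (R \<omega>)"
proof -
  have "walsh {} = (\<lambda>_. 1)" by (simp add: fun_eq_iff)
  then have "AE \<omega> in M. CE S (\<lambda>_. 1) \<omega> = R \<omega> {}" using assms(1)[of "{}"] by simp
  with CE_const_1[of S] have "AE \<omega> in M. R \<omega> {} = 1" by eventually_elim simp
  moreover have "AE \<omega> in M. 0 \<le> genp (R \<omega>) s" for s
  proof -
    let ?J = "{..<length s}"
    let ?c = "\<lambda>A. \<Prod>i\<in>A. sgnb (s ! i)"
    have "0 \<le> (\<Sum>A\<in>Pow ?J. ?c A * walsh (\<iota> ` A) \<omega>)" for \<omega>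
    proof -
      have "(\<Sum>A\<in>Pow ?J. ?c A * walsh (\<iota> ` A) \<omega>) =
          (\<Sum>A\<in>Pow ?J. (\<Prod>i\<in>A. sgnb (s ! i) * sgnb (\<omega> (\<iota> i))) * (\<Prod>i\<in>?J-A. 1))"
        by (intro sum.cong refl)
           (simp add: walsh_def prod.reindex inj_on_subset[OF assms(2)] prod.distrib)
      also have "\<dots> = (\<Prod>i\<in>?J. sgnb (s ! i) * sgnb (\<omega> (\<iota> i)) + 1)"
        by (rule prod_add[symmetric]) simp
      also have "0 \<le> \<dots>" by (intro prod_nonneg) (auto simp: sgnb_def)
      finally show ?thesis .
    qed
    then have "AE \<omega> in M. 0 \<le> (\<Sum>A\<in>Pow ?J. ?c A * CE S (walsh (\<iota> ` A)) \<omega>)"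
      by (intro CE_combination_nonneg bdd1_walsh) auto
    moreover have "AE \<omega> in M. \<forall>A\<in>Pow ?J. CE S (walsh (\<iota> ` A)) \<omega> = R \<omega> A"
      by (intro AE_finite_allI) (auto intro!: assms(1) intro: finite_subset)
    ultimately show ?thesis
      by eventually_elim (simp add: genp_def)
  qed
  then have "AE \<omega> in M. \<forall>s. 0 \<le> genp (R \<omega>) s" by (simp add: AE_all_countable)
  ultimately show ?thesis by eventually_elim (simp add: correlation_def)
qed

end

context rp_parameter
begin

definition rowcor :: "(nat \<Rightarrow> bool) \<Rightarrow> nat set \<Rightarrow> real" where
  "rowcor \<omega> A = \<Omega>.CE (rowset {}) (walsh (ridx (lab 0) ` A)) \<omega>"

text \<open>The default on the exceptional null set is the correlation of independent fair signs, so
  that \<open>Q\<close> can be used at every \<open>\<omega>\<close>.\<close>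

definition rowcor' :: "(nat \<Rightarrow> bool) \<Rightarrow> nat set \<Rightarrow> real" where
  "rowcor' \<omega> A = (if correlation (rowcor \<omega>) then rowcor \<omega> A else of_bool (A = {}))"

text \<open>A sampler for rows: for uniform u, \<open>Q \<omega> u\<close> has, for almost every
  \<open>\<omega>\<close>, the conditional law of a row given the background bits of
  \<open>\<omega>\<close>.\<close>

definition Q :: "(nat \<Rightarrow> bool) \<Rightarrow> real \<Rightarrow> nat \<Rightarrow> bool" where
  "Q \<omega> = bits_of (rowcor' \<omega>)"

lemma correlation_rowcor': "correlation (rowcor' \<omega>)"
proof -
  have "correlation (\<lambda>A. of_bool (A = {}))"
    by (auto simp: correlation_def genp_def intro!: divide_nonneg_nonneg sum_nonneg)
  then show ?thesis
    by (cases "correlation (rowcor \<omega>)") (simp_all add: rowcor'_def[abs_def])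
qed

lemma measurable_rowcor [measurable]: "(\<lambda>\<omega>. rowcor \<omega> A) \<in> borel_measurable Bits"
  unfolding rowcor_def by (rule bdd1_measurable[OF \<Omega>.bdd1_CE])

lemma measurable_rowcor' [measurable]: "(\<lambda>\<omega>. rowcor' \<omega> A) \<in> borel_measurable Bits"
proof -
  have [measurable]: "Measurable.pred Bits (\<lambda>\<omega>. correlation (rowcor \<omega>))"
    unfolding correlation_def genp_def by measurable
  show ?thesis unfolding rowcor'_def by measurable
qed

lemma AE_rowcor': "AE \<omega> in \<Omega>. rowcor' \<omega> = rowcor \<omega>"
proof -
  have "AE \<omega> in \<Omega>. correlation (rowcor \<omega>)"
    by (rule \<Omega>.CE_correlation[where \<iota>="ridx (lab 0)"]) (auto simp: rowcor_def inj_ridx)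
  then show ?thesis by eventually_elim (simp add: rowcor'_def[abs_def])
qed

lemma measurable_Q:
  assumes [measurable]: "\<omega> \<in> M \<rightarrow>\<^sub>M Bits" "u \<in> borel_measurable M"
  shows "(\<lambda>x. Q (\<omega> x) (u x)) \<in> M \<rightarrow>\<^sub>M Bits"
  unfolding Q_def by (rule measurable_bits_of) measurable

lemma measurable_cfg:
  assumes "finite V" and [measurable]: "\<omega> \<in> M \<rightarrow>\<^sub>M Bits" "\<And>i. i \<in> V \<Longrightarrow> (\<lambda>x. \<rho> x i) \<in> M \<rightarrow>\<^sub>M Bits"
  shows "(\<lambda>x. cfg V (\<omega> x) (\<rho> x)) \<in> M \<rightarrow>\<^sub>M Bits"
proof (rule measurable_BitsI)
  fix n
  have \<rho> [measurable]: "Measurable.pred M (\<lambda>x. \<rho> x i m)" if "i \<in> V" for i m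
    using measurable_compose[OF assms(3)[OF that] measurable_Bits_component] .
  have "Measurable.pred M (\<lambda>x. \<exists>i\<in>V. \<exists>m. n = ridx (lab i) m \<and> \<rho> x i m)"
    by (intro pred_intros_finite assms(1) pred_intros_countable pred_intros_logic \<rho>) simp_all
  then show "Measurable.pred M (\<lambda>x. cfg V (\<omega> x) (\<rho> x) n)"
    unfolding cfg_def by measurable
qed

lemma measurable_resample:
  assumes "finite V" "sets M = sets Bits"
  shows "(\<lambda>(\<omega>, u). cfg V \<omega> (\<lambda>i. Q \<omega> (u i))) \<in> M \<Otimes>\<^sub>M (\<Pi>\<^sub>M i\<in>V. unit01) \<rightarrow>\<^sub>M Bits"
  unfolding split_beta'
proof (rule measurable_cfg[OF assms(1)])
  note [measurable_cong] = assms(2)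
  show bg: "fst \<in> M \<Otimes>\<^sub>M (\<Pi>\<^sub>M i\<in>V. unit01) \<rightarrow>\<^sub>M Bits" by measurable
  fix i assume "i \<in> V"
  then show "(\<lambda>a. Q (fst a) (snd a i)) \<in> M \<Otimes>\<^sub>M (\<Pi>\<^sub>M i\<in>V. unit01) \<rightarrow>\<^sub>M Bits"
    by (intro measurable_Q bg) (auto intro!: measurable_compose[OF _ measurable_ident_unit01]
      measurable_compose[OF measurable_snd measurable_component_singleton])
qed

lemma AE_CE_row:
  "AE \<omega> in \<Omega>. \<Omega>.CE (rowset {}) (walsh (ridx (lab i) ` A)) \<omega> = rowcor \<omega> A"
proof -
  obtain \<sigma> where \<sigma>: "inj \<sigma>" "\<And>x. x \<in> {lab 0} \<Longrightarrow> \<sigma> x = lab i" "\<And>x. x \<in> BG \<Longrightarrow> \<sigma> x = x"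
    by (rule ex_relabelling[of "{lab 0}" "\<lambda>_. lab i"]) auto
  interpret relabelled_bit_space \<Omega> "nperm \<sigma>" by (rule relabelled_nperm[OF \<sigma>(1)])
  have eq: "nperm \<sigma> ` rowset {} = rowset {}"
    using nperm_rowset[OF \<sigma>(3), of "{}"] by simp
  have "nperm \<sigma> ` ridx (lab 0) ` A = ridx (lab i) ` A"
    unfolding image_image by (intro image_cong refl nperm_ridx \<sigma>) auto
  then have "walsh (ridx (lab 0) ` A) (relab (nperm \<sigma>) \<omega>) = walsh (ridx (lab i) ` A) \<omega>" for \<omega>
    by (simp add: walsh_relab inj_\<pi>)
  with CE_relab[OF bdd1_walsh, of "rowset {}" "ridx (lab 0) ` A"]
  have "AE \<omega> in \<Omega>. \<Omega>.CE (rowset {}) (walsh (ridx (lab i) ` A)) \<omega>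
      = \<Omega>.CE (rowset {}) (walsh (ridx (lab 0) ` A)) (relab (nperm \<sigma>) \<omega>)"
    by (simp add: eq)
  moreover have "\<Omega>.CE (rowset {}) (walsh (ridx (lab 0) ` A)) (relab (nperm \<sigma>) \<omega>) = rowcor \<omega> A" for \<omega>
    unfolding rowcor_def
    by (rule depends_onD[OF \<Omega>.depends_on_CE]) (use \<sigma>(3) in \<open>simp add: relab_def nperm_background\<close>)
  ultimately show ?thesis by simp
qed

lemma product_prob_unit01: "product_prob_space (\<lambda>_. unit01)"
  by (simp add: product_prob_spaceI)

text \<open>
  Conditionally on the background, the rows of the odd nodes are independent and identically
  distributed, so they can be resampled from independent uniform variables.
\<close>

lemma distr_rows:
  assumes V: "finite V"
  shows "distr \<Omega> Bits (keep (rowset (lab ` V))) =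
    distr (\<Omega> \<Otimes>\<^sub>M (\<Pi>\<^sub>M i\<in>V. unit01)) Bits (\<lambda>(\<omega>, u). cfg V \<omega> (\<lambda>i. Q \<omega> (u i)))"
proof -
  let ?R = "rowset (lab ` V)" and ?U = "\<Pi>\<^sub>M i\<in>V. unit01"
  interpret U: product_prob_space "\<lambda>_. unit01" V by (rule product_prob_unit01)
  interpret UV: prob_space ?U by (rule prob_space_PiM) simp
  interpret P: pair_prob_space \<Omega> ?U ..
  note cm = measurable_resample[OF V \<Omega>.sets_M]
  have core: "(\<integral>\<omega>. walsh K (keep ?R \<omega>) \<partial>\<Omega>) = (\<integral>(\<omega>, u). walsh K (cfg V \<omega> (\<lambda>i. Q \<omega> (u i))) \<partial>(\<Omega> \<Otimes>\<^sub>M ?U))"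
    if K: "finite K" "K \<subseteq> ?R" for K
  proof -
    define K0 where "K0 = K \<inter> rowset {}"
    define A where "A i = ridx (lab i) -` K" for i
    have finA: "finite (A i)" for i
      unfolding A_def by (rule finite_vimageI[OF K(1) inj_ridx])
    have K_eq: "K = K0 \<union> (\<Union>i\<in>V. ridx (lab i) ` A i)"
      using K(2) by (auto simp: K0_def A_def elim!: rowset_cases dest: subsetD)
    have walsh_K: "walsh K x = walsh K0 x * (\<Prod>i\<in>V. walsh (ridx (lab i) ` A i) x)" for x
    proof -
      have "walsh K x = walsh K0 x * walsh (\<Union>i\<in>V. ridx (lab i) ` A i) x"
        unfolding K_eq using K(1) V finA by (intro walsh_Un) (auto simp: K0_def)
      also have "walsh (\<Union>i\<in>V. ridx (lab i) ` A i) x = (\<Prod>i\<in>V. walsh (ridx (lab i) ` A i) x)"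
        unfolding walsh_def by (rule prod.UNION_disjoint) (use V finA in auto)
      finally show ?thesis .
    qed
    have "(\<integral>\<omega>. walsh K (keep ?R \<omega>) \<partial>\<Omega>) = (\<integral>\<omega>. walsh K0 \<omega> * (\<Prod>i\<in>V. walsh (ridx (lab i) ` A i) \<omega>) \<partial>\<Omega>)"
      unfolding depends_on_keep[OF depends_on_walsh[OF K(2)]] by (simp only: walsh_K)
    also have "\<dots> = (\<integral>\<omega>. walsh K0 \<omega> * (\<Prod>i\<in>V. \<Omega>.CE (rowset {}) (walsh (ridx (lab i) ` A i)) \<omega>) \<partial>\<Omega>)"
    proof (rule \<Omega>.integral_replace_all[where R="\<lambda>i. rowset (lab ` (V - {i}))"])
      fix i j assume "i \<in> V" "j \<in> V" "i \<noteq> j"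
      then show "depends_on (rowset (lab ` (V - {i}))) (walsh (ridx (lab j) ` A j))"
        by (intro depends_on_walsh) auto
      show "depends_on (rowset (lab ` (V - {i}))) (\<Omega>.CE (rowset {}) (walsh (ridx (lab j) ` A j)))"
        by (rule depends_on_mono[OF \<Omega>.depends_on_CE rowset_mono]) simp
    next
      fix i H assume i: "i \<in> V" and H: "bdd1 H" "depends_on (rowset (lab ` (V - {i}))) H"
      show "(\<integral>\<omega>. H \<omega> * walsh (ridx (lab i) ` A i) \<omega> \<partial>\<Omega>) =
          (\<integral>\<omega>. H \<omega> * \<Omega>.CE (rowset {}) (walsh (ridx (lab i) ` A i)) \<omega> \<partial>\<Omega>)"
        by (rule replace_row[OF _ _ _ _ _ _ H, of "lab i"]) (use V finA in auto)
    next
      show "depends_on (rowset (lab ` (V - {i}))) (walsh K0)" for i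
        using rowset_mono[of "{}" "lab ` (V - {i})"] by (intro depends_on_walsh) (auto simp: K0_def)
    qed (auto intro: V bdd1_walsh \<Omega>.bdd1_CE)
    also have "\<dots> = (\<integral>\<omega>. walsh K0 \<omega> * (\<Prod>i\<in>V. rowcor' \<omega> (A i)) \<partial>\<Omega>)"
    proof (rule integral_cong_AE)
      have "AE \<omega> in \<Omega>. \<forall>i\<in>V. \<Omega>.CE (rowset {}) (walsh (ridx (lab i) ` A i)) \<omega> = rowcor \<omega> (A i)"
        by (intro AE_finite_allI V AE_CE_row)
      with AE_rowcor' show "AE \<omega> in \<Omega>. walsh K0 \<omega> * (\<Prod>i\<in>V. \<Omega>.CE (rowset {}) (walsh (ridx (lab i) ` A i)) \<omega>) =
          walsh K0 \<omega> * (\<Prod>i\<in>V. rowcor' \<omega> (A i))"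
        by eventually_elim (simp cong: prod.cong)
    qed (auto intro!: \<Omega>.bdd1_measurable_M bdd1_mult bdd1_prod bdd1_walsh \<Omega>.bdd1_CE)
    also have "\<dots> = (\<integral>\<omega>. (\<integral>u. walsh K (cfg V \<omega> (\<lambda>i. Q \<omega> (u i))) \<partial>?U) \<partial>\<Omega>)"
    proof (rule Bochner_Integration.integral_cong[OF refl])
      fix \<omega>
      have "walsh K (cfg V \<omega> (\<lambda>i. Q \<omega> (u i))) = walsh K0 \<omega> * (\<Prod>i\<in>V. walsh (A i) (Q \<omega> (u i)))" for u
      proof -
        have "walsh K0 (cfg V \<omega> (\<lambda>i. Q \<omega> (u i))) = walsh K0 \<omega>"
          unfolding walsh_def by (intro prod.cong) (auto simp: K0_def)
        moreover have "walsh (ridx (lab i) ` A i) (cfg V \<omega> (\<lambda>i. Q \<omega> (u i))) = walsh (A i) (Q \<omega> (u i))"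
          if "i \<in> V" for i
          using that by (simp add: walsh_def prod.reindex inj_on_subset[OF inj_ridx])
        ultimately show ?thesis by (simp add: walsh_K)
      qed
      moreover have "(\<integral>u. (\<Prod>i\<in>V. walsh (A i) (Q \<omega> (u i))) \<partial>?U) = (\<Prod>i\<in>V. rowcor' \<omega> (A i))"
      proof -
        have "finite_measure unit01" using prob_space_unit01 by (simp add: prob_space_def)
        then have "integrable unit01 (\<lambda>v. walsh (A i) (Q \<omega> v))" for i
          by (rule finite_measure.integrable_const_bound[where B=1])
             (auto simp: Q_def intro!: measurable_compose[OF measurable_bits_of' measurable_walsh])
        then show ?thesis
          by (subst U.product_integral_prod)
             (auto simp: V Q_def integral_walsh_bits_of[OF correlation_rowcor' finA])
      qed
      ultimately show "walsh K0 \<omega> * (\<Prod>i\<in>V. rowcor' \<omega> (A i)) = (\<integral>u. walsh K (cfg V \<omega> (\<lambda>i. Q \<omega> (u i))) \<partial>?U)"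
        by simp
    qed
    also have "\<dots> = (\<integral>(\<omega>, u). walsh K (cfg V \<omega> (\<lambda>i. Q \<omega> (u i))) \<partial>(\<Omega> \<Otimes>\<^sub>M ?U))"
      by (subst P.integral_fst[symmetric])
         (use measurable_compose[OF cm measurable_walsh] in
           \<open>auto intro!: P.P.integrable_const_bound[where B=1] simp: split_beta'\<close>)
    finally show ?thesis .
  qed
  show ?thesis
  proof (rule distr_Bits_eqI)
    fix K :: "nat set" assume K: "finite K"
    \<comment> \<open>Outside \<open>?R\<close> both configurations are \<open>False\<close>, so
      each such index contributes the constant sign -1.\<close>
    have outside: "walsh K x = walsh (K \<inter> ?R) x * (-1) ^ card (K - ?R)" if "\<And>n. n \<notin> ?R \<Longrightarrow> \<not> x n" for x
    proof -
      have "walsh K x = walsh (K \<inter> ?R) x * walsh (K - ?R) x"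
        using K walsh_Un[of "K \<inter> ?R" "K - ?R"] by (simp add: Int_Diff_Un) blast
      moreover have "walsh (K - ?R) x = (\<Prod>n\<in>K - ?R. -1)"
        unfolding walsh_def by (intro prod.cong) (auto simp: that)
      ultimately show ?thesis by simp
    qed
    have "(\<integral>\<omega>. walsh K (keep ?R \<omega>) \<partial>\<Omega>) = (\<integral>\<omega>. walsh (K \<inter> ?R) (keep ?R \<omega>) \<partial>\<Omega>) * (-1) ^ card (K - ?R)"
      by (subst outside) (auto simp: keep_def)
    also have "\<dots> = (\<integral>(\<omega>, u). walsh (K \<inter> ?R) (cfg V \<omega> (\<lambda>i. Q \<omega> (u i))) \<partial>(\<Omega> \<Otimes>\<^sub>M ?U)) * (-1) ^ card (K - ?R)"
      using K by (subst core) auto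
    also have "\<dots> = (\<integral>(\<omega>, u). walsh K (cfg V \<omega> (\<lambda>i. Q \<omega> (u i))) \<partial>(\<Omega> \<Otimes>\<^sub>M ?U))"
      unfolding split_beta' integral_mult_left_zero[symmetric]
      by (intro Bochner_Integration.integral_cong refl outside[symmetric]) (auto simp: cfg_outside)
    finally show "(\<integral>\<omega>. walsh K (keep ?R \<omega>) \<partial>\<Omega>) =
      (\<integral>x. walsh K (case x of (\<omega>, u) \<Rightarrow> cfg V \<omega> (\<lambda>i. Q \<omega> (u i))) \<partial>(\<Omega> \<Otimes>\<^sub>M ?U))"
      by (simp add: split_beta')
  next
    show "(\<lambda>(\<omega>, u). cfg V \<omega> (\<lambda>i. Q \<omega> (u i))) \<in> \<Omega> \<Otimes>\<^sub>M ?U \<rightarrow>\<^sub>M Bits"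
      by (rule cm)
  qed (auto simp: \<Omega>.measurable_M intro: \<Omega>.prob_space_axioms P.P.prob_space_axioms)
qed

end

section \<open>Homomorphism densities of Borel kernels\<close>

definition prs :: "nat set \<Rightarrow> (nat \<times> nat) set" where
  "prs V = {(i, j). i \<in> V \<and> j \<in> V \<and> i < j}"

abbreviation cube :: "nat set \<Rightarrow> (nat \<Rightarrow> real) measure" where
  "cube V \<equiv> \<Pi>\<^sub>M i\<in>V. unit01"

text \<open>\<open>m k\<close> is to be the k-th moment. That \<open>m 0\<close> is 1 everywhere
  makes non-adjacent pairs contribute the factor 1.\<close>

definition kernel :: "(nat \<Rightarrow> real \<Rightarrow> real \<Rightarrow> real) \<Rightarrow> (nat \<Rightarrow> real) \<Rightarrow> bool" where
  "kernel m c \<longleftrightarrow> (\<forall>k. (\<lambda>(x, y). m k x y) \<in> borel_measurable (unit01 \<Otimes>\<^sub>M unit01)) \<and>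
     (\<forall>k x y. \<bar>m k x y\<bar> \<le> c k) \<and> (\<forall>x y. m 0 x y = 1)"

text \<open>The counterpart of \<open>hom_density\<close> for Borel moment functions; without a
  completion, Fubini's theorem applies directly.\<close>

definition tden :: "multigraph \<Rightarrow> (nat \<Rightarrow> real \<Rightarrow> real \<Rightarrow> real) \<Rightarrow> real" where
  "tden F m = (\<integral>u. (\<Prod>(i, j)\<in>prs (nodes F). m (edge_mult F i j) (u i) (u j)) \<partial>cube (nodes F))"

lemma finite_prs [simp]: "finite V \<Longrightarrow> finite (prs V)"
  by (rule finite_subset[of _ "V \<times> V"]) (auto simp: prs_def)

lemma prs_subset: "p \<in> prs V \<Longrightarrow> fst p \<in> V \<and> snd p \<in> V \<and> fst p \<noteq> snd p"
  by (auto simp: prs_def)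

interpretation U: product_prob_space "\<lambda>_. unit01" I for I
  by (simp add: product_prob_spaceI)

lemma prob_space_cube [intro, simp]: "prob_space (cube V)"
  by (rule prob_space_PiM) simp

lemma measurable_kernel_pair:
  assumes "kernel m c" "i \<in> V" "j \<in> V"
  shows "(\<lambda>u. m k (u i) (u j)) \<in> borel_measurable (cube V)"
proof -
  have "(\<lambda>u. (u i, u j)) \<in> cube V \<rightarrow>\<^sub>M unit01 \<Otimes>\<^sub>M unit01"
    using assms(2,3) by measurable
  moreover have "(\<lambda>(x, y). m k x y) \<in> borel_measurable (unit01 \<Otimes>\<^sub>M unit01)"
    using assms(1) by (simp add: kernel_def)
  ultimately show ?thesis
    using measurable_compose[of _ _ _ "\<lambda>(x, y). m k x y"] by fastforce
qed

lemma measurable_kernel_prod: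
  assumes "kernel m c"
  shows "(\<lambda>u. \<Prod>(i, j)\<in>prs V. m (e i j) (u i) (u j)) \<in> borel_measurable (cube V)"
  unfolding split_beta'
  by (intro borel_measurable_prod measurable_kernel_pair[OF assms]) (auto dest: prs_subset)

lemma kernel_prod_bound:
  assumes "kernel m c"
  shows "\<bar>\<Prod>(i, j)\<in>P. m (e i j) (u i) (u j)\<bar> \<le> (\<Prod>(i, j)\<in>P. c (e i j))"
proof -
  have "\<bar>m k x y\<bar> \<le> c k" for k x y using assms by (simp add: kernel_def)
  then show ?thesis unfolding abs_prod split_beta' by (intro prod_mono) auto
qed

lemma integrable_kernel_prod:
  assumes "kernel m c"
  shows "integrable (cube V) (\<lambda>u. \<Prod>(i, j)\<in>prs V. m (e i j) (u i) (u j))"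
proof -
  interpret C: prob_space "cube V" by simp
  have "finite_measure (cube V)" by unfold_locales
  then show ?thesis
    by (rule finite_measure.integrable_const_bound)
       (use kernel_prod_bound[OF assms] measurable_kernel_prod[OF assms] in auto)
qed

lemma integral_cube_reindex:
  fixes g :: "(nat \<Rightarrow> real) \<Rightarrow> real"
  assumes "inj_on \<phi> V" and [measurable]: "g \<in> borel_measurable (cube V)"
  shows "(\<integral>u. g u \<partial>cube V) = (\<integral>u. g (\<lambda>i\<in>V. u (\<phi> i)) \<partial>cube (\<phi> ` V))"
proof -
  have "(\<integral>u. g u \<partial>cube V) = (\<integral>u. g u \<partial>distr (cube (\<phi> ` V)) (cube V) (\<lambda>u. \<lambda>i\<in>V. u (\<phi> i)))"
    by (subst distr_PiM_reindex) (use assms in auto)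
  also have "\<dots> = (\<integral>u. g (\<lambda>i\<in>V. u (\<phi> i)) \<partial>cube (\<phi> ` V))"
    by (rule integral_distr) (measurable; simp)+
  finally show ?thesis .
qed

text \<open>A strictly increasing map preserves the order i < j by which \<open>prs\<close> selects
  pairs, so the arguments of \<open>m\<close>, which \<open>kernel\<close> does not assume
  symmetric, are never swapped.\<close>

lemma tden_reindex:
  assumes "kernel m c" "strict_mono \<phi>" "\<And>i j. e (\<phi> i) (\<phi> j) = edge_mult F i j"
  shows "tden F m = (\<integral>u. (\<Prod>(i, j)\<in>prs (\<phi> ` nodes F). m (e i j) (u i) (u j)) \<partial>cube (\<phi> ` nodes F))"
proof -
  have inj: "inj \<phi>" using assms(2) by (rule strict_mono_imp_inj_on)
  have prs: "prs (\<phi> ` nodes F) = (\<lambda>(i, j). (\<phi> i, \<phi> j)) ` prs (nodes F)"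
    using assms(2) by (auto simp: prs_def strict_mono_less image_iff)
  have "tden F m = (\<integral>u. (\<Prod>(i, j)\<in>prs (nodes F). m (edge_mult F i j) ((\<lambda>i\<in>nodes F. u (\<phi> i)) i) ((\<lambda>i\<in>nodes F. u (\<phi> i)) j))
      \<partial>cube (\<phi> ` nodes F))"
    unfolding tden_def
    by (rule integral_cube_reindex) (auto intro: inj_on_subset[OF inj] measurable_kernel_prod[OF assms(1)])
  also have "\<dots> = (\<integral>u. (\<Prod>(i, j)\<in>prs (\<phi> ` nodes F). m (e i j) (u i) (u j)) \<partial>cube (\<phi> ` nodes F))"
  proof (rule Bochner_Integration.integral_cong[OF refl])
    fix u
    have "inj_on (\<lambda>(i, j). (\<phi> i, \<phi> j)) (prs (nodes F))"
      using inj by (auto simp: inj_on_def)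
    then show "(\<Prod>(i, j)\<in>prs (nodes F). m (edge_mult F i j) ((\<lambda>i\<in>nodes F. u (\<phi> i)) i) ((\<lambda>i\<in>nodes F. u (\<phi> i)) j)) =
        (\<Prod>(i, j)\<in>prs (\<phi> ` nodes F). m (e i j) (u i) (u j))"
      unfolding prs by (subst prod.reindex) (auto intro!: prod.cong simp: assms(3) dest!: prs_subset)
  qed
  finally show ?thesis .
qed

lemma tden_disjoint_union:
  assumes "kernel m c"
  shows "tden (disjoint_union F G) m = tden F m * tden G m"
proof -
  let ?V = "(\<lambda>i. 2 * i) ` nodes F" and ?W = "(\<lambda>i. Suc (2 * i)) ` nodes G"
  let ?e = "edge_mult (disjoint_union F G)"
  let ?h = "\<lambda>P u. \<Prod>(i, j)\<in>P. m (?e i j) (u i) (u j)"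
  have disj: "?V \<inter> ?W = {}" by auto presburger
  have m0: "m 0 x y = 1" for x y using assms by (simp add: kernel_def)
  have h: "?h (prs (?V \<union> ?W)) u = ?h (prs ?V) u * ?h (prs ?W) u" for u
  proof -
    \<comment> \<open>Pairs between the two parts carry no edge and contribute
      \<open>m 0 = 1\<close>.\<close>
    have "?h (prs (?V \<union> ?W)) u = ?h (prs ?V \<union> prs ?W) u"
    proof (rule prod.mono_neutral_right)
      show "finite (prs (?V \<union> ?W))" by (rule finite_prs) simp
    qed (auto simp: prs_def m0)
    also have "\<dots> = ?h (prs ?V) u * ?h (prs ?W) u"
      using disj by (intro prod.union_disjoint finite_prs) (auto simp: prs_def)
    finally show ?thesis .
  qed
  have merge: "?h (prs ?V) (merge ?V ?W (x, y)) = ?h (prs ?V) x" "?h (prs ?W) (merge ?V ?W (x, y)) = ?h (prs ?W) y" for x y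
    using disj by (auto intro!: prod.cong simp: merge_def Suc_double_not_eq_double dest!: prs_subset)
  have "tden (disjoint_union F G) m = (\<integral>u. ?h (prs (?V \<union> ?W)) u \<partial>cube (?V \<union> ?W))"
    by (simp only: tden_def nodes_disjoint_union)
  also have "\<dots> = (\<integral>x. (\<integral>y. ?h (prs (?V \<union> ?W)) (merge ?V ?W (x, y)) \<partial>cube ?W) \<partial>cube ?V)"
    by (rule U.product_integral_fold[OF disj]) (auto intro: integrable_kernel_prod[OF assms])
  also have "\<dots> = (\<integral>x. ?h (prs ?V) x \<partial>cube ?V) * (\<integral>y. ?h (prs ?W) y \<partial>cube ?W)"
    unfolding h merge by simp
  also have "(\<integral>x. ?h (prs ?V) x \<partial>cube ?V) = tden F m"
    by (rule tden_reindex[OF assms, symmetric]) (auto simp: strict_mono_def)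
  also have "(\<integral>x. ?h (prs ?W) x \<partial>cube ?W) = tden G m"
    by (rule tden_reindex[OF assms, symmetric]) (auto simp: strict_mono_def)
  finally show ?thesis .
qed

section \<open>Passage from Lebesgue to Borel representatives\<close>

lemma distr_cube_pair:
  assumes "finite V" "i \<in> V" "j \<in> V" "i \<noteq> j"
  shows "distr (cube V) (unit01 \<Otimes>\<^sub>M unit01) (\<lambda>u. (u i, u j)) = unit01 \<Otimes>\<^sub>M unit01"
proof (rule pair_measure_eqI[symmetric])
  have sf: "sigma_finite_measure unit01"
    by (rule prob_space_imp_sigma_finite) simp
  then show "sigma_finite_measure unit01" "sigma_finite_measure unit01" by simp_all
  fix A B assume AB: "A \<in> sets unit01" "B \<in> sets unit01"
  have [measurable]: "(\<lambda>u. (u i, u j)) \<in> cube V \<rightarrow>\<^sub>M unit01 \<Otimes>\<^sub>M unit01"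
    using assms by measurable
  have "emeasure (distr (cube V) (unit01 \<Otimes>\<^sub>M unit01) (\<lambda>u. (u i, u j))) (A \<times> B) =
      emeasure (cube V) ((\<lambda>u. (u i, u j)) -` (A \<times> B) \<inter> space (cube V))"
    using AB by (intro emeasure_distr) auto
  also have "(\<lambda>u. (u i, u j)) -` (A \<times> B) \<inter> space (cube V) =
      {u \<in> space (cube V). \<forall>k\<in>{i, j}. u k \<in> (if k = i then A else B)}"
    using assms(4) by auto
  also have "emeasure (cube V) \<dots> = (\<Prod>k\<in>{i, j}. emeasure unit01 (if k = i then A else B))"
    using AB assms by (intro U.emeasure_PiM_Collect) auto
  also have "\<dots> = emeasure unit01 A * emeasure unit01 B" using assms(4) by simp
  finally show "emeasure unit01 A * emeasure unit01 B =
      emeasure (distr (cube V) (unit01 \<Otimes>\<^sub>M unit01) (\<lambda>u. (u i, u j))) (A \<times> B)" ..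
qed simp

lemma AE_cube_pair:
  assumes "finite V" "i \<in> V" "j \<in> V" "i \<noteq> j" "AE p in unit01 \<Otimes>\<^sub>M unit01. P (fst p) (snd p)"
  shows "AE u in cube V. P (u i) (u j)"
proof -
  have "(\<lambda>u. (u i, u j)) \<in> cube V \<rightarrow>\<^sub>M unit01 \<Otimes>\<^sub>M unit01"
    using assms by measurable
  then have "AE u in cube V. P (fst (u i, u j)) (snd (u i, u j))"
    by (rule AE_distrD) (simp only: distr_cube_pair[OF assms(1-4)] assms(5))
  then show ?thesis by simp
qed

lemma AE_cube_prs:
  assumes "finite V" "AE p in unit01 \<Otimes>\<^sub>M unit01. P (fst p) (snd p)"
  shows "AE u in cube V. \<forall>(i, j)\<in>prs V. P (u i) (u j)"
proof -
  have "AE u in cube V. \<forall>p\<in>prs V. P (u (fst p)) (u (snd p))"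
    using assms(1) by (intro AE_finite_allI) (auto intro!: AE_cube_pair assms dest: prs_subset)
  then show ?thesis by (simp add: case_prod_beta')
qed

lemma unit_cube_eq: "unit_cube V = completion (cube V)"
  by (simp add: unit_cube_def unit01_def)

lemma borel_measurable_completion_AE:
  fixes f g :: "'a \<Rightarrow> real"
  assumes "g \<in> borel_measurable M" "AE x in M. g x = f x"
  shows "f \<in> borel_measurable (completion M)"
proof (rule borel_measurableI)
  fix S :: "real set" assume "open S"
  have 1: "Measurable.pred (completion M) (\<lambda>x. f x \<in> S \<and> f x \<noteq> g x)"
    by (rule sets_completion_AE) (use assms(2) in \<open>auto elim: eventually_mono\<close>)
  have 2: "Measurable.pred (completion M) (\<lambda>x. f x \<noteq> g x)"
    by (rule sets_completion_AE) (use assms(2) in \<open>auto elim: eventually_mono\<close>)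
  have [measurable]: "g \<in> borel_measurable (completion M)"
    by (rule measurable_completion[OF assms(1)])
  have [measurable]: "S \<in> sets borel" using \<open>open S\<close> by simp
  have "Measurable.pred (completion M) (\<lambda>x. (f x \<in> S \<and> f x \<noteq> g x) \<or> (g x \<in> S \<and> \<not> f x \<noteq> g x))"
    using 1 2 by measurable
  also have "(\<lambda>x. (f x \<in> S \<and> f x \<noteq> g x) \<or> (g x \<in> S \<and> \<not> f x \<noteq> g x)) = (\<lambda>x. f x \<in> S)" by auto
  finally show "f -` S \<inter> space (completion M) \<in> sets (completion M)"
    by (simp add: pred_def vimage_def Int_def conj_commute)
qed

text \<open>Only pairs of distinct coordinates enter, and their joint law is uniform on the square,
  so a planar null set stays null in the cube. The completion absorbs the integrand's lack of
  product measurability.\<close>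

lemma hom_density_eq_tden:
  assumes "kernel m c" "AE p in unit01 \<Otimes>\<^sub>M unit01. \<forall>k. moment W k (fst p) (snd p) = m k (fst p) (snd p)"
  shows "hom_density F W = tden F m"
proof -
  let ?V = "nodes F"
  let ?f = "\<lambda>u. \<Prod>(i, j)\<in>prs ?V. moment W (edge_mult F i j) (u i) (u j)"
  let ?g = "\<lambda>u. \<Prod>(i, j)\<in>prs ?V. m (edge_mult F i j) (u i) (u j)"
  have "AE u in cube ?V. \<forall>(i, j)\<in>prs ?V. \<forall>k. moment W k (u i) (u j) = m k (u i) (u j)"
    by (rule AE_cube_prs) (use assms(2) in auto)
  then have AE: "AE u in cube ?V. ?g u = ?f u"
    by eventually_elim (auto intro!: prod.cong)
  have g: "?g \<in> borel_measurable (cube ?V)" by (rule measurable_kernel_prod[OF assms(1)])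
  have g': "?g \<in> borel_measurable (completion (cube ?V))" by (rule measurable_completion[OF g])
  have f': "?f \<in> borel_measurable (completion (cube ?V))"
    using g AE by (rule borel_measurable_completion_AE)
  have "hom_density F W = (\<integral>u. ?f u \<partial>completion (cube ?V))"
    by (simp add: hom_density_def unit_cube_eq prs_def)
  also have "\<dots> = (\<integral>u. ?g u \<partial>completion (cube ?V))"
    by (intro integral_cong_AE f' g' AE_completion) (use AE in \<open>auto elim: eventually_mono\<close>)
  also have "\<dots> = tden F m" by (simp add: tden_def integral_completion[OF g])
  finally show ?thesis .
qed

section \<open>Densities of a graphon\<close>

lemma borel_prob_measuresD:
  assumes "\<mu> \<in> borel_prob_measures d"
  shows "prob_space \<mu>" "space \<mu> = {-d..d}" "sets \<mu> = sets (restrict_space borel {-d..d})"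
proof -
  show 1: "prob_space \<mu>" "sets \<mu> = sets (restrict_space borel {-d..d})"
    using assms by (auto simp: borel_prob_measures_def)
  show "space \<mu> = {-d..d}"
    using sets_eq_imp_space_eq[OF 1(2)] by (simp add: space_restrict_space)
qed

lemma measurable_borel_prob_measures:
  assumes "\<mu> \<in> borel_prob_measures d" "g \<in> borel_measurable (restrict_space borel {-d..d})"
  shows "g \<in> borel_measurable \<mu>"
  using assms(2) measurable_cong_sets[OF borel_prob_measuresD(3)[OF assms(1)] refl] by blast

lemma integrable_borel_prob_measures:
  fixes g :: "real \<Rightarrow> real"
  assumes "\<mu> \<in> borel_prob_measures d" "g \<in> borel_measurable (restrict_space borel {-d..d})"
    "\<And>s. s \<in> {-d..d} \<Longrightarrow> \<bar>g s\<bar> \<le> B"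
  shows "integrable \<mu> g" "\<bar>\<integral>s. g s \<partial>\<mu>\<bar> \<le> B"
proof -
  interpret prob_space \<mu> by (rule borel_prob_measuresD[OF assms(1)])
  have AE: "AE s in \<mu>. \<bar>g s\<bar> \<le> B"
    using assms(3) borel_prob_measuresD(2)[OF assms(1)] by (intro AE_I2) auto
  show int: "integrable \<mu> g"
    using AE measurable_borel_prob_measures[OF assms(1,2)] by (intro integrable_const_bound[of _ B]) auto
  have "\<bar>\<integral>s. g s \<partial>\<mu>\<bar> \<le> (\<integral>s. \<bar>g s\<bar> \<partial>\<mu>)" by (rule integral_abs_bound)
  also have "\<dots> \<le> B" using int AE by (intro integral_le_const) auto
  finally show "\<bar>\<integral>s. g s \<partial>\<mu>\<bar> \<le> B" .
qed

lemma measurable_power_restrict [simp]: "(\<lambda>s::real. s ^ k) \<in> borel_measurable (restrict_space borel S)"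
  by (rule measurable_restrict_space1) simp

lemma abs_power_le:
  fixes s d :: real
  assumes "s \<in> {-d..d}"
  shows "\<bar>s ^ k\<bar> \<le> d ^ k"
  unfolding power_abs using assms by (intro power_mono) auto

lemma topspace_weak_topology:
  assumes "U \<in> {U. openin (weak_topology d) U}"
  shows "U \<subseteq> borel_prob_measures d"
proof -
  have "topspace (weak_topology d) \<subseteq> borel_prob_measures d"
    unfolding weak_topology_def topology_generated_by_topspace by auto
  with assms show ?thesis using openin_subset by blast
qed

lemma space_weak_borel [simp]: "space (weak_borel d) = borel_prob_measures d"
  unfolding weak_borel_def by (rule space_measure_of) (use topspace_weak_topology in blast)

lemma sets_weak_borel: "sets (weak_borel d) = sigma_sets (borel_prob_measures d) {U. openin (weak_topology d) U}"
  unfolding weak_borel_def by (rule sets_measure_of) (use topspace_weak_topology in blast)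

lemma measurable_integral_weak_borel:
  fixes g :: "real \<Rightarrow> real"
  assumes "continuous_on {-d..d} g"
  shows "(\<lambda>\<mu>. \<integral>s. g s \<partial>\<mu>) \<in> borel_measurable (weak_borel d)"
proof (rule borel_measurableI)
  fix S :: "real set" assume "open S"
  then have "openin (weak_topology d) {\<mu> \<in> borel_prob_measures d. (\<integral>s. g s \<partial>\<mu>) \<in> S}"
    unfolding weak_topology_def openin_topology_generated_by_iff
    using assms by (intro generate_topology_on.Basis) blast
  then have "{\<mu> \<in> borel_prob_measures d. (\<integral>s. g s \<partial>\<mu>) \<in> S} \<in> sets (weak_borel d)"
    unfolding sets_weak_borel by (intro sigma_sets.Basic) simp
  then show "(\<lambda>\<mu>. \<integral>s. g s \<partial>\<mu>) -` S \<inter> space (weak_borel d) \<in> sets (weak_borel d)"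
    by (simp add: vimage_def Int_def conj_commute)
qed

lemma AE_lborel_unit01_pair:
  assumes "AE p in lborel. P (fst p) (snd p)"
  shows "AE p in unit01 \<Otimes>\<^sub>M unit01. P (fst p) (snd p)"
proof -
  obtain N where N: "{p \<in> space lborel. \<not> P (fst p) (snd p)} \<subseteq> N" "emeasure lborel N = 0" "N \<in> sets lborel"
    using AE_E[OF assms] by blast
  interpret pair_sigma_finite unit01 unit01
    by (intro pair_sigma_finite.intro prob_space_imp_sigma_finite) simp_all
  have N': "N \<in> sets (lborel \<Otimes>\<^sub>M lborel)" using N(3) by (simp only: lborel_prod)
  have ident: "(\<lambda>p. p) \<in> unit01 \<Otimes>\<^sub>M unit01 \<rightarrow>\<^sub>M lborel \<Otimes>\<^sub>M (lborel :: real measure)"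
  proof -
    have [measurable]: "(\<lambda>u. u) \<in> unit01 \<rightarrow>\<^sub>M lborel" using measurable_ident_unit01 by simp
    have "(\<lambda>p. (fst p, snd p)) \<in> unit01 \<Otimes>\<^sub>M unit01 \<rightarrow>\<^sub>M lborel \<Otimes>\<^sub>M (lborel :: real measure)"
      by measurable
    then show ?thesis by simp
  qed
  have "AE p in lborel. p \<notin> N" using N(2,3) by (intro AE_not_in) (auto simp: null_sets_def)
  then have "AE p in lborel \<Otimes>\<^sub>M lborel. p \<notin> N" by (simp only: lborel_prod)
  then have "AE x in lborel. AE y in lborel. (x, y) \<notin> N"
    by (rule lborel_pair.AE_pair)
  then have "AE x in unit01. AE y in unit01. (x, y) \<notin> N"
    unfolding unit01_def by (subst AE_restrict_space_iff, simp, elim eventually_mono)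
      (subst AE_restrict_space_iff, simp, auto elim: eventually_mono)
  moreover have "{p \<in> space (unit01 \<Otimes>\<^sub>M unit01). p \<notin> N} \<in> sets (unit01 \<Otimes>\<^sub>M unit01)"
  proof -
    have "space (unit01 \<Otimes>\<^sub>M unit01) - (\<lambda>p. p) -` N \<inter> space (unit01 \<Otimes>\<^sub>M unit01) \<in> sets (unit01 \<Otimes>\<^sub>M unit01)"
      by (intro sets.compl_sets measurable_sets[OF ident N'])
    then show ?thesis by (rule back_subst[of "\<lambda>X. X \<in> sets (unit01 \<Otimes>\<^sub>M unit01)"]) auto
  qed
  ultimately have "AE p in unit01 \<Otimes>\<^sub>M unit01. p \<notin> N"
    by (intro AE_pair_measure)
  then show ?thesis by eventually_elim (use N(1) in auto)
qed

lemma clamp: "\<bar>a\<bar> \<le> b \<Longrightarrow> max (- b) (min b a) = (a :: real)"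
  by linarith

text \<open>Each moment is a bounded Lebesgue measurable function and has a Borel version; countably
  many null sets are discarded for all k at once.\<close>

lemma graphon_kernel:
  assumes "graphon d W" "d > 0"
  obtains m where "kernel m (\<lambda>k. d ^ k)"
    "AE p in unit01 \<Otimes>\<^sub>M unit01. \<forall>k. moment W k (fst p) (snd p) = m k (fst p) (snd p)"
proof -
  let ?S = "{0..1} \<times> {0..1} :: (real \<times> real) set"
  have W: "(\<lambda>(x, y). W x y) \<in> lebesgue_on ?S \<rightarrow>\<^sub>M weak_borel d"
    using assms(1) by (simp add: graphon_def)
  have mem: "W x y \<in> borel_prob_measures d" if "x \<in> {0..1}" "y \<in> {0..1}" for x y
    using measurable_space[OF W, of "(x, y)"] that by (simp add: space_restrict_space)
  have S: "?S \<in> sets lebesgue"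
    by (intro sets_completionI_sets) (simp add: lborel_prod[symmetric] pair_measureI)
  have "\<exists>g\<in>borel_measurable (lborel :: (real \<times> real) measure). AE p in lborel. indicator ?S p * moment W k (fst p) (snd p) = g p" for k
  proof (rule completion_ex_borel_measurable_real)
    have "(\<lambda>p. moment W k (fst p) (snd p)) \<in> borel_measurable (lebesgue_on ?S)"
      using measurable_compose[OF W measurable_integral_weak_borel[of d "\<lambda>s. s ^ k"]]
      by (simp add: moment_def split_beta' continuous_on_power)
    then show "(\<lambda>p. indicator ?S p * moment W k (fst p) (snd p)) \<in> borel_measurable lebesgue"
      using borel_measurable_restrict_space_iff[of ?S lebesgue "\<lambda>p. moment W k (fst p) (snd p)"] S by simp
  qed
  then have "\<forall>k. \<exists>g. g \<in> borel_measurable (lborel :: (real \<times> real) measure) \<and>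
      (AE p in lborel. indicator ?S p * moment W k (fst p) (snd p) = g p)" by blast
  from choice[OF this] obtain g where g': "\<forall>k. g k \<in> borel_measurable (lborel :: (real \<times> real) measure) \<and>
      (AE p in lborel. indicator ?S p * moment W k (fst p) (snd p) = g k p)" ..
  then have g: "g k \<in> borel_measurable (lborel :: (real \<times> real) measure)"
    "AE p in lborel. indicator ?S p * moment W k (fst p) (snd p) = g k p" for k by simp_all
  \<comment> \<open>\<open>kernel\<close> demands its bounds at every point, but \<open>g k\<close>
    is uncontrolled on a null set; hence the clamping and the forced value at k = 0.\<close>
  define m where "m k x y = (if k = 0 then 1 else max (- (d ^ k)) (min (d ^ k) (g k (x, y))))" for k x y
  have [measurable]: "(\<lambda>p. g k p) \<in> borel_measurable (unit01 \<Otimes>\<^sub>M unit01)" for k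
  proof -
    have "(\<lambda>p. (fst p, snd p)) \<in> unit01 \<Otimes>\<^sub>M unit01 \<rightarrow>\<^sub>M borel \<Otimes>\<^sub>M (borel :: real measure)"
      by measurable
    then have "(\<lambda>p. p) \<in> unit01 \<Otimes>\<^sub>M unit01 \<rightarrow>\<^sub>M (borel :: (real \<times> real) measure)"
      by (simp add: borel_prod)
    from measurable_compose[OF this] g(1)[of k] show ?thesis by simp
  qed
  have "kernel m (\<lambda>k. d ^ k)"
    unfolding kernel_def
  proof (intro conjI allI)
    show "(\<lambda>(x, y). m k x y) \<in> borel_measurable (unit01 \<Otimes>\<^sub>M unit01)" for k
      unfolding m_def split_beta' prod.collapse by measurable
    show "\<bar>m k x y\<bar> \<le> d ^ k" for k x y
      using assms(2) by (auto simp: m_def abs_le_iff)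
  qed (simp add: m_def)
  moreover have "AE p in unit01 \<Otimes>\<^sub>M unit01. \<forall>k. moment W k (fst p) (snd p) = m k (fst p) (snd p)"
  proof -
    have "AE p in lborel. \<forall>k. indicator ?S (fst p, snd p) * moment W k (fst p) (snd p) = g k (fst p, snd p)"
      using g(2) by (simp add: AE_all_countable)
    then have "AE p in unit01 \<Otimes>\<^sub>M unit01. \<forall>k. indicator ?S (fst p, snd p) * moment W k (fst p) (snd p) = g k (fst p, snd p)"
      by (rule AE_lborel_unit01_pair)
    with AE_space show ?thesis
    proof eventually_elim
      case (elim p)
      then have p: "fst p \<in> {0..1}" "snd p \<in> {0..1}" by (auto simp: space_pair_measure)
      then have "(fst p, snd p) \<in> ?S" by blast
      with elim(2) have g: "g k (fst p, snd p) = moment W k (fst p) (snd p)" for k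
        by (simp only: indicator_simps mult_1)
      interpret prob_space "W (fst p) (snd p)" by (rule borel_prob_measuresD[OF mem[OF p]])
      have "\<bar>moment W k (fst p) (snd p)\<bar> \<le> d ^ k" for k
        unfolding moment_def by (rule integrable_borel_prob_measures[OF mem[OF p]]) (auto intro: abs_power_le)
      then have "max (- (d ^ k)) (min (d ^ k) (moment W k (fst p) (snd p))) = moment W k (fst p) (snd p)" for k
        using clamp by blast
      moreover have "moment W 0 (fst p) (snd p) = 1" by (simp add: moment_def prob_space)
      ultimately show ?case by (auto simp: m_def g[unfolded prod.collapse])
    qed
  qed
  ultimately show thesis by (rule that)
qed

lemma linear_extension_quantum_mult:
  "linear_extension f (quantum_mult p q) = (\<Sum>F\<in>Poly_Mapping.keys p. \<Sum>G\<in>Poly_Mapping.keys q.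
     Poly_Mapping.lookup p F * Poly_Mapping.lookup q G * f (gluing F G))"
  by (simp add: quantum_mult_def linear_extension_sum)

text \<open>
  Given the types of the nodes, the density of \<open>p\<^sup>2\<close> is the second moment of a polynomial in
  independent edge weights.
\<close>

lemma graphon_square_nonneg:
  assumes W: "\<And>i j. i \<in> V \<Longrightarrow> j \<in> V \<Longrightarrow> W (u i) (u j) \<in> borel_prob_measures d" and V: "finite V"
  shows "0 \<le> (\<Sum>F\<in>A. \<Sum>G\<in>A. c F * c G *
    (\<Prod>(i, j)\<in>prs V. moment W (edge_mult F i j + edge_mult G i j) (u i) (u j)))"
proof -
  \<comment> \<open>\<open>product_prob_space\<close> asks for a probability space at every index;
    \<open>unit01\<close> is a filler outside \<open>prs V\<close>.\<close>
  define N where "N p = (if p \<in> prs V then W (u (fst p)) (u (snd p)) else unit01)" for p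
  have N: "prob_space (N p)" for p
    using W prs_subset[of p V] by (auto simp: N_def dest: borel_prob_measuresD(1))
  interpret N: product_prob_space N "prs V" by (rule product_prob_spaceI[OF N])
  let ?M = "\<Pi>\<^sub>M p\<in>prs V. N p"
  define h where "h F s = (\<Prod>p\<in>prs V. s p ^ edge_mult F (fst p) (snd p))" for F and s :: "nat \<times> nat \<Rightarrow> real"
  have int: "integrable (N p) (\<lambda>s. s ^ k)" if "p \<in> prs V" for p k
    using that W prs_subset[OF that] by (auto simp: N_def intro!: integrable_borel_prob_measures(1)[where d=d] abs_power_le)
  have hh: "h F s * h G s = (\<Prod>p\<in>prs V. s p ^ (edge_mult F (fst p) (snd p) + edge_mult G (fst p) (snd p)))" for F G s
    by (simp add: h_def power_add prod.distrib)
  have int_hh: "integrable ?M (\<lambda>s. h F s * h G s)" for F G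
    unfolding hh by (rule N.product_integrable_prod) (auto intro: finite_prs[OF V] int)
  have "0 \<le> (\<integral>s. (\<Sum>F\<in>A. c F * h F s)\<^sup>2 \<partial>?M)" by simp
  also have "\<dots> = (\<integral>s. (\<Sum>F\<in>A. \<Sum>G\<in>A. c F * c G * (h F s * h G s)) \<partial>?M)"
    by (simp add: power2_eq_square sum_product mult_ac)
  also have "\<dots> = (\<Sum>F\<in>A. \<Sum>G\<in>A. c F * c G * (\<integral>s. h F s * h G s \<partial>?M))"
    by (simp add: int_hh)
  also have "\<dots> = (\<Sum>F\<in>A. \<Sum>G\<in>A. c F * c G *
    (\<Prod>(i, j)\<in>prs V. moment W (edge_mult F i j + edge_mult G i j) (u i) (u j)))"
  proof -
    have "(\<integral>s. h F s * h G s \<partial>?M) = (\<Prod>(i, j)\<in>prs V. moment W (edge_mult F i j + edge_mult G i j) (u i) (u j))" for F G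
    proof -
      let ?e = "\<lambda>p. edge_mult F (fst p) (snd p) + edge_mult G (fst p) (snd p)"
      have "(\<integral>s. h F s * h G s \<partial>?M) = (\<Prod>p\<in>prs V. (\<integral>s. s ^ ?e p \<partial>N p))"
        unfolding hh by (rule N.product_integral_prod) (auto intro: finite_prs[OF V] int)
      also have "\<dots> = (\<Prod>(i, j)\<in>prs V. moment W (edge_mult F i j + edge_mult G i j) (u i) (u j))"
        by (intro prod.cong refl) (auto simp: N_def moment_def)
      finally show ?thesis .
    qed
    then show ?thesis by simp
  qed
  finally show ?thesis .
qed

theorem graphon_parameter_properties:
  assumes W: "graphon d W" and d: "d > 0" and f: "\<And>F. f F = hom_density F W"
  shows "normalized f \<and> multiplicative f \<and> weakly_reflection_positive f \<and> (\<forall>k. \<bar>f (K2 k)\<bar> \<le> d ^ k)"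
proof -
  obtain m where m: "kernel m (\<lambda>k. d ^ k)"
    and AEm: "AE p in unit01 \<Otimes>\<^sub>M unit01. \<forall>k. moment W k (fst p) (snd p) = m k (fst p) (snd p)"
    by (rule graphon_kernel[OF W d])
  have f_eq: "f F = tden F m" for F by (simp add: f hom_density_eq_tden[OF m AEm])
  have prs1: "prs {1} = {}" by (auto simp: prs_def)
  have prs2: "prs {1, 2} = {(1, 2)}" by (auto simp: prs_def)
  have "normalized f"
    using prob_space.prob_space[OF prob_space_cube[of "{1}"]]
    by (simp add: normalized_def f_eq tden_def prs1[simplified])
  moreover have "multiplicative f"
    by (simp add: multiplicative_def f_eq tden_disjoint_union[OF m])
  moreover have "\<bar>f (K2 k)\<bar> \<le> d ^ k" for k
  proof -
    let ?h = "\<lambda>u. \<Prod>(i, j)\<in>prs {1, 2}. m (edge_mult (K2 k) i j) (u i) (u j)"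
    have int: "integrable (cube {1, 2}) ?h" by (rule integrable_kernel_prod[OF m])
    have "\<bar>?h u\<bar> \<le> d ^ k" for u
      using kernel_prod_bound[OF m, of "edge_mult (K2 k)" u "prs {1, 2}"] unfolding prs2 by simp
    then have "(\<integral>u. \<bar>?h u\<bar> \<partial>cube {1, 2}) \<le> d ^ k"
      using int by (intro prob_space.integral_le_const[OF prob_space_cube]) auto
    moreover have "\<bar>f (K2 k)\<bar> \<le> (\<integral>u. \<bar>?h u\<bar> \<partial>cube {1, 2})"
      unfolding f_eq tden_def nodes_K2 by (rule integral_abs_bound)
    ultimately show ?thesis by simp
  qed
  moreover have "weakly_reflection_positive f"
    unfolding weakly_reflection_positive_def
  proof (intro allI impI ballI)
    fix n :: nat and p assume p: "p \<in> quantum_graphs n"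
    let ?V = "{1..n}" and ?K = "Poly_Mapping.keys p" and ?c = "Poly_Mapping.lookup p"
    have nodes: "nodes F = ?V" if "F \<in> ?K" for F
      using p that by (auto simp: quantum_graphs_def graphs_on_def)
    let ?h = "\<lambda>F G u. \<Prod>(i, j)\<in>prs ?V. m (edge_mult F i j + edge_mult G i j) (u i) (u j)"
    have int: "integrable (cube ?V) (?h F G)" for F G by (rule integrable_kernel_prod[OF m])
    have mem: "W x y \<in> borel_prob_measures d" if "x \<in> {0..1}" "y \<in> {0..1}" for x y
      using W measurable_space[of "\<lambda>(x, y). W x y" "lebesgue_on ({0..1} \<times> {0..1})" "weak_borel d" "(x, y)"] that
      by (simp add: space_restrict_space graphon_def)
    have "AE u in cube ?V. \<forall>(i, j)\<in>prs ?V. \<forall>k. moment W k (u i) (u j) = m k (u i) (u j)"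
      by (rule AE_cube_prs) (use AEm in auto)
    \<comment> \<open>Nonnegativity holds for the true moments of \<open>W\<close>; it is carried to
      the Borel version \<open>m\<close>, with which the densities are integrated.\<close>
    with AE_space have "AE u in cube ?V. 0 \<le> (\<Sum>F\<in>?K. \<Sum>G\<in>?K. ?c F * ?c G * ?h F G u)"
    proof eventually_elim
      case (elim u)
      then have "u i \<in> {0..1}" if "i \<in> ?V" for i
        using that by (auto simp: space_PiM PiE_def Pi_def)
      then have "0 \<le> (\<Sum>F\<in>?K. \<Sum>G\<in>?K. ?c F * ?c G *
          (\<Prod>(i, j)\<in>prs ?V. moment W (edge_mult F i j + edge_mult G i j) (u i) (u j)))"
        by (intro graphon_square_nonneg[where d=d] mem) auto
      moreover have "(\<Prod>(i, j)\<in>prs ?V. moment W (edge_mult F i j + edge_mult G i j) (u i) (u j)) = ?h F G u" for F G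
        using elim(2) by (intro prod.cong) auto
      ultimately show ?case by simp
    qed
    then have "0 \<le> (\<integral>u. (\<Sum>F\<in>?K. \<Sum>G\<in>?K. ?c F * ?c G * ?h F G u) \<partial>cube ?V)"
      by (rule integral_nonneg_AE)
    also have "\<dots> = (\<Sum>F\<in>?K. \<Sum>G\<in>?K. ?c F * ?c G * (\<integral>u. ?h F G u \<partial>cube ?V))"
      by (simp add: int[simplified])
    also have "\<dots> = linear_extension f (quantum_mult p p)"
      unfolding linear_extension_quantum_mult
      by (intro sum.cong refl) (simp add: f_eq tden_def nodes)
    finally show "0 \<le> linear_extension f (quantum_mult p p)" .
  qed
  ultimately show ?thesis by blast
qed

section \<open>The random graphon\<close>

declare One_nat_def [simp del]

context rp_parameter
begin

abbreviation S01 :: "nat set" where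
  "S01 \<equiv> rowset {lab 0, lab 1}"

text \<open>After scaling by d^k, this will be the k-th moment of the edge weight between two
  sampled nodes, given their rows and the background.\<close>

definition H :: "nat \<Rightarrow> (nat \<Rightarrow> bool) \<Rightarrow> real" where
  "H k = \<Omega>.CE S01 (walsh (pairset (lab 0) (lab 1) k))"

text \<open>The Aldous--Hoover representation: the types x and y are turned into rows by the sampler
  \<open>Q \<omega>\<close>, with the background held fixed.\<close>

definition wk :: "nat \<Rightarrow> (nat \<Rightarrow> bool) \<Rightarrow> real \<Rightarrow> real \<Rightarrow> real" where
  "wk k \<omega> x y = H k (cfg {0, 1} \<omega> (\<lambda>i. if i = 0 then Q \<omega> x else Q \<omega> y))"

text \<open>
  \<open>good \<omega> x y\<close> holds almost everywhere; where it fails, the moments of the Dirac measure at 0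
  are used.
\<close>

definition good :: "(nat \<Rightarrow> bool) \<Rightarrow> real \<Rightarrow> real \<Rightarrow> bool" where
  "good \<omega> x y \<longleftrightarrow> correlation (\<lambda>A. wk (card A) \<omega> x y) \<and> (\<forall>k. wk k \<omega> x y = wk k \<omega> y x)"

definition mk :: "(nat \<Rightarrow> bool) \<Rightarrow> nat \<Rightarrow> real \<Rightarrow> real \<Rightarrow> real" where
  "mk \<omega> k x y = (if good \<omega> x y then d ^ k * wk k \<omega> x y else 0 ^ k)"

definition sig :: "nat \<Rightarrow> nat \<Rightarrow> nat \<Rightarrow> nat" where
  "sig i j = (SOME \<sigma>. inj \<sigma> \<and> \<sigma> (lab 0) = lab i \<and> \<sigma> (lab 1) = lab j \<and> (\<forall>x\<in>BG. \<sigma> x = x))"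

lemma sig:
  assumes "i \<noteq> j"
  shows "inj (sig i j)" "sig i j (lab 0) = lab i" "sig i j (lab 1) = lab j" "\<And>x. x \<in> BG \<Longrightarrow> sig i j x = x"
proof -
  let ?D = "{lab 0, lab 1}" and ?\<tau> = "\<lambda>x. if x = lab 0 then lab i else lab j"
  have D: "finite ?D" "?D \<inter> BG = {}" "inj_on ?\<tau> ?D" "?\<tau> ` ?D \<inter> BG = {}"
    using assms by (simp_all add: inj_on_def)
  obtain \<sigma> :: "nat \<Rightarrow> nat" where \<sigma>: "inj \<sigma>" "\<And>x. x \<in> ?D \<Longrightarrow> \<sigma> x = ?\<tau> x" "\<And>x. x \<in> BG \<Longrightarrow> \<sigma> x = x"
    by (rule ex_relabelling[OF D]) blast
  have "\<exists>\<sigma>. inj \<sigma> \<and> \<sigma> (lab 0) = lab i \<and> \<sigma> (lab 1) = lab j \<and> (\<forall>x\<in>BG. \<sigma> x = x)"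
    using \<sigma>(1,3) \<sigma>(2)[of "lab 0"] \<sigma>(2)[of "lab 1"] by (intro exI[of _ \<sigma>]) simp
  from someI_ex[OF this]
  show "inj (sig i j)" "sig i j (lab 0) = lab i" "sig i j (lab 1) = lab j" "\<And>x. x \<in> BG \<Longrightarrow> sig i j x = x"
    unfolding sig_def by auto
qed

lemma S01_eq: "S01 = rowset (lab ` {0, 1})"
  by simp

lemma bdd1_H: "bdd1 (H k)" and depends_on_H: "depends_on S01 (H k)"
  unfolding H_def by (rule \<Omega>.bdd1_CE \<Omega>.depends_on_CE)+

lemma abs_wk_le: "\<bar>wk k \<omega> x y\<bar> \<le> 1"
  unfolding wk_def by (rule bdd1_le[OF bdd1_H])

lemma nperm_sig_S01: "i \<noteq> j \<Longrightarrow> nperm (sig i j) ` S01 = rowset {lab i, lab j}"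
  unfolding S01_eq by (subst nperm_rowset[where \<tau>="\<lambda>l. if l = 0 then i else j"]) (auto simp: sig insert_commute)

section \<open>Densities as means over the array\<close>

lemma AE_edge:
  assumes "i \<noteq> j"
  shows "AE \<omega> in \<Omega>. \<Omega>.CE (rowset {lab i, lab j}) (walsh (pairset (lab i) (lab j) k)) \<omega>
    = H k (relab (nperm (sig i j)) \<omega>)"
proof -
  interpret relabelled_bit_space \<Omega> "nperm (sig i j)" by (rule relabelled_nperm[OF sig(1)[OF assms]])
  have "nperm (sig i j) ` pairset (lab 0) (lab 1) k = pairset (lab i) (lab j) k"
    unfolding pairset_def image_image by (intro image_cong refl) (simp add: nperm_bidx sig[OF assms])
  then have "walsh (pairset (lab 0) (lab 1) k) (relab (nperm (sig i j)) \<omega>) = walsh (pairset (lab i) (lab j) k) \<omega>" for \<omega>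
    by (simp add: walsh_relab inj_\<pi>)
  with CE_relab[OF bdd1_walsh, of S01 "pairset (lab 0) (lab 1) k"] show ?thesis
    by (simp add: nperm_sig_S01[OF assms] H_def)
qed

lemma H_relab_cfg:
  assumes "i \<noteq> j" "i \<in> V" "j \<in> V"
  shows "H k (relab (nperm (sig i j)) (cfg V \<omega> \<rho>)) = H k (cfg {0, 1} \<omega> (\<lambda>l. if l = 0 then \<rho> i else \<rho> j))"
proof (rule depends_onD[OF depends_on_H])
  fix n assume "n \<in> S01"
  then have "n \<in> rowset (lab ` {0, 1})" by simp
  then show "relab (nperm (sig i j)) (cfg V \<omega> \<rho>) n = cfg {0, 1} \<omega> (\<lambda>l. if l = 0 then \<rho> i else \<rho> j) n"
  proof (cases rule: rowset_cases)
    case 1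
    then show ?thesis by (simp add: relab_def nperm_background sig[OF assms(1)])
  next
    case (2 l m)
    then have "nperm (sig i j) n = ridx (lab (if l = 0 then i else j)) m"
      using nperm_ridx[of "sig i j" l "lab (if l = 0 then i else j)" m] sig[OF assms(1)] by auto
    with 2 assms show ?thesis by (simp add: relab_def)
  qed
qed

text \<open>The multigraph is placed on odd nodes, with one distinct copy for each parallel edge, so
  that f F is d to the number of edges times the mean of one Walsh character. Then
  \<open>replace_edge\<close> replaces each edge by its conditional mean given two rows.\<close>

lemma array_density:
  "f F = (\<Prod>(i, j)\<in>prs (nodes F). d ^ edge_mult F i j) *
    (\<integral>\<omega>. (\<Prod>(i, j)\<in>prs (nodes F). H (edge_mult F i j) (relab (nperm (sig i j)) \<omega>)) \<partial>\<Omega>)"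
proof -
  let ?V = "nodes F" and ?e = "edge_mult F"
  let ?Ks = "\<lambda>p. pairset (lab (fst p)) (lab (snd p)) (?e (fst p) (snd p))"
  let ?h = "\<lambda>p. \<Omega>.CE (rowset {lab (fst p), lab (snd p)}) (walsh (?Ks p))"
  define K where "K = (\<Union>p\<in>prs ?V. ?Ks p)"
  have fin: "finite (prs ?V)" by simp
  have finK: "finite (?Ks p)" for p by (simp add: pairset_def)
  have ne: "lab (fst p) \<noteq> lab (snd p)" if "p \<in> prs ?V" for p using prs_subset[OF that] by simp
  have enodes_K: "enodes n = {lab (fst p), lab (snd p)}" if "p \<in> prs ?V" "n \<in> ?Ks p" for n p
    by (rule enodes_pairset[OF ne[OF that(1)] that(2)])
  have same_pair: "p = q" if "p \<in> prs ?V" "q \<in> prs ?V" "{lab (fst p), lab (snd p)} = {lab (fst q), lab (snd q)}" for p q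
    using that by (auto simp: prs_def doubleton_eq_iff)
  have disj: "?Ks p \<inter> ?Ks q = {}" if "p \<in> prs ?V" "q \<in> prs ?V" "p \<noteq> q" for p q
  proof (rule equals0I)
    fix n assume "n \<in> ?Ks p \<inter> ?Ks q"
    then have "{lab (fst p), lab (snd p)} = {lab (fst q), lab (snd q)}"
      using enodes_K[OF that(1)] enodes_K[OF that(2)] by blast
    with same_pair[OF that(1,2)] that(3) show False by blast
  qed
  have card_Ks: "card (?Ks p) = ?e (fst p) (snd p)" if "p \<in> prs ?V" for p
    unfolding pairset_def using ne[OF that] by (subst card_image) (auto simp: inj_on_def bidx_eq_iff)
  have count: "edge_count K (ecode (lab i) (lab j)) = ?e i j" if ij: "i \<in> ?V" "j \<in> ?V" "i \<noteq> j" for i j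
  proof -
    define p where "p = (if i < j then (i, j) else (j, i))"
    have p: "p \<in> prs ?V" "{lab (fst p), lab (snd p)} = {lab i, lab j}" "?e (fst p) (snd p) = ?e i j"
      using ij by (auto simp: p_def prs_def edge_mult_commute)
    have "{n \<in> K. fst (prod_decode n) = ecode (lab i) (lab j)} = ?Ks p"
    proof (intro equalityI subsetI)
      fix n assume "n \<in> {n \<in> K. fst (prod_decode n) = ecode (lab i) (lab j)}"
      then obtain q where q: "q \<in> prs ?V" "n \<in> ?Ks q" "enodes n = {lab i, lab j}"
        by (auto simp: K_def decode_eq_ecode_iff[of "lab i" "lab j"] ij(3))
      then have "{lab (fst q), lab (snd q)} = {lab (fst p), lab (snd p)}" using enodes_K[OF q(1,2)] p(2) by simp
      then have "q = p" by (rule same_pair[OF q(1) p(1)])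
      with q(2) show "n \<in> ?Ks p" by simp
    next
      fix n assume n: "n \<in> ?Ks p"
      then show "n \<in> {n \<in> K. fst (prod_decode n) = ecode (lab i) (lab j)}"
        using p(1,2) enodes_K[OF p(1) n] by (auto simp: K_def decode_eq_ecode_iff[of "lab i" "lab j"] ij(3))
    qed
    then show ?thesis unfolding edge_count_def using card_Ks[OF p(1)] p(3) by simp
  qed
  have "f F = gval f (edge_count K)"
  proof (rule f_eq_gval[where \<phi>=lab])
    show "inj_on lab ?V" by (simp add: inj_on_def)
    show "support_nodes (edge_count K) \<subseteq> lab ` ?V"
    proof
      fix x assume "x \<in> support_nodes (edge_count K)"
      then obtain c where c: "edge_count K c \<noteq> 0" "x \<in> endset c" by (auto simp: support_nodes_def)
      have "{n \<in> K. fst (prod_decode n) = c} \<noteq> {}"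
        using c(1) unfolding edge_count_def by (metis card.empty)
      then obtain n p where np: "p \<in> prs ?V" "n \<in> ?Ks p" "fst (prod_decode n) = c"
        by (auto simp: K_def)
      then have "endset c = {lab (fst p), lab (snd p)}" using enodes_K[OF np(1,2)] by (simp add: enodes_def)
      then show "x \<in> lab ` ?V" using c(2) prs_subset[OF np(1)] by auto
    qed
  qed (rule count)
  moreover have "card K = (\<Sum>p\<in>prs ?V. ?e (fst p) (snd p))"
    unfolding K_def using fin finK disj card_Ks by (subst card_UN_disjoint) auto
  ultimately have "gcor K * (\<Prod>(i, j)\<in>prs ?V. d ^ ?e i j) = f F"
    using d_pos by (simp add: gcor_def split_beta' power_sum)
  moreover have "gcor K = (\<integral>\<omega>. (\<Prod>p\<in>prs ?V. H (?e (fst p) (snd p)) (relab (nperm (sig (fst p) (snd p))) \<omega>)) \<partial>\<Omega>)"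
  proof -
    \<comment> \<open>The factor 1 stands for \<open>G\<close> in
      \<open>integral_replace_all\<close>.\<close>
    have walsh_K: "walsh K \<omega> = 1 * (\<Prod>p\<in>prs ?V. walsh (?Ks p) \<omega>)" for \<omega>
      unfolding walsh_def K_def using fin finK disj by (subst prod.UNION_disjoint) auto
    have "gcor K = (\<integral>\<omega>. walsh K \<omega> \<partial>\<Omega>)"
      using fin finK by (subst integral_walsh) (auto simp: K_def)
    also have "\<dots> = (\<integral>\<omega>. 1 * (\<Prod>p\<in>prs ?V. walsh (?Ks p) \<omega>) \<partial>\<Omega>)"
      by (simp only: walsh_K)
    also have "(\<integral>\<omega>. 1 * (\<Prod>p\<in>prs ?V. walsh (?Ks p) \<omega>) \<partial>\<Omega>) = (\<integral>\<omega>. 1 * (\<Prod>p\<in>prs ?V. ?h p \<omega>) \<partial>\<Omega>)"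
    proof (rule \<Omega>.integral_replace_all[where R="\<lambda>p. {n. enodes n \<subseteq> BG \<union> lab ` (?V - {fst p, snd p}) \<union> {lab (fst p), lab (snd p)}
        \<and> \<not> enodes n \<subseteq> {lab (fst p), lab (snd p)}}"])
      fix p q assume pq: "p \<in> prs ?V" "q \<in> prs ?V" "p \<noteq> q"
      let ?R = "{n. enodes n \<subseteq> BG \<union> lab ` (?V - {fst p, snd p}) \<union> {lab (fst p), lab (snd p)}
        \<and> \<not> enodes n \<subseteq> {lab (fst p), lab (snd p)}}"
      have inV: "lab (fst q) \<in> lab ` (?V - {fst p, snd p}) \<union> {lab (fst p), lab (snd p)}"
        "lab (snd q) \<in> lab ` (?V - {fst p, snd p}) \<union> {lab (fst p), lab (snd p)}"
        using prs_subset[OF pq(2)] by auto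
      have "\<not> {lab (fst q), lab (snd q)} \<subseteq> {lab (fst p), lab (snd p)}"
        using pq by (auto simp: prs_def)
      then show "depends_on ?R (walsh (?Ks q))"
        using enodes_K[OF pq(2)] inV by (intro depends_on_walsh) auto
      have "rowset {lab (fst q), lab (snd q)} \<subseteq> ?R"
        using inV by (auto simp: rowset_def)
      then show "depends_on ?R (?h q)" by (rule depends_on_mono[OF \<Omega>.depends_on_CE])
    next
      fix p G assume p: "p \<in> prs ?V" and G: "bdd1 G"
        "depends_on {n. enodes n \<subseteq> BG \<union> lab ` (?V - {fst p, snd p}) \<union> {lab (fst p), lab (snd p)}
          \<and> \<not> enodes n \<subseteq> {lab (fst p), lab (snd p)}} G"
      show "(\<integral>\<omega>. G \<omega> * walsh (?Ks p) \<omega> \<partial>\<Omega>) = (\<integral>\<omega>. G \<omega> * ?h p \<omega> \<partial>\<Omega>)"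
        by (rule replace_edge[OF ne[OF p] _ _ _ _ _ G]) auto
    next
      show "bdd1 (\<lambda>_. 1)" by (simp add: bdd1_def)
      show "depends_on T (\<lambda>_. 1 :: real)" for T by (simp add: depends_on_def)
    qed (auto intro: bdd1_walsh \<Omega>.bdd1_CE)
    also have "\<dots> = (\<integral>\<omega>. (\<Prod>p\<in>prs ?V. H (?e (fst p) (snd p)) (relab (nperm (sig (fst p) (snd p))) \<omega>)) \<partial>\<Omega>)"
    proof (rule integral_cong_AE)
      have "AE \<omega> in \<Omega>. \<forall>p\<in>prs ?V. ?h p \<omega> = H (?e (fst p) (snd p)) (relab (nperm (sig (fst p) (snd p))) \<omega>)"
        by (intro AE_finite_allI fin AE_edge) (auto dest: prs_subset)
      then show "AE \<omega> in \<Omega>. 1 * (\<Prod>p\<in>prs ?V. ?h p \<omega>) =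
          (\<Prod>p\<in>prs ?V. H (?e (fst p) (snd p)) (relab (nperm (sig (fst p) (snd p))) \<omega>))"
        by eventually_elim (simp cong: prod.cong)
    qed (auto intro!: \<Omega>.bdd1_measurable_M bdd1_prod \<Omega>.bdd1_CE bdd1_relab bdd1_H)
    finally show ?thesis .
  qed
  ultimately show ?thesis by (simp add: split_beta' mult.commute)
qed

section \<open>Measurability and almost sure properties of the kernel\<close>

lemma measurable_cfg01:
  assumes [measurable]: "\<omega> \<in> M \<rightarrow>\<^sub>M Bits" "x \<in> borel_measurable M" "y \<in> borel_measurable M"
  shows "(\<lambda>a. cfg {0, 1} (\<omega> a) (\<lambda>i. if i = 0 then Q (\<omega> a) (x a) else Q (\<omega> a) (y a))) \<in> M \<rightarrow>\<^sub>M Bits"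
proof (rule measurable_cfg)
  note [measurable] = measurable_Q[of \<omega> M x] measurable_Q[of \<omega> M y]
  show "(\<lambda>a. if i = 0 then Q (\<omega> a) (x a) else Q (\<omega> a) (y a)) \<in> M \<rightarrow>\<^sub>M Bits" for i :: nat
    by (cases "i = 0") (simp_all add: measurable_Q)
qed simp_all

lemma measurable_wk [measurable (raw)]:
  assumes "\<omega> \<in> M \<rightarrow>\<^sub>M Bits" "x \<in> borel_measurable M" "y \<in> borel_measurable M"
  shows "(\<lambda>a. wk k (\<omega> a) (x a) (y a)) \<in> borel_measurable M"
  unfolding wk_def by (rule measurable_compose[OF measurable_cfg01[OF assms] bdd1_measurable[OF bdd1_H]])

lemma measurable_good [measurable (raw)]:
  assumes [measurable]: "\<omega> \<in> M \<rightarrow>\<^sub>M Bits" "x \<in> borel_measurable M" "y \<in> borel_measurable M"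
  shows "Measurable.pred M (\<lambda>a. good (\<omega> a) (x a) (y a))"
  unfolding good_def correlation_def genp_def by measurable

lemma measurable_mk [measurable (raw)]:
  assumes [measurable]: "\<omega> \<in> M \<rightarrow>\<^sub>M Bits" "x \<in> borel_measurable M" "y \<in> borel_measurable M"
  shows "(\<lambda>a. mk (\<omega> a) k (x a) (y a)) \<in> borel_measurable M"
  unfolding mk_def by measurable

lemma kernel_mk: "kernel (mk \<omega>) (\<lambda>k. d ^ k)"
  unfolding kernel_def
proof (intro conjI allI)
  show "(\<lambda>(x, y). mk \<omega> k x y) \<in> borel_measurable (unit01 \<Otimes>\<^sub>M unit01)" for k
    unfolding split_beta'
    by (intro measurable_mk measurable_const measurable_compose[OF measurable_fst measurable_ident_unit01]
      measurable_compose[OF measurable_snd measurable_ident_unit01]) simp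
  show "\<bar>mk \<omega> k x y\<bar> \<le> d ^ k" for k x y
    using abs_wk_le[of k \<omega> x y] d_pos
    by (auto simp: mk_def abs_mult power_0_left mult_left_le intro: mult_left_le)
  show "mk \<omega> 0 x y = 1" for x y
    by (auto simp: mk_def good_def correlation_def)
qed

text \<open>Exchangeability of the copies: a permutation of the tags of this single edge preserves
  the law and fixes the rows, so only the number of copies matters. This makes \<open>wk\<close> a
  candidate for de Finetti's theorem.\<close>

lemma AE_H_tags:
  assumes "finite A"
  shows "AE \<omega> in \<Omega>. \<Omega>.CE S01 (walsh (bidx (lab 0) (lab 1) ` A)) \<omega> = H (card A) \<omega>"
proof -
  let ?b = "bidx (lab 0) (lab 1)" and ?E = "{lab 0, lab 1}"
  obtain \<tau>1 where \<tau>1: "bij_betw \<tau>1 {..<card A} A"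
    using bij_betw_iff_card[of "{..<card A}" A] assms by auto
  have "infinite (- {..<card A})" "infinite (- A)"
    using assms by (auto simp: Compl_eq_Diff_UNIV Diff_infinite_finite)
  then obtain \<tau>2 where \<tau>2: "bij_betw \<tau>2 (- {..<card A}) (- A)" using ex_bij_infinite_nat by blast
  \<comment> \<open>A bijection that takes the first \<open>card A\<close> tags to \<open>A\<close>;
    the complements are matched too, so that it is injective on all tags.\<close>
  define \<tau> where "\<tau> t = (if t < card A then \<tau>1 t else \<tau>2 t)" for t
  have "bij_betw \<tau> {..<card A} A \<longleftrightarrow> bij_betw \<tau>1 {..<card A} A"
    "bij_betw \<tau> (- {..<card A}) (- A) \<longleftrightarrow> bij_betw \<tau>2 (- {..<card A}) (- A)"
    by (rule bij_betw_cong; simp add: \<tau>_def)+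
  with \<tau>1 \<tau>2 have "bij_betw \<tau> {..<card A} A" "bij_betw \<tau> (- {..<card A}) (- A)" by simp_all
  from bij_betw_combine[OF this] have "bij \<tau>" unfolding Compl_partition by simp
  then have inj\<tau>: "inj \<tau>" by (rule bij_is_inj)
  have im: "\<tau> ` {..<card A} = A" using \<open>bij_betw \<tau> {..<card A} A\<close> by (simp add: bij_betw_def)
  define \<pi> where "\<pi> n = (if enodes n = ?E then ?b (\<tau> (etag n)) else n)" for n
  have en: "enodes (\<pi> n) = enodes n" for n by (simp add: \<pi>_def)
  have tag: "etag (\<pi> n) = (if enodes n = ?E then \<tau> (etag n) else etag n)" for n by (simp add: \<pi>_def)
  have n_eq: "m = n" if "enodes m = enodes n" "etag m = etag n" for m n
  proof -
    obtain i j where "enodes n = {i, j}" by (rule obtain_bidx[of n])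
    then show ?thesis using that bidx_if_enodes[of m i j] bidx_if_enodes[of n i j] by simp
  qed
  have inj: "inj \<pi>"
    by (rule injI, rule n_eq) (metis en, metis en tag inj\<tau> injD)
  have code: "fst (prod_decode (\<pi> n)) = fst (prod_decode n)" for n
  proof (cases "enodes n = ?E")
    case True
    then have "n = ?b (etag n)" by (rule bidx_if_enodes)
    then have "fst (prod_decode n) = ecode (lab 0) (lab 1)" by (metis bidx_def fst_conv prod_encode_inverse)
    with True show ?thesis by (simp add: \<pi>_def bidx_def)
  qed (simp add: \<pi>_def)
  interpret relabelled_bit_space \<Omega> \<pi>
  proof (rule relabelledI[OF inj])
    fix K :: "nat set" assume "finite K"
    have "edge_count (\<pi> ` K) c = edge_count K c" for c
    proof -
      have "{n \<in> \<pi> ` K. fst (prod_decode n) = c} = \<pi> ` {n \<in> K. fst (prod_decode n) = c}"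
        by (auto simp: code)
      then show ?thesis by (simp add: edge_count_def card_image inj_on_subset[OF inj])
    qed
    then have "edge_count (\<pi> ` K) = edge_count K" by blast
    then show "gcor (\<pi> ` K) = gcor K" by (simp add: gcor_def card_image inj_on_subset[OF inj])
  qed
  have fixed: "\<pi> n = n" if "n \<in> S01" for n
    using that by (auto simp: \<pi>_def rowset_def)
  then have "\<pi> ` S01 = S01" by (force simp: image_iff)
  moreover have "\<pi> ` pairset (lab 0) (lab 1) (card A) = ?b ` A"
  proof -
    have "\<pi> (?b t) = ?b (\<tau> t)" for t by (simp add: \<pi>_def)
    then have "\<pi> ` ?b ` {..<card A} = ?b ` \<tau> ` {..<card A}" unfolding image_image by simp
    then show ?thesis by (simp only: pairset_def im)
  qed
  then have "walsh (pairset (lab 0) (lab 1) (card A)) (relab \<pi> \<omega>) = walsh (?b ` A) \<omega>" for \<omega>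
    by (simp add: walsh_relab inj)
  moreover have "H (card A) (relab \<pi> \<omega>) = H (card A) \<omega>" for \<omega>
    by (rule depends_onD[OF depends_on_H]) (simp add: relab_def fixed)
  ultimately show ?thesis
    using CE_relab[OF bdd1_walsh, of S01 "pairset (lab 0) (lab 1) (card A)"] by (simp add: H_def)
qed

text \<open>\<open>good\<close> phrased for configurations. \<open>sig 1 0\<close> swaps the nodes
  \<open>lab 0\<close> and \<open>lab 1\<close>, so the second part is the symmetry of the
  kernel.\<close>

definition good_cfg :: "(nat \<Rightarrow> bool) \<Rightarrow> bool" where
  "good_cfg x \<longleftrightarrow> correlation (\<lambda>A. H (card A) x) \<and> (\<forall>k. H k x = H k (relab (nperm (sig 1 0)) x))"

lemma AE_good_cfg: "AE x in \<Omega>. good_cfg x"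
proof -
  have "AE x in \<Omega>. correlation (\<lambda>A. H (card A) x)"
    by (rule \<Omega>.CE_correlation[where \<iota>="bidx (lab 0) (lab 1)"]) (auto intro: AE_H_tags simp: inj_def bidx_eq_iff)
  moreover have "AE x in \<Omega>. H k x = H k (relab (nperm (sig 1 0)) x)" for k
  proof -
    have "pairset (lab 1) (lab 0) k = pairset (lab 0) (lab 1) k"
      by (simp add: pairset_def bidx_commute[of "lab 1"])
    then show ?thesis
      using AE_edge[of 1 0 k] by (simp add: H_def insert_commute)
  qed
  then have "AE x in \<Omega>. \<forall>k. H k x = H k (relab (nperm (sig 1 0)) x)" by (simp add: AE_all_countable)
  ultimately show ?thesis by eventually_elim (simp add: good_cfg_def)
qed

lemma measurable_good_cfg: "Measurable.pred Bits good_cfg"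
proof -
  have H: "(\<lambda>x. H k x) \<in> borel_measurable Bits" for k
    by (rule bdd1_measurable[OF bdd1_H])
  have H': "(\<lambda>x. H k (relab (nperm (sig 1 0)) x)) \<in> borel_measurable Bits" for k
    by (rule bdd1_measurable[OF bdd1_relab[OF bdd1_H]])
  show ?thesis
    unfolding good_cfg_def[abs_def] correlation_def genp_def pred_def
    by (intro sets.sets_Collect_conj sets.sets_Collect_countable_All borel_measurable_eq borel_measurable_le
      borel_measurable_divide borel_measurable_sum borel_measurable_times borel_measurable_const H H')
qed

text \<open>\<open>good_cfg\<close> depends only on the background and two rows, so
  \<open>distr_rows\<close> transports it from the array to almost every background and pair of
  types.\<close>

lemma AE_good: "AE \<omega> in \<Omega>. AE p in unit01 \<Otimes>\<^sub>M unit01. good \<omega> (fst p) (snd p)"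
proof -
  let ?C = "cube {0, 1}"
  let ?T = "\<lambda>(\<omega>, u). cfg {0, 1} \<omega> (\<lambda>i. Q \<omega> (u i))"
  interpret P: pair_sigma_finite \<Omega> ?C
    by (intro pair_sigma_finite.intro prob_space_imp_sigma_finite \<Omega>.prob_space_axioms prob_space_cube)
  have keep_H: "H k (keep S01 x) = H k x" for k x by (rule depends_on_keep[OF depends_on_H])
  have "depends_on S01 (\<lambda>x. H k (relab (nperm (sig 1 0)) x))" for k
    using depends_on_relab[OF depends_on_H, of "nperm (sig 1 0)" k] nperm_sig_S01[of 1 0]
    by (simp add: insert_commute)
  from depends_on_keep[OF this] have "good_cfg (keep S01 x) = good_cfg x" for x
    by (simp add: good_cfg_def keep_H)
  then have "AE x in \<Omega>. good_cfg (keep S01 x)" using AE_good_cfg by simp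
  then have "AE x in distr \<Omega> Bits (keep S01). good_cfg x"
    by (subst AE_distr_iff) (use measurable_good_cfg in \<open>auto simp: \<Omega>.measurable_M pred_def\<close>)
  note AE_keep = this
  have "distr \<Omega> Bits (keep S01) = distr (\<Omega> \<Otimes>\<^sub>M ?C) Bits ?T"
    unfolding S01_eq by (rule distr_rows) simp
  from AE_keep[unfolded this] have "AE x in distr (\<Omega> \<Otimes>\<^sub>M ?C) Bits ?T. good_cfg x" .
  moreover have "?T \<in> \<Omega> \<Otimes>\<^sub>M ?C \<rightarrow>\<^sub>M Bits" by (rule measurable_resample[OF _ \<Omega>.sets_M]) simp
  ultimately have "AE a in \<Omega> \<Otimes>\<^sub>M ?C. good_cfg (?T a)" by (rule AE_distrD[rotated])
  then have "AE \<omega> in \<Omega>. AE u in ?C. good_cfg (?T (\<omega>, u))" by (rule P.AE_pair)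
  then show ?thesis
  proof eventually_elim
    case (elim \<omega>)
    have "good_cfg (?T (\<omega>, u)) \<longleftrightarrow> good \<omega> (u 0) (u 1)" for u
    proof -
      have "cfg {0, 1} \<omega> (\<lambda>i. Q \<omega> (u i)) = cfg {0, 1} \<omega> (\<lambda>i. if i = 0 then Q \<omega> (u 0) else Q \<omega> (u 1))"
        by (auto simp: cfg_def fun_eq_iff)
      moreover have "H k (relab (nperm (sig 1 0)) (cfg {0, 1} \<omega> (\<lambda>i. Q \<omega> (u i)))) = wk k \<omega> (u 1) (u 0)" for k
        unfolding wk_def by (subst H_relab_cfg) auto
      ultimately show ?thesis by (simp add: good_cfg_def good_def wk_def)
    qed
    with elim have AE: "AE u in ?C. good \<omega> (fst (u 0, u 1)) (snd (u 0, u 1))" by simp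
    have m: "(\<lambda>u. (u 0, u 1)) \<in> ?C \<rightarrow>\<^sub>M unit01 \<Otimes>\<^sub>M unit01" by measurable
    have "Measurable.pred (unit01 \<Otimes>\<^sub>M unit01) (\<lambda>p. good \<omega> (fst p) (snd p))"
      by (intro measurable_good measurable_const measurable_compose[OF measurable_fst measurable_ident_unit01]
        measurable_compose[OF measurable_snd measurable_ident_unit01]) simp
    with AE m have "AE p in distr ?C (unit01 \<Otimes>\<^sub>M unit01) (\<lambda>u. (u 0, u 1)). good \<omega> (fst p) (snd p)"
      by (subst AE_distr_iff) (auto simp: pred_def)
    then show ?case by (subst (asm) distr_cube_pair) auto
  qed
qed

section \<open>Mean and variance of the random density\<close>

lemma measurable_cube_component: "i \<in> V \<Longrightarrow> (\<lambda>u. u i) \<in> borel_measurable (cube V)"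
  using measurable_compose[OF measurable_component_singleton[of i V "\<lambda>_. unit01"] measurable_ident_unit01] .

lemma measurable_tden_mk: "(\<lambda>\<omega>. tden F (mk \<omega>)) \<in> borel_measurable \<Omega>"
proof -
  have "(\<lambda>(\<omega>, u). \<Prod>p\<in>prs (nodes F). mk \<omega> (edge_mult F (fst p) (snd p)) (u (fst p)) (u (snd p)))
      \<in> borel_measurable (\<Omega> \<Otimes>\<^sub>M cube (nodes F))"
    unfolding split_beta'
  proof (intro borel_measurable_prod measurable_mk)
    have [measurable_cong]: "sets \<Omega> = sets Bits" by (rule \<Omega>.sets_M)
    show "fst \<in> \<Omega> \<Otimes>\<^sub>M cube (nodes F) \<rightarrow>\<^sub>M Bits" by measurable
    fix p assume "p \<in> prs (nodes F)"
    then show "(\<lambda>a. snd a (fst p)) \<in> borel_measurable (\<Omega> \<Otimes>\<^sub>M cube (nodes F))"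
      "(\<lambda>a. snd a (snd p)) \<in> borel_measurable (\<Omega> \<Otimes>\<^sub>M cube (nodes F))"
      using prs_subset[of p "nodes F"]
      by (auto intro!: measurable_compose[OF _ measurable_ident_unit01] measurable_compose[OF measurable_snd measurable_component_singleton])
  qed
  then show ?thesis
    unfolding tden_def split_beta' by (intro sigma_finite_measure.borel_measurable_lebesgue_integral prob_space_imp_sigma_finite prob_space_cube) (simp add: split_beta')
qed

lemma abs_tden_mk_le: "\<bar>tden F (mk \<omega>)\<bar> \<le> (\<Prod>(i, j)\<in>prs (nodes F). d ^ edge_mult F i j)"
proof -
  let ?h = "\<lambda>u. \<Prod>(i, j)\<in>prs (nodes F). mk \<omega> (edge_mult F i j) (u i) (u j)"
  have "\<bar>tden F (mk \<omega>)\<bar> \<le> (\<integral>u. \<bar>?h u\<bar> \<partial>cube (nodes F))"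
    unfolding tden_def by (rule integral_abs_bound)
  also have "\<dots> \<le> (\<Prod>(i, j)\<in>prs (nodes F). d ^ edge_mult F i j)"
    by (intro prob_space.integral_le_const[OF prob_space_cube] integrable_abs AE_I2
      kernel_prod_bound[OF kernel_mk] integrable_kernel_prod[OF kernel_mk])
  finally show ?thesis .
qed

text \<open>The integrand of \<open>array_density\<close> depends only on the rows of the nodes of
  \<open>F\<close>; these are resampled from uniform types, and Fubini's theorem separates the
  background from the types.\<close>

lemma integral_tden_mk: "(\<integral>\<omega>. tden F (mk \<omega>) \<partial>\<Omega>) = f F"
proof -
  let ?V = "nodes F" and ?e = "edge_mult F"
  let ?C = "cube ?V" and ?R = "rowset (lab ` nodes F)"
  let ?D = "\<Prod>(i, j)\<in>prs ?V. d ^ ?e i j"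
  let ?Phi = "\<lambda>x. \<Prod>p\<in>prs ?V. H (?e (fst p) (snd p)) (relab (nperm (sig (fst p) (snd p))) x)"
  let ?T = "\<lambda>(\<omega>, u). cfg ?V \<omega> (\<lambda>i. Q \<omega> (u i))"
  interpret P: pair_sigma_finite \<Omega> ?C
    by (intro pair_sigma_finite.intro prob_space_imp_sigma_finite \<Omega>.prob_space_axioms prob_space_cube)
  interpret PP: pair_prob_space \<Omega> ?C ..
  have "bdd1 ?Phi" by (intro bdd1_prod bdd1_relab bdd1_H)
  have Phi_dep: "depends_on ?R ?Phi"
  proof (rule depends_on_prod)
    fix p assume p: "p \<in> prs ?V"
    then have "fst p \<noteq> snd p" by (auto dest: prs_subset)
    from depends_on_relab[OF depends_on_H, of "nperm (sig (fst p) (snd p))"]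
    have "depends_on (rowset {lab (fst p), lab (snd p)}) (\<lambda>x. H k (relab (nperm (sig (fst p) (snd p))) x))" for k
      by (simp add: nperm_sig_S01[OF \<open>fst p \<noteq> snd p\<close>])
    moreover have "rowset {lab (fst p), lab (snd p)} \<subseteq> ?R"
      using prs_subset[OF p] by (intro rowset_mono) auto
    ultimately show "depends_on ?R (\<lambda>x. H (?e (fst p) (snd p)) (relab (nperm (sig (fst p) (snd p))) x))"
      by (rule depends_on_mono)
  qed
  have Phi_T: "?Phi (?T (\<omega>, u)) = (\<Prod>(i, j)\<in>prs ?V. wk (?e i j) \<omega> (u i) (u j))" for \<omega> u
    unfolding split_beta' wk_def using prs_subset[of _ ?V]
    by (intro prod.cong refl) (simp add: H_relab_cfg)
  have T_meas: "?T \<in> \<Omega> \<Otimes>\<^sub>M ?C \<rightarrow>\<^sub>M Bits" by (rule measurable_resample[OF _ \<Omega>.sets_M]) simp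
  have "(\<integral>x. ?Phi x \<partial>\<Omega>) = (\<integral>x. ?Phi (keep ?R x) \<partial>\<Omega>)"
    by (simp only: depends_on_keep[OF Phi_dep])
  also have "\<dots> = (\<integral>x. ?Phi x \<partial>distr \<Omega> Bits (keep ?R))"
    by (rule integral_distr[symmetric]) (simp_all add: \<Omega>.measurable_M measurable_keep bdd1_measurable[OF \<open>bdd1 ?Phi\<close>])
  also have "\<dots> = (\<integral>x. ?Phi x \<partial>distr (\<Omega> \<Otimes>\<^sub>M ?C) Bits ?T)"
    by (subst distr_rows) simp_all
  also have "\<dots> = (\<integral>a. ?Phi (?T a) \<partial>(\<Omega> \<Otimes>\<^sub>M ?C))"
    by (rule integral_distr[OF T_meas bdd1_measurable[OF \<open>bdd1 ?Phi\<close>]])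
  also have "\<dots> = (\<integral>\<omega>. (\<integral>u. ?Phi (?T (\<omega>, u)) \<partial>?C) \<partial>\<Omega>)"
  proof -
    have "finite_measure (\<Omega> \<Otimes>\<^sub>M ?C)" by unfold_locales
    then have "integrable (\<Omega> \<Otimes>\<^sub>M ?C) (\<lambda>a. ?Phi (?T a))"
      by (rule finite_measure.integrable_const_bound[where B=1])
         (use bdd1_le[OF \<open>bdd1 ?Phi\<close>] measurable_compose[OF T_meas bdd1_measurable[OF \<open>bdd1 ?Phi\<close>]] in auto)
    from P.integral_fst'[OF this] show ?thesis by simp
  qed
  finally have "f F = ?D * (\<integral>\<omega>. (\<integral>u. (\<Prod>(i, j)\<in>prs ?V. wk (?e i j) \<omega> (u i) (u j)) \<partial>?C) \<partial>\<Omega>)"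
    unfolding Phi_T by (subst array_density) (simp add: split_beta')
  also have "\<dots> = (\<integral>\<omega>. (\<integral>u. (\<Prod>(i, j)\<in>prs ?V. d ^ ?e i j * wk (?e i j) \<omega> (u i) (u j)) \<partial>?C) \<partial>\<Omega>)"
    by (simp add: split_beta' prod.distrib)
  also have "\<dots> = (\<integral>\<omega>. tden F (mk \<omega>) \<partial>\<Omega>)"
  proof (rule integral_cong_AE)
    have inner: "(\<integral>u. (\<Prod>(i, j)\<in>prs ?V. d ^ ?e i j * wk (?e i j) \<omega> (u i) (u j)) \<partial>?C) = tden F (mk \<omega>)"
      if "AE p in unit01 \<Otimes>\<^sub>M unit01. good \<omega> (fst p) (snd p)" for \<omega>
    proof -
      have AE: "AE u in ?C. \<forall>(i, j)\<in>prs ?V. good \<omega> (u i) (u j)"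
        by (rule AE_cube_prs) (use that in auto)
      have "(\<lambda>u. d ^ ?e (fst p) (snd p) * wk (?e (fst p) (snd p)) \<omega> (u (fst p)) (u (snd p))) \<in> borel_measurable ?C"
        if "p \<in> prs ?V" for p
        using prs_subset[OF that]
        by (intro borel_measurable_times measurable_const measurable_wk)
           (auto intro: measurable_cube_component)
      then have "(\<lambda>u. \<Prod>(i, j)\<in>prs ?V. d ^ ?e i j * wk (?e i j) \<omega> (u i) (u j)) \<in> borel_measurable ?C"
        unfolding split_beta' by (intro borel_measurable_prod) auto
      moreover have "AE u in ?C. (\<Prod>(i, j)\<in>prs ?V. d ^ ?e i j * wk (?e i j) \<omega> (u i) (u j)) =
          (\<Prod>(i, j)\<in>prs ?V. mk \<omega> (?e i j) (u i) (u j))"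
        using AE by eventually_elim (auto simp: mk_def intro!: prod.cong)
      ultimately show ?thesis
        unfolding tden_def using measurable_kernel_prod[OF kernel_mk] by (intro integral_cong_AE) auto
    qed
    show "AE \<omega> in \<Omega>. (\<integral>u. (\<Prod>(i, j)\<in>prs ?V. d ^ ?e i j * wk (?e i j) \<omega> (u i) (u j)) \<partial>?C) = tden F (mk \<omega>)"
      using AE_good by eventually_elim (rule inner)
    have "(\<lambda>(\<omega>, u). \<Prod>p\<in>prs ?V. d ^ ?e (fst p) (snd p) * wk (?e (fst p) (snd p)) \<omega> (u (fst p)) (u (snd p)))
        \<in> borel_measurable (\<Omega> \<Otimes>\<^sub>M ?C)"
      unfolding split_beta'
    proof (intro borel_measurable_prod borel_measurable_times measurable_const measurable_wk)
      have [measurable_cong]: "sets \<Omega> = sets Bits" by (rule \<Omega>.sets_M)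
      show "fst \<in> \<Omega> \<Otimes>\<^sub>M ?C \<rightarrow>\<^sub>M Bits" by measurable
      fix p assume "p \<in> prs ?V"
      then show "(\<lambda>a. snd a (fst p)) \<in> borel_measurable (\<Omega> \<Otimes>\<^sub>M ?C)" "(\<lambda>a. snd a (snd p)) \<in> borel_measurable (\<Omega> \<Otimes>\<^sub>M ?C)"
        using prs_subset[of p ?V]
        by (auto intro!: measurable_compose[OF _ measurable_ident_unit01] measurable_compose[OF measurable_snd measurable_component_singleton])
    qed simp
    then show "(\<lambda>\<omega>. \<integral>u. (\<Prod>(i, j)\<in>prs ?V. d ^ ?e i j * wk (?e i j) \<omega> (u i) (u j)) \<partial>?C) \<in> borel_measurable \<Omega>"
      unfolding split_beta' by (intro sigma_finite_measure.borel_measurable_lebesgue_integral prob_space_imp_sigma_finite prob_space_cube) (simp add: split_beta')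
  qed (rule measurable_tden_mk)
  finally show ?thesis ..
qed

text \<open>
  By multiplicativity the density of \<open>F\<close> in the random kernel has the second moment
  \<open>f (F \<union> F) = (f F)\<^sup>2\<close>, hence variance 0.
\<close>

lemma AE_tden_mk: "AE \<omega> in \<Omega>. tden F (mk \<omega>) = f F"
proof -
  have int: "integrable \<Omega> (\<lambda>\<omega>. tden G (mk \<omega>))" for G
    by (rule \<Omega>.integrable_const_bound[OF _ measurable_tden_mk])
       (use abs_tden_mk_le in auto)
  have sq: "(tden F (mk \<omega>) - f F)\<^sup>2 = tden (disjoint_union F F) (mk \<omega>) - 2 * f F * tden F (mk \<omega>) + (f F)\<^sup>2" for \<omega>
    by (simp add: tden_disjoint_union[OF kernel_mk] power2_eq_square algebra_simps)
  have "(\<integral>\<omega>. (tden F (mk \<omega>) - f F)\<^sup>2 \<partial>\<Omega>) = f (disjoint_union F F) - 2 * f F * f F + (f F)\<^sup>2"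
    unfolding sq by (simp add: int integral_tden_mk \<Omega>.prob_space[simplified])
  also have "\<dots> = 0"
    using mult by (simp add: multiplicative_def power2_eq_square)
  finally have *: "(\<integral>\<omega>. (tden F (mk \<omega>) - f F)\<^sup>2 \<partial>\<Omega>) = 0" .
  have "integrable \<Omega> (\<lambda>\<omega>. (tden F (mk \<omega>) - f F)\<^sup>2)"
    unfolding sq by (simp add: int)
  then have "AE \<omega> in \<Omega>. (tden F (mk \<omega>) - f F)\<^sup>2 = 0"
    using * by (subst (asm) integral_nonneg_eq_0_iff_AE) auto
  then show ?thesis by simp
qed

end

declare One_nat_def [simp]

section \<open>Moment sequences and the weak topology\<close>

text \<open>\<open>err j m / n\<close> bounds the error when w (j + m) is replaced by the mean of
  the j-th power of an average of n signs times a product of m signs. The term 2 * m accounts for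
  the at most m indices that collide with those signs, each costing at most 2.\<close>

primrec err :: "nat \<Rightarrow> nat \<Rightarrow> real" where
  "err 0 m = 0"
| "err (Suc j) m = err j (Suc m) + 2 * m"

text \<open>
  De Finetti: for exchangeable signs, the averages converge in mean, and the \<open>k\<close>-th moment of
  the limit is the correlation of \<open>k\<close> signs.
\<close>

theorem ex_measure_of_correlation:
  assumes w: "correlation (\<lambda>A. w (card A))" and d: "d > 0"
  shows "\<exists>\<mu>\<in>borel_prob_measures d. \<forall>k. (\<integral>s. s ^ k \<partial>\<mu>) = d ^ k * w k"
proof -
  have fm: "finite_measure unit01" using prob_space_unit01 by (simp add: prob_space_def)
  define b where "b = bits_of (\<lambda>A. w (card A))"
  have b [measurable]: "b \<in> unit01 \<rightarrow>\<^sub>M Bits" by (simp add: b_def)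
  have walsh_b: "(\<integral>u. walsh K (b u) \<partial>unit01) = w (card K)" if "finite K" for K
    unfolding b_def by (rule integral_walsh_bits_of[OF w that])
  define A where "A n u = (\<Sum>t<n. sgnb (b u t)) / real n" for n u
  have walsh_m [measurable]: "(\<lambda>u. walsh K (b u)) \<in> borel_measurable unit01" for K
    by (rule measurable_compose[OF b measurable_walsh])
  have A_m [measurable]: "A n \<in> borel_measurable unit01" for n
    unfolding A_def[abs_def] by measurable
  have A_le: "\<bar>A n u\<bar> \<le> 1" for n u
  proof -
    have "\<bar>\<Sum>t<n. sgnb (b u t)\<bar> \<le> (\<Sum>t<n. \<bar>sgnb (b u t)\<bar>)" by (rule sum_abs)
    also have "\<dots> = real n" by simp
    finally show ?thesis by (cases "n = 0") (simp_all add: A_def divide_le_eq_1)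
  qed
  have int: "integrable unit01 g" if "g \<in> borel_measurable unit01" "\<And>u. \<bar>g u\<bar> \<le> 1" for g :: "real \<Rightarrow> real"
    using that by (intro finite_measure.integrable_const_bound[OF fm, where B=1]) auto
  have le1: "\<bar>\<integral>u. g u \<partial>unit01\<bar> \<le> 1" if "g \<in> borel_measurable unit01" "\<And>u. \<bar>g u\<bar> \<le> 1" for g :: "real \<Rightarrow> real"
  proof -
    have "\<bar>\<integral>u. g u \<partial>unit01\<bar> \<le> (\<integral>u. \<bar>g u\<bar> \<partial>unit01)" by (rule integral_abs_bound)
    also have "\<dots> \<le> 1" using that by (intro prob_space.integral_le_const[OF prob_space_unit01] integrable_abs int) auto
    finally show ?thesis .
  qed
  have w_le: "\<bar>w k\<bar> \<le> 1" for k
    using le1[of "\<lambda>u. walsh {..<k} (b u)"] walsh_b[of "{..<k}"] by simp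
  have prod_le: "\<bar>A n u ^ j * walsh K (b u)\<bar> \<le> 1" for n u j K
    using A_le[of n u] by (simp add: abs_mult power_abs power_le_one)
  have prod_le': "\<bar>A n u ^ j * (sgnb (b u t) * walsh K (b u))\<bar> \<le> 1" for n u j K t
    using A_le[of n u] by (simp add: abs_mult power_abs power_le_one)
  \<comment> \<open>One factor \<open>A n\<close> is expanded: a sign with index t outside
    \<open>K\<close> joins the character, for t in \<open>K\<close> the trivial bound is
    used.\<close>
  have approx: "\<bar>(\<integral>u. A n u ^ j * walsh K (b u) \<partial>unit01) - w (j + card K)\<bar> \<le> err j (card K) / n"
    if "finite K" "n > 0" for n j K
    using that
  proof (induction j arbitrary: K)
    case 0
    then show ?case by (simp add: walsh_b)
  next
    case (Suc j)
    let ?I = "\<lambda>t. \<integral>u. A n u ^ j * (sgnb (b u t) * walsh K (b u)) \<partial>unit01"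
    let ?w = "w (Suc j + card K)" and ?e = "err j (Suc (card K)) / n"
    have "A n u ^ Suc j * walsh K (b u) = (\<Sum>t<n. A n u ^ j * (sgnb (b u t) * walsh K (b u))) / n" for u
      by (simp add: A_def[of n u] sum_distrib_left sum_distrib_right sum_divide_distrib mult_ac)
    then have "(\<integral>u. A n u ^ Suc j * walsh K (b u) \<partial>unit01) = (\<Sum>t<n. ?I t) / n"
      using prod_le' by (simp add: int Bochner_Integration.integral_sum)
    then have "(\<integral>u. A n u ^ Suc j * walsh K (b u) \<partial>unit01) - ?w = (\<Sum>t<n. ?I t - ?w) / n"
      using Suc.prems by (simp add: sum_subtractf diff_divide_distrib)
    also have "\<bar>\<dots>\<bar> \<le> (\<Sum>t<n. \<bar>?I t - ?w\<bar>) / n"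
      using Suc.prems by (simp add: abs_divide divide_right_mono)
    also have "\<dots> \<le> (\<Sum>t<n. ?e + (if t \<in> K then 2 else 0)) / n"
    proof (intro divide_right_mono sum_mono)
      fix t
      have e: "0 \<le> err j' m" for j' m by (induction j' arbitrary: m) auto
      show "\<bar>?I t - ?w\<bar> \<le> ?e + (if t \<in> K then 2 else 0)"
      proof (cases "t \<in> K")
        case True
        have "\<bar>?I t - ?w\<bar> \<le> \<bar>?I t\<bar> + \<bar>?w\<bar>" by (rule abs_triangle_ineq4)
        also have "\<dots> \<le> 1 + 1" using prod_le' by (intro add_mono le1 w_le) auto
        also have "\<dots> \<le> ?e + 2" using e by simp
        finally show ?thesis using True by simp
      next
        case False
        then show ?thesis
          using Suc.IH[of "insert t K"] Suc.prems by (simp add: walsh_insert)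
      qed
    qed simp
    also have "\<dots> = ?e + 2 * card ({..<n} \<inter> K) / n"
      using Suc.prems by (simp add: sum.distrib sum.If_cases add_divide_distrib)
    also have "\<dots> \<le> ?e + 2 * card K / n"
      using Suc.prems by (intro add_left_mono divide_right_mono mult_left_mono) (auto intro: card_mono)
    also have "\<dots> = err (Suc j) (card K) / n" by (simp add: add_divide_distrib)
    finally show ?case .
  qed
  have mixed: "\<bar>(\<integral>u. A n u * A m u \<partial>unit01) - w 2\<bar> \<le> 2 / n" if "n > 0" "m > 0" for n m
  proof -
    have "A n u * A m u = (\<Sum>t<m. A n u ^ 1 * walsh {t} (b u)) / m" for u
      by (simp add: A_def[of m u] sum_distrib_left walsh_def)
    then have "(\<integral>u. A n u * A m u \<partial>unit01) = (\<Sum>t<m. \<integral>u. A n u ^ 1 * walsh {t} (b u) \<partial>unit01) / m"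
      using prod_le[of n _ 1] by (simp add: int Bochner_Integration.integral_sum)
    then have "(\<integral>u. A n u * A m u \<partial>unit01) - w 2 = (\<Sum>t<m. (\<integral>u. A n u ^ 1 * walsh {t} (b u) \<partial>unit01) - w 2) / m"
      using that by (simp add: sum_subtractf diff_divide_distrib)
    also have "\<bar>\<dots>\<bar> \<le> (\<Sum>t<m. \<bar>(\<integral>u. A n u ^ 1 * walsh {t} (b u) \<partial>unit01) - w 2\<bar>) / m"
      using that by (simp add: abs_divide divide_right_mono)
    \<comment> \<open>Here 2 is \<open>err 1 1\<close>.\<close>
    also have "\<dots> \<le> (\<Sum>t<m. 2 / n) / m"
      using approx[of "{_}" n 1] that
      by (intro divide_right_mono sum_mono) (simp_all add: numeral_2_eq_2)
    also have "\<dots> = 2 / n" using that by simp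
    finally show ?thesis .
  qed
  \<comment> \<open>2/n and 2/m come from the two squares, and 4/n from twice the mixed
    term.\<close>
  have L2: "(\<integral>u. (A n u - A m u)\<^sup>2 \<partial>unit01) \<le> 6 / n + 2 / m" if "n > 0" "m > 0" for n m
  proof -
    have i: "integrable unit01 (\<lambda>u. A k u * A l u)" for k l
      using A_le by (intro int) (auto simp: abs_mult intro: mult_le_one)
    have "(\<integral>u. (A n u - A m u)\<^sup>2 \<partial>unit01) =
        (\<integral>u. A n u * A n u \<partial>unit01) - 2 * (\<integral>u. A n u * A m u \<partial>unit01) + (\<integral>u. A m u * A m u \<partial>unit01)"
    proof -
      have "(A n u - A m u)\<^sup>2 = A n u * A n u - 2 * (A n u * A m u) + A m u * A m u" for u
        by (simp add: power2_eq_square algebra_simps)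
      then show ?thesis by (simp add: i)
    qed
    then show ?thesis
      using mixed[OF that] mixed[OF that(1) that(1)] mixed[OF that(2) that(2)] by linarith
  qed
  have Cauchy_L1: "\<exists>N. \<forall>i\<ge>N. \<forall>j\<ge>N. (\<integral>u. norm (A (Suc i) u - A (Suc j) u) \<partial>unit01) < e" if e: "e > 0" for e
  proof -
    \<comment> \<open>If both indices exceed 32 / e^2, then 6/n + 2/m < 8 e^2 / 32 = e^2 /
      4.\<close>
    obtain N where N: "32 / e\<^sup>2 < real N" using reals_Archimedean2 by blast
    have "(\<integral>u. norm (A (Suc i) u - A (Suc j) u) \<partial>unit01) < e" if "i \<ge> N" "j \<ge> N" for i j
    proof -
      let ?D = "\<lambda>u. A (Suc i) u - A (Suc j) u"
      have i: "integrable unit01 (\<lambda>u. (?D u)\<^sup>2)" "integrable unit01 ?D"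
      proof -
        show "integrable unit01 ?D" using A_le by (intro Bochner_Integration.integrable_diff int) auto
        have "\<bar>?D u\<bar> \<le> 2" for u using A_le[of "Suc i" u] A_le[of "Suc j" u] by linarith
        then have "(?D u)\<^sup>2 \<le> 2\<^sup>2" for u by (intro abs_le_square_iff[THEN iffD1]) simp
        then show "integrable unit01 (\<lambda>u. (?D u)\<^sup>2)"
          by (intro finite_measure.integrable_const_bound[OF fm, where B="2\<^sup>2"]) auto
      qed
      have "32 / e\<^sup>2 < real (Suc i)" "32 / e\<^sup>2 < real (Suc j)" using N that by linarith+
      then have "32 / real (Suc i) < e\<^sup>2" "32 / real (Suc j) < e\<^sup>2"
        using e by (simp_all add: field_simps)
      then have E: "(\<integral>u. (?D u)\<^sup>2 \<partial>unit01) < e\<^sup>2 / 4"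
        using L2[of "Suc i" "Suc j"] by simp
      \<comment> \<open>The inequality of arithmetic and geometric means passes from mean squares to
        means: the result is below e/2 + e/8.\<close>
      have am: "norm (?D u) \<le> e / 2 + (?D u)\<^sup>2 * (1 / (2 * e))" for u
      proof -
        have "0 \<le> (norm (?D u) - e)\<^sup>2" by simp
        then have "2 * e * norm (?D u) \<le> e * e + (?D u)\<^sup>2"
          by (simp add: power2_eq_square algebra_simps)
        then show ?thesis using e by (simp add: field_simps)
      qed
      have "(\<integral>u. norm (?D u) \<partial>unit01) \<le> (\<integral>u. e / 2 + (?D u)\<^sup>2 * (1 / (2 * e)) \<partial>unit01)"
        using i am by (intro integral_mono) auto
      also have "\<dots> = e / 2 + (\<integral>u. (?D u)\<^sup>2 \<partial>unit01) * (1 / (2 * e))"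
        using i by (simp add: prob_space.prob_space[OF prob_space_unit01, simplified])
      also have "\<dots> < e / 2 + e\<^sup>2 / 4 * (1 / (2 * e))"
        using E e by (intro add_strict_left_mono mult_strict_right_mono) auto
      also have "\<dots> \<le> e" using e by (simp add: power2_eq_square)
      finally show ?thesis .
    qed
    then show ?thesis by blast
  qed
  have "integrable unit01 (A (Suc n))" for n using A_le by (intro int) auto
  from cauchy_L1_AE_cauchy_subseq[OF this Cauchy_L1] obtain r where r: "strict_mono r"
    and AE_Cauchy: "AE u in unit01. Cauchy (\<lambda>i. A (Suc (r i)) u)" by blast
  \<comment> \<open>Clamping keeps |X| <= 1 also on the null set where the averages do not
    converge.\<close>
  define X where "X u = max (-1) (min 1 (lim (\<lambda>i. A (Suc (r i)) u)))" for u
  have X_m [measurable]: "X \<in> borel_measurable unit01"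
    unfolding X_def[abs_def] by (intro borel_measurable_max borel_measurable_min borel_measurable_const borel_measurable_lim_metric A_m)
  have X_le: "\<bar>X u\<bar> \<le> 1" for u by (auto simp: X_def)
  have AE_lim: "AE u in unit01. (\<lambda>i. A (Suc (r i)) u) \<longlonglongrightarrow> X u"
    using AE_Cauchy
  proof eventually_elim
    case (elim u)
    then have L: "(\<lambda>i. A (Suc (r i)) u) \<longlonglongrightarrow> lim (\<lambda>i. A (Suc (r i)) u)"
      by (simp add: Cauchy_convergent_iff convergent_LIMSEQ_iff)
    then have "(\<lambda>i. \<bar>A (Suc (r i)) u\<bar>) \<longlonglongrightarrow> \<bar>lim (\<lambda>i. A (Suc (r i)) u)\<bar>" by (rule tendsto_rabs)
    then have "\<bar>lim (\<lambda>i. A (Suc (r i)) u)\<bar> \<le> 1"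
      by (rule LIMSEQ_le_const2) (use A_le in auto)
    then have "X u = lim (\<lambda>i. A (Suc (r i)) u)" unfolding X_def by (rule clamp)
    with L show ?case by simp
  qed
  have X_moment: "(\<integral>u. X u ^ k \<partial>unit01) = w k" for k
  proof -
    have "(\<lambda>i. \<integral>u. A (Suc (r i)) u ^ k \<partial>unit01) \<longlonglongrightarrow> (\<integral>u. X u ^ k \<partial>unit01)"
    proof (rule integral_dominated_convergence[where w="\<lambda>_. 1"])
      show "AE u in unit01. (\<lambda>i. A (Suc (r i)) u ^ k) \<longlonglongrightarrow> X u ^ k"
        using AE_lim by eventually_elim (rule tendsto_power)
      show "AE u in unit01. norm (A (Suc (r i)) u ^ k) \<le> 1" for i
        using A_le by (simp add: power_abs power_le_one)
    qed auto
    moreover have "(\<lambda>i. \<integral>u. A (Suc (r i)) u ^ k \<partial>unit01) \<longlonglongrightarrow> w k"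
    proof (rule LIMSEQ_I)
      fix e :: real assume e: "e > 0"
      obtain N where N: "err k 0 / e < real N" using reals_Archimedean2 by blast
      have "norm ((\<integral>u. A (Suc (r i)) u ^ k \<partial>unit01) - w k) < e" if "i \<ge> N" for i
      proof -
        have "N \<le> r i" using that seq_suble[OF r, of i] by simp
        then have "err k 0 / e < real (Suc (r i))" using N by linarith
        then have "err k 0 / real (Suc (r i)) < e" using e by (simp add: field_simps)
        with approx[of "{}" "Suc (r i)" k] show ?thesis by simp
      qed
      then show "\<exists>N. \<forall>i\<ge>N. norm ((\<integral>u. A (Suc (r i)) u ^ k \<partial>unit01) - w k) < e" by blast
    qed
    ultimately show ?thesis by (rule LIMSEQ_unique)
  qed
  define \<mu> where "\<mu> = distr unit01 (restrict_space borel {-d..d}) (\<lambda>u. d * X u)"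
  have dX: "(\<lambda>u. d * X u) \<in> unit01 \<rightarrow>\<^sub>M restrict_space borel {-d..d}"
  proof (rule measurable_restrict_space2)
    have "\<bar>d * X u\<bar> \<le> d" for u using X_le[of u] d by (simp add: abs_mult)
    then show "(\<lambda>u. d * X u) \<in> space unit01 \<rightarrow> {-d..d}" by (auto simp: abs_le_iff minus_le_iff)
  qed measurable
  have "\<mu> \<in> borel_prob_measures d"
    unfolding borel_prob_measures_def \<mu>_def by (simp add: prob_space.prob_space_distr[OF prob_space_unit01 dX])
  moreover have "(\<integral>s. s ^ k \<partial>\<mu>) = d ^ k * w k" for k
    unfolding \<mu>_def by (subst integral_distr[OF dX]) (simp_all add: power_mult_distrib X_moment)
  ultimately show ?thesis by blast
qed

text \<open>For a subbasic set, a polynomial within e/4 of the test function costs e/4 at each of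
  the two measures, and close moments cost less than e/2. A single N serves as number of moments and
  as precision, so finite intersections only need a maximum.\<close>

lemma open_weak_topology_moments:
  assumes "openin (weak_topology d) U" "\<mu> \<in> U"
  shows "\<exists>N. \<forall>\<nu>\<in>borel_prob_measures d.
    (\<forall>k\<le>N. \<bar>(\<integral>s. s ^ k \<partial>\<nu>) - (\<integral>s. s ^ k \<partial>\<mu>)\<bar> < 1 / real (Suc N)) \<longrightarrow> \<nu> \<in> U"
proof -
  let ?P = "borel_prob_measures d" and ?m = "\<lambda>k \<mu>. \<integral>s. s ^ k \<partial>(\<mu> :: real measure)"
  have "generate_topology_on {{\<mu> \<in> ?P. (\<integral>s. g s \<partial>\<mu>) \<in> U} | (g :: real \<Rightarrow> real) U. continuous_on {-d..d} g \<and> open U} U"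
    using assms(1) by (simp add: weak_topology_def openin_topology_generated_by_iff)
  then show ?thesis using assms(2)
  proof (induction arbitrary: \<mu>)
    case Empty
    then show ?case by simp
  next
    case (Int A B)
    from Int.IH(1)[of \<mu>] Int.prems obtain N1
      where N1: "\<forall>\<nu>\<in>?P. (\<forall>k\<le>N1. \<bar>?m k \<nu> - ?m k \<mu>\<bar> < 1 / real (Suc N1)) \<longrightarrow> \<nu> \<in> A" by auto
    from Int.IH(2)[of \<mu>] Int.prems obtain N2
      where N2: "\<forall>\<nu>\<in>?P. (\<forall>k\<le>N2. \<bar>?m k \<nu> - ?m k \<mu>\<bar> < 1 / real (Suc N2)) \<longrightarrow> \<nu> \<in> B" by auto
    define N where "N = max N1 N2"
    have N: "N1 \<le> N" "N2 \<le> N" by (simp_all add: N_def)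
    have le: "1 / real (Suc N) \<le> 1 / real (Suc N1)" "1 / real (Suc N) \<le> 1 / real (Suc N2)"
      using N by (simp_all add: frac_le)
    have "\<nu> \<in> A \<inter> B" if \<nu>: "\<nu> \<in> ?P" and close: "\<forall>k\<le>N. \<bar>?m k \<nu> - ?m k \<mu>\<bar> < 1 / real (Suc N)" for \<nu>
    proof
      show "\<nu> \<in> A" using N1 \<nu> close N(1) le(1) by (blast intro: order_trans less_le_trans)
      show "\<nu> \<in> B" using N2 \<nu> close N(2) le(2) by (blast intro: order_trans less_le_trans)
    qed
    then show ?case by blast
  next
    case (UN K)
    from UN.prems obtain A where A: "A \<in> K" "\<mu> \<in> A" by auto
    from UN.IH[OF A] obtain N where
      "\<forall>\<nu>\<in>?P. (\<forall>k\<le>N. \<bar>?m k \<nu> - ?m k \<mu>\<bar> < 1 / real (Suc N)) \<longrightarrow> \<nu> \<in> A" ..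
    then show ?case using A(1) by (intro exI[of _ N]) blast
  next
    case (Basis S)
    then obtain g :: "real \<Rightarrow> real" and V where S: "S = {\<mu> \<in> ?P. (\<integral>s. g s \<partial>\<mu>) \<in> V}"
      and g: "continuous_on {-d..d} g" and V: "open V" by blast
    have \<mu>: "\<mu> \<in> ?P" "(\<integral>s. g s \<partial>\<mu>) \<in> V" using Basis.prems S by auto
    obtain e where e: "e > 0" "\<And>x. dist x (\<integral>s. g s \<partial>\<mu>) < e \<Longrightarrow> x \<in> V"
      using V \<mu>(2) unfolding open_dist by blast
    obtain h where h: "real_polynomial_function h" "\<And>s. s \<in> {-d..d} \<Longrightarrow> \<bar>g s - h s\<bar> < e / 4"
      using Stone_Weierstrass_real_polynomial_function[OF _ g, of "e / 4"] e(1) by auto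
    obtain a n where a: "h = (\<lambda>s. \<Sum>i\<le>n. a i * s ^ i)"
      using h(1) unfolding real_polynomial_function_iff_sum by blast
    define C where "C = (\<Sum>i\<le>n. \<bar>a i\<bar>)"
    obtain N0 where N0: "2 * C / e < real N0" using reals_Archimedean2 by blast
    define N where "N = max n N0"
    have "2 * C / e < real (Suc N)" using N0 by (simp add: N_def)
    then have CN: "C * (1 / real (Suc N)) < e / 2" using e(1) by (simp add: field_simps)
    have gm: "g \<in> borel_measurable (restrict_space borel {-d..d})"
      by (rule borel_measurable_continuous_on_restrict[OF g])
    obtain B where B: "\<And>s. s \<in> {-d..d} \<Longrightarrow> \<bar>g s\<bar> \<le> B"
    proof -
      have "compact (g ` {-d..d})" by (rule compact_continuous_image[OF g]) simp
      then show thesis using that by (metis compact_imp_bounded bounded_iff imageI real_norm_def)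
    qed
    have diff: "\<bar>(\<integral>s. g s \<partial>\<nu>) - (\<Sum>i\<le>n. a i * ?m i \<nu>)\<bar> \<le> e / 4" if \<nu>: "\<nu> \<in> ?P" for \<nu>
    proof -
      have ip: "integrable \<nu> (\<lambda>s. s ^ k)" for k
        by (rule integrable_borel_prob_measures(1)[OF \<nu>]) (auto intro: abs_power_le)
      have ig: "integrable \<nu> g" by (rule integrable_borel_prob_measures(1)[OF \<nu> gm B])
      have "(\<integral>s. g s \<partial>\<nu>) - (\<Sum>i\<le>n. a i * ?m i \<nu>) = (\<integral>s. g s - h s \<partial>\<nu>)"
        unfolding a by (simp add: ip ig)
      also have "\<bar>\<dots>\<bar> \<le> e / 4"
      proof (rule integrable_borel_prob_measures(2)[OF \<nu>])
        show "(\<lambda>s. g s - h s) \<in> borel_measurable (restrict_space borel {-d..d})"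
          unfolding a by (intro borel_measurable_diff gm borel_measurable_sum borel_measurable_times) simp_all
      qed (use h(2) in \<open>auto intro: less_imp_le\<close>)
      finally show ?thesis .
    qed
    have "\<nu> \<in> S" if \<nu>: "\<nu> \<in> ?P" and close: "\<forall>k\<le>N. \<bar>?m k \<nu> - ?m k \<mu>\<bar> < 1 / real (Suc N)" for \<nu>
    proof -
      have "\<bar>(\<Sum>i\<le>n. a i * ?m i \<nu>) - (\<Sum>i\<le>n. a i * ?m i \<mu>)\<bar> = \<bar>\<Sum>i\<le>n. a i * (?m i \<nu> - ?m i \<mu>)\<bar>"
        by (simp add: sum_subtractf right_diff_distrib)
      also have "\<dots> \<le> (\<Sum>i\<le>n. \<bar>a i * (?m i \<nu> - ?m i \<mu>)\<bar>)" by (rule sum_abs)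
      also have "\<dots> \<le> (\<Sum>i\<le>n. \<bar>a i\<bar> * (1 / real (Suc N)))"
        unfolding abs_mult
      proof (intro sum_mono mult_left_mono)
        fix i assume "i \<in> {..n}"
        then have "i \<le> N" by (simp add: N_def)
        with close show "\<bar>?m i \<nu> - ?m i \<mu>\<bar> \<le> 1 / real (Suc N)" by (blast intro: less_imp_le)
      qed simp
      also have "\<dots> = C * (1 / real (Suc N))" by (simp only: C_def sum_distrib_right)
      finally have "\<bar>(\<integral>s. g s \<partial>\<nu>) - (\<integral>s. g s \<partial>\<mu>)\<bar> < e"
        using diff[OF \<nu>] diff[OF \<mu>(1)] CN by linarith
      then show ?thesis using e(2) \<nu> by (simp add: S dist_real_def)
    qed
    then show ?case by blast
  qed
qed

text \<open>
  The moments embed the measures on \<open>[-d, d]\<close> into the second countable space of real sequences.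
\<close>

lemma measurable_weak_borelI:
  assumes \<phi>: "\<phi> \<in> space M \<rightarrow> borel_prob_measures d"
    and moments: "\<And>k. (\<lambda>x. \<integral>s. s ^ k \<partial>\<phi> x) \<in> borel_measurable M"
  shows "\<phi> \<in> M \<rightarrow>\<^sub>M weak_borel d"
  unfolding weak_borel_def
proof (rule measurable_measure_of)
  show "{U. openin (weak_topology d) U} \<subseteq> Pow (borel_prob_measures d)"
    using topspace_weak_topology by blast
  show "\<phi> \<in> space M \<rightarrow> borel_prob_measures d" by (rule \<phi>)
  fix U assume "U \<in> {U. openin (weak_topology d) U}"
  then have U: "openin (weak_topology d) U" by simp
  define mom where "mom \<mu> k = (\<integral>s. s ^ k \<partial>\<mu>)" for \<mu> :: "real measure" and k :: nat
  have mom: "(\<lambda>x. mom (\<phi> x)) \<in> borel_measurable M"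
    by (rule measurable_coordinatewise_then_product) (simp add: mom_def moments)
  obtain N where N: "\<And>\<mu> \<nu>. \<mu> \<in> U \<Longrightarrow> \<nu> \<in> borel_prob_measures d \<Longrightarrow>
      (\<And>k. k \<le> N \<mu> \<Longrightarrow> \<bar>mom \<nu> k - mom \<mu> k\<bar> < 1 / real (Suc (N \<mu>))) \<Longrightarrow> \<nu> \<in> U"
    using open_weak_topology_moments[OF U] unfolding mom_def by metis
  \<comment> \<open>The union may be uncountable but is open, so its preimage under the Borel map
    \<open>mom\<close> is measurable; second countability enters through the measurability of
    \<open>mom\<close>.\<close>
  define O' where "O' = (\<Union>\<mu>\<in>U. \<Inter>k\<in>{..N \<mu>}. {z :: nat \<Rightarrow> real. \<bar>z k - mom \<mu> k\<bar> < 1 / real (Suc (N \<mu>))})"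
  have "open {z :: nat \<Rightarrow> real. \<bar>z k - c\<bar> < e}" for k c e
    by (intro open_Collect_less continuous_intros continuous_on_product_coordinates)
  then have "open O'" unfolding O'_def by (intro open_UN ballI open_INT) auto
  then have "(\<lambda>x. mom (\<phi> x)) -` O' \<inter> space M \<in> sets M"
    by (intro measurable_sets[OF mom]) simp
  also have "(\<lambda>x. mom (\<phi> x)) -` O' \<inter> space M = \<phi> -` U \<inter> space M"
  proof (intro equalityI subsetI)
    fix x assume x: "x \<in> (\<lambda>x. mom (\<phi> x)) -` O' \<inter> space M"
    then obtain \<mu> where \<mu>: "\<mu> \<in> U" "\<And>k. k \<le> N \<mu> \<Longrightarrow> \<bar>mom (\<phi> x) k - mom \<mu> k\<bar> < 1 / real (Suc (N \<mu>))"
      by (auto simp: O'_def)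
    have "\<phi> x \<in> borel_prob_measures d" using x \<phi> by auto
    then have "\<phi> x \<in> U" by (rule N[OF \<mu>(1) _ \<mu>(2)])
    with x show "x \<in> \<phi> -` U \<inter> space M" by simp
  next
    fix x assume "x \<in> \<phi> -` U \<inter> space M"
    then show "x \<in> (\<lambda>x. mom (\<phi> x)) -` O' \<inter> space M"
      by (auto simp: O'_def intro!: bexI[of _ "\<phi> x"])
  qed
  finally show "\<phi> -` U \<inter> space M \<in> sets M" .
qed

text \<open>Allows one realization of the random kernel to have the right density for all
  multigraphs at once.\<close>

lemma countable_multigraphs: "countable (UNIV :: multigraph set)"
proof -
  \<comment> \<open>The diagonal triples (i, i, 0) record every node, isolated ones
    included.\<close>
  define enc where "enc F = (\<lambda>(i, j). (i, j, edge_mult F i j)) ` (nodes F \<times> nodes F)" for F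
  have nodes: "nodes F = fst ` enc F" for F by (force simp: enc_def)
  have "inj enc"
  proof (rule injI)
    fix F G assume eq: "enc F = enc G"
    then have n: "nodes F = nodes G" by (simp only: nodes)
    have "edge_mult F i j = edge_mult G i j" for i j
    proof (cases "i \<in> nodes F \<and> j \<in> nodes F")
      case True
      then have "(i, j, edge_mult F i j) \<in> enc F" by (force simp: enc_def)
      then show ?thesis unfolding eq by (auto simp: enc_def)
    next
      case False
      then show ?thesis using n edge_mult_outside[of i F j] edge_mult_outside[of i G j] by auto
    qed
    with n show "F = G" by (rule multigraph_eqI)
  qed
  moreover have "countable (range enc)"
    by (rule countable_subset[OF _ countable_Collect_finite]) (auto simp: enc_def)
  ultimately show ?thesis by (simp add: countable_image_inj_eq)
qed

section \<open>Choice of the graphon\<close>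

lemma correlation_trivial: "correlation (\<lambda>A. of_bool (card A = 0))"
  unfolding correlation_def
proof (intro conjI allI)
  fix s :: "bool list"
  have "0 \<le> (\<Prod>i\<in>A. sgnb (s ! i)) * of_bool (card A = 0)" if "A \<in> Pow {..<length s}" for A
  proof -
    have "finite A" using that finite_subset by auto
    then show ?thesis by (cases "A = {}") auto
  qed
  then show "0 \<le> genp (\<lambda>A. of_bool (card A = 0)) s"
    unfolding genp_def by (intro divide_nonneg_nonneg sum_nonneg) auto
qed simp

lemma (in rp_parameter) ex_measure_mk:
  "\<exists>\<mu>\<in>borel_prob_measures d. \<forall>k. (\<integral>s. s ^ k \<partial>\<mu>) = mk \<omega> k x y"
proof (cases "good \<omega> x y")
  case True
  then have "correlation (\<lambda>A. wk (card A) \<omega> x y)" unfolding good_def by (rule conjunct1)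
  from ex_measure_of_correlation[OF this d_pos] show ?thesis
    using True by (simp add: mk_def)
next
  case False
  have "d ^ k * of_bool (k = 0) = mk \<omega> k x y" for k
    using False by (simp add: mk_def power_0_left)
  with ex_measure_of_correlation[OF correlation_trivial d_pos] show ?thesis by simp
qed

theorem (in rp_parameter) ex_graphon: "\<exists>W. graphon d W \<and> (\<forall>F. f F = hom_density F W)"
proof -
  have "AE \<omega> in \<Omega>. \<forall>F\<in>UNIV. tden F (mk \<omega>) = f F"
    by (rule AE_ball_countable[THEN iffD2, OF countable_multigraphs]) (simp add: AE_tden_mk)
  note AE = this
  have "\<exists>\<omega>. \<forall>F\<in>UNIV. tden F (mk \<omega>) = f F"
  proof (rule ccontr)
    assume none: "\<not> ?thesis"
    from AE have "AE \<omega> in \<Omega>. False" by eventually_elim (use none in blast)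
    then show False by simp
  qed
  then obtain \<omega> where \<omega>: "\<And>F. tden F (mk \<omega>) = f F" by blast
  \<comment> \<open>The choice depends on (x, y) only through the moment sequence, so symmetry of
    the moments gives symmetry of \<open>W\<close>; measurability is also read off from the moments,
    without a measurable selection.\<close>
  define W where "W x y = (SOME \<mu>. \<mu> \<in> borel_prob_measures d \<and> (\<forall>k. (\<integral>s. s ^ k \<partial>\<mu>) = mk \<omega> k x y))" for x y
  have W: "W x y \<in> borel_prob_measures d" "(\<integral>s. s ^ k \<partial>W x y) = mk \<omega> k x y" for x y k
    using someI_ex[OF ex_measure_mk[of \<omega> x y, unfolded Bex_def]] unfolding W_def by blast+
  have good_sym: "good \<omega> y x" "mk \<omega> k x y = mk \<omega> k y x" if "good \<omega> x y" for k x y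
  proof -
    have eq: "wk k \<omega> x y = wk k \<omega> y x" for k using that unfolding good_def by blast
    have "correlation (\<lambda>A. wk (card A) \<omega> x y)" using that unfolding good_def by blast
    also have "(\<lambda>A :: nat set. wk (card A) \<omega> x y) = (\<lambda>A. wk (card A) \<omega> y x)" by (rule ext) (rule eq)
    finally show *: "good \<omega> y x" unfolding good_def using eq[symmetric] by blast
    show "mk \<omega> k x y = mk \<omega> k y x" unfolding mk_def eq[of k] using that * by simp
  qed
  have mk_sym: "mk \<omega> k x y = mk \<omega> k y x" for k x y
  proof (cases "good \<omega> x y")
    case False
    then have "\<not> good \<omega> y x" using good_sym(1) by blast
    with False show ?thesis by (simp add: mk_def)
  qed (rule good_sym(2))
  have "graphon d W"
    unfolding graphon_def
  proof (intro conjI ballI)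
    show "W x y = W y x" for x y unfolding W_def mk_sym[of _ x y] ..
    let ?S = "{0..1} \<times> {0..1} :: (real \<times> real) set"
    have "(\<lambda>p. mk \<omega> k (fst p) (snd p)) \<in> borel_measurable (lebesgue_on ?S)" for k
    proof (rule measurable_mk)
      have "fst \<in> borel_measurable (borel :: (real \<times> real) measure)" "snd \<in> borel_measurable (borel :: (real \<times> real) measure)"
        by (simp_all add: borel_measurable_continuous_onI continuous_on_fst continuous_on_snd)
      then show "fst \<in> borel_measurable (lebesgue_on ?S)" "snd \<in> borel_measurable (lebesgue_on ?S)"
        by (auto intro!: measurable_restrict_space1 measurable_completion)
    qed simp
    then show "(\<lambda>(x, y). W x y) \<in> lebesgue_on ?S \<rightarrow>\<^sub>M weak_borel d"
      by (intro measurable_weak_borelI) (auto simp: W split_beta')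
  qed
  moreover have "f F = hom_density F W" for F
    using hom_density_eq_tden[OF kernel_mk, of W \<omega> F] by (simp add: moment_def W \<omega>)
  ultimately show ?thesis by blast
qed

theorem theorem3p3:
  fixes d :: real and f :: "multigraph \<Rightarrow> real"
  assumes "d > 0" and "graph_parameter f"
  shows "(\<exists>W. graphon d W \<and> (\<forall>F. f F = hom_density F W)) \<longleftrightarrow>
    normalized f \<and> multiplicative f \<and> weakly_reflection_positive f \<and>
    (\<forall>k. \<bar>f (K2 k)\<bar> \<le> d ^ k)"
proof
  assume "\<exists>W. graphon d W \<and> (\<forall>F. f F = hom_density F W)"
  then obtain W where "graphon d W" "\<And>F. f F = hom_density F W" by blast
  then show "normalized f \<and> multiplicative f \<and> weakly_reflection_positive f \<and> (\<forall>k. \<bar>f (K2 k)\<bar> \<le> d ^ k)"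
    using assms(1) by (intro graphon_parameter_properties)
next
  assume "normalized f \<and> multiplicative f \<and> weakly_reflection_positive f \<and> (\<forall>k. \<bar>f (K2 k)\<bar> \<le> d ^ k)"
  then interpret rp_parameter f d
    using assms by unfold_locales auto
  show "\<exists>W. graphon d W \<and> (\<forall>F. f F = hom_density F W)" by (rule ex_graphon)
qed

end
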